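(* Let $E$ be a directed graph, $\mathbb{K}$ a field, $L_{\mathbb{K}}(E)$ the associated Leavitt path algebra, and $\mathcal{C}(L_{\mathbb{K}}(E))$ its centroid. Then (isomorphisms being of $\mathbb{K}$-algebras): 1. If $L_{\mathbb{K}}(E)$ is simple, then $\mathcal{C}(L_{\mathbb{K}}(E))\cong\mathbb{K}$. 2. If $E$ is row-finite and $L_{\mathbb{K}}(E)$ is graded simple and non-simple, then the graph $E$ is a comet and $\mathcal{C}(L_{\mathbb{K}}(E))\cong\mathbb{K}[x,x^{-1}]$. 3. If $L_{\mathbb{K}}(E)$ is prime and $E$ is acyclic, then $\mathcal{C}(L_{\mathbb{K}}(E))\cong\mathbb{K}$. 4. If $L_{\mathbb{K}}(E)$ is prime and there is a cycle with exits in $E$, then $\mathcal{C}(L_{\mathbb{K}}(E))\cong\mathbb{K}$. 5. If $L_{\mathbb{K}}(E)$ is prime and there is an infinite emitter in $E$ which is not the base of a cycle, then $\mathcal{C}(L_{\mathbb{K}}(E))\cong\mathbb{K}$. 6. Suppose that $E$ is row-finite, $L_{\mathbb{K}}(E)$ is prime, and $E$ has a unique cycle, and this cycle has no exits. If $E$ is not a comet then $\mathcal{C}(L_{\mathbb{K}}(E))\cong\mathbb{K}$, and if $E$ is a comet then $\mathcal{C}(L_{\mathbb{K}}(E))\cong\mathbb{K}[x,x^{-1}]$.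
   Context: A directed graph $E=(E^0,E^1,r,s)$ consists of disjoint sets $E^0$ (vertices) and $E^1$ (edges), of arbitrary cardinality, and maps $r,s:E^1\to E^0$ (range and source). A vertex $v$ is a sink if $s^{-1}(v)=\emptyset$, an infinite emitter if $s^{-1}(v)$ is infinite, and regular otherwise. $E$ is row-finite if it has no infinite emitters. A path is a vertex (length $0$) or a finite sequence $e_1\cdots e_n$ ($n\ge 1$) of edges with $r(e_i)=s(e_{i+1})$; its source is $s(e_1)$ and its range is $r(e_n)$. For a vertex $v$, $T(v)$ is the set of vertices $w$ such that there is a path from $v$ to $w$. A cycle is a nontrivial path $c=e_1\cdots e_n$ with $s(c)=r(c)$ and $s(e_i)\neq s(e_j)$ for $i\ne j$; it is based at the vertex $s(c)=r(c)$, and $c^0$ is the set of its vertices. When counting cycles, cyclic rotations of a cycle are regarded as the same cycle. An exit for $c=e_1\cdots e_n$ is an edge $e$ such that for some $i$, $s(e)=s(e_i)$ and $e\ne e_i$. $E$ is acyclic if it has no cycles. An infinite path is an infinite sequence of edges $f_0f_1\cdots$ with $r(f_i)=s(f_{i+1})$; it ends in the cycle $c$ if from some index on all its edges are edges of $c$. $E$ is a comet if it has exactly one cycle $c$, $T(v)\cap c^0\neq\emptyset$ for every $v\in E^0$, and every infinite path ends in the cycle $c$. The Leavitt path algebra $L_{\mathbb{K}}(E)$ is the associative (not necessarily unital) $\mathbb{K}$-algebra generated by $E^0\cup E^1\cup\{e^*: e\in E^1\}$ subject to: $vw=\delta_{v,w}v$ for $v,w\in E^0$; $s(e)e=e=e\,r(e)$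 and $r(e)e^*=e^*=e^*s(e)$ for $e\in E^1$; $e^*e'=\delta_{e,e'}r(e)$ for $e,e'\in E^1$; and $v=\sum_{s(e)=v}ee^*$ for every regular vertex $v$. It is $\mathbb{Z}$-graded with vertices in degree $0$, edges in degree $1$ and the elements $e^*$ in degree $-1$; graded simple means nonzero with no graded two-sided ideals other than $0$ and the whole algebra. The centroid $\mathcal{C}(A)$ of a $\mathbb{K}$-algebra $A$ is the algebra (under composition) of all $\mathbb{K}$-linear maps $\tau:A\to A$ with $\tau(xy)=\tau(x)y=x\tau(y)$ for all $x,y\in A$. *)

theory Defs
  imports
    "Graph_Theory.Graph_Theory"
    "HOL-Algebra.Congruence"
    "HOL-Library.FuncSet"
    "HOL-Library.Poly_Mapping"
begin

section \<open>Associative, not necessarily unital algebras over a field\<close>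

record ('k, 'a) kalgebra = "'a partial_object" +
  alg_add :: "'a \<Rightarrow> 'a \<Rightarrow> 'a"
  alg_zero :: 'a
  alg_mult :: "'a \<Rightarrow> 'a \<Rightarrow> 'a"
  alg_scale :: "'k \<Rightarrow> 'a \<Rightarrow> 'a"

definition alg_isomorphic :: "('k, 'a) kalgebra \<Rightarrow> ('k, 'b) kalgebra \<Rightarrow> bool" where
  "alg_isomorphic A B \<longleftrightarrow> (\<exists>h. bij_betw h (carrier A) (carrier B) \<and>
     (\<forall>x\<in>carrier A. \<forall>y\<in>carrier A. h (alg_add A x y) = alg_add B (h x) (h y)) \<and>
     (\<forall>x\<in>carrier A. \<forall>y\<in>carrier A. h (alg_mult A x y) = alg_mult B (h x) (h y)) \<and>
     (\<forall>c. \<forall>x\<in>carrier A. h (alg_scale A c x) = alg_scale B c (h x)))"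

definition alg_subspace :: "('k, 'a) kalgebra \<Rightarrow> 'a set \<Rightarrow> bool" where
  "alg_subspace A U \<longleftrightarrow> U \<subseteq> carrier A \<and> alg_zero A \<in> U \<and>
     (\<forall>x\<in>U. \<forall>y\<in>U. alg_add A x y \<in> U) \<and> (\<forall>c. \<forall>x\<in>U. alg_scale A c x \<in> U)"

definition alg_span :: "('k, 'a) kalgebra \<Rightarrow> 'a set \<Rightarrow> 'a set" where
  "alg_span A S = \<Inter>{U. alg_subspace A U \<and> S \<subseteq> U}"

definition alg_ideal :: "('k, 'a) kalgebra \<Rightarrow> 'a set \<Rightarrow> bool" where
  "alg_ideal A I \<longleftrightarrow> alg_subspace A I \<and>
     (\<forall>a\<in>carrier A. \<forall>x\<in>I. alg_mult A a x \<in> I \<and> alg_mult A x a \<in> I)"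

definition alg_ideal_generated :: "('k, 'a) kalgebra \<Rightarrow> 'a set \<Rightarrow> 'a set" where
  "alg_ideal_generated A S = \<Inter>{I. alg_ideal A I \<and> S \<subseteq> I}"

definition alg_coset :: "('k, 'a) kalgebra \<Rightarrow> 'a set \<Rightarrow> 'a \<Rightarrow> 'a set" where
  "alg_coset A I x = alg_add A x ` I"

definition alg_quotient :: "('k, 'a) kalgebra \<Rightarrow> 'a set \<Rightarrow> ('k, 'a set) kalgebra" where
  "alg_quotient A I = \<lparr>
     carrier = alg_coset A I ` carrier A,
     alg_add = (\<lambda>X Y. \<Union>x\<in>X. \<Union>y\<in>Y. alg_coset A I (alg_add A x y)),
     alg_zero = alg_coset A I (alg_zero A),
     alg_mult = (\<lambda>X Y. \<Union>x\<in>X. \<Union>y\<in>Y. alg_coset A I (alg_mult A x y)),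
     alg_scale = (\<lambda>c X. \<Union>x\<in>X. alg_coset A I (alg_scale A c x))\<rparr>"

definition alg_simple :: "('k, 'a) kalgebra \<Rightarrow> bool" where
  "alg_simple A \<longleftrightarrow> carrier A \<noteq> {alg_zero A} \<and>
     (\<forall>I. alg_ideal A I \<longrightarrow> I = {alg_zero A} \<or> I = carrier A)"

text \<open>For a family \<open>D n\<close> of homogeneous components, \<open>I\<close> is graded if it is the sum of the
  subspaces \<open>I \<inter> D n\<close>.\<close>

definition alg_graded_ideal :: "('k, 'a) kalgebra \<Rightarrow> (int \<Rightarrow> 'a set) \<Rightarrow> 'a set \<Rightarrow> bool" where
  "alg_graded_ideal A D I \<longleftrightarrow> alg_ideal A I \<and> I = alg_span A (\<Union>n. I \<inter> D n)"

definition alg_graded_simple :: "('k, 'a) kalgebra \<Rightarrow> (int \<Rightarrow> 'a set) \<Rightarrow> bool" where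
  "alg_graded_simple A D \<longleftrightarrow> carrier A \<noteq> {alg_zero A} \<and>
     (\<forall>I. alg_graded_ideal A D I \<longrightarrow> I = {alg_zero A} \<or> I = carrier A)"

text \<open>The zero algebra does not count as prime.\<close>

definition alg_prime :: "('k, 'a) kalgebra \<Rightarrow> bool" where
  "alg_prime A \<longleftrightarrow> carrier A \<noteq> {alg_zero A} \<and>
     (\<forall>I J. alg_ideal A I \<and> alg_ideal A J \<and> (\<forall>x\<in>I. \<forall>y\<in>J. alg_mult A x y = alg_zero A) \<longrightarrow>
        I = {alg_zero A} \<or> J = {alg_zero A})"

text \<open>Maps are taken to be extensional (\<open>undefined\<close> off the carrier), so that
  equality in the centroid is equality of maps on the carrier.\<close>

definition centroid :: "('k, 'a) kalgebra \<Rightarrow> ('k, 'a \<Rightarrow> 'a) kalgebra" where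
  "centroid A = \<lparr>
     carrier = {\<tau> \<in> carrier A \<rightarrow>\<^sub>E carrier A.
       (\<forall>x\<in>carrier A. \<forall>y\<in>carrier A. \<tau> (alg_add A x y) = alg_add A (\<tau> x) (\<tau> y)) \<and>
       (\<forall>c. \<forall>x\<in>carrier A. \<tau> (alg_scale A c x) = alg_scale A c (\<tau> x)) \<and>
       (\<forall>x\<in>carrier A. \<forall>y\<in>carrier A. \<tau> (alg_mult A x y) = alg_mult A (\<tau> x) y \<and>
          \<tau> (alg_mult A x y) = alg_mult A x (\<tau> y))},
     alg_add = (\<lambda>\<sigma> \<tau>. \<lambda>x\<in>carrier A. alg_add A (\<sigma> x) (\<tau> x)),
     alg_zero = (\<lambda>x\<in>carrier A. alg_zero A),
     alg_mult = compose (carrier A),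
     alg_scale = (\<lambda>c \<tau>. \<lambda>x\<in>carrier A. alg_scale A c (\<tau> x))\<rparr>"

definition base_field_algebra :: "('k::field, 'k) kalgebra" where
  "base_field_algebra = \<lparr>carrier = UNIV, alg_add = (+), alg_zero = 0, alg_mult = (*), alg_scale = (*)\<rparr>"

text \<open>The algebra of a subsemigroup \<open>M\<close> of a monoid: finitely supported functions
  on \<open>M\<close> with the convolution product.\<close>

definition semigroup_algebra ::
    "'m::monoid_add set \<Rightarrow> ('k::field, 'm \<Rightarrow>\<^sub>0 'k) kalgebra" where
  "semigroup_algebra M = \<lparr>
     carrier = {p. Poly_Mapping.keys p \<subseteq> M},
     alg_add = (+), alg_zero = 0, alg_mult = (*),
     alg_scale = (\<lambda>c. Poly_Mapping.map ((*) c))\<rparr>"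

text \<open>The Laurent polynomials in \<open>x\<close>, where \<open>x ^ n\<close> is \<open>Poly_Mapping.single n 1\<close> for \<open>n :: int\<close>.\<close>

definition laurent_algebra :: "('k::field, int \<Rightarrow>\<^sub>0 'k) kalgebra" where
  "laurent_algebra = semigroup_algebra UNIV"

text \<open>Words form a monoid under concatenation, written additively because
  \<open>\<Rightarrow>\<^sub>0\<close> takes its convolution from the additive structure on the exponents.\<close>

datatype 'g free_word = Free_Word (letters: "'g list")

instantiation free_word :: (type) monoid_add
begin

definition "0 = Free_Word []"
definition "u + v = Free_Word (letters u @ letters v)"

instance
  by standard (auto simp: zero_free_word_def plus_free_word_def)

end

definition free_algebra :: "'g set \<Rightarrow> ('k::field, 'g free_word \<Rightarrow>\<^sub>0 'k) kalgebra" where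
  "free_algebra X = semigroup_algebra {w. letters w \<noteq> [] \<and> set (letters w) \<subseteq> X}"


section \<open>Directed graphs\<close>

text \<open>A directed graph with arbitrarily many vertices and edges is a \<^locale>\<open>wf_digraph\<close>;
  the source map is \<open>tail\<close> and the range map is \<open>head\<close>.\<close>

definition sink :: "('v, 'e) pre_digraph \<Rightarrow> 'v \<Rightarrow> bool" where
  "sink E v \<longleftrightarrow> v \<in> verts E \<and> out_arcs E v = {}"

definition infinite_emitter :: "('v, 'e) pre_digraph \<Rightarrow> 'v \<Rightarrow> bool" where
  "infinite_emitter E v \<longleftrightarrow> v \<in> verts E \<and> infinite (out_arcs E v)"

definition regular_vertex :: "('v, 'e) pre_digraph \<Rightarrow> 'v \<Rightarrow> bool" where
  "regular_vertex E v \<longleftrightarrow> v \<in> verts E \<and> \<not> sink E v \<and> \<not> infinite_emitter E v"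

definition row_finite :: "('v, 'e) pre_digraph \<Rightarrow> bool" where
  "row_finite E \<longleftrightarrow> (\<nexists>v. infinite_emitter E v)"

definition vertex_tree :: "('v, 'e) pre_digraph \<Rightarrow> 'v \<Rightarrow> 'v set" where
  "vertex_tree E v = {w. \<exists>p. pre_digraph.awalk E v p w}"

text \<open>\<open>pre_digraph.cycle\<close> asks that the ranges of the edges of a nontrivial closed path be
  distinct; the sources are then distinct as well:\<close>

lemma (in wf_digraph) cycle_iff_distinct_sources:
  "cycle c \<longleftrightarrow> c \<noteq> [] \<and> (\<exists>u. awalk u c u) \<and> distinct (map (tail G) c)"
proof -
  have heads: "tl (awalk_verts u c) = map (head G) c" if "awalk u c v" for u v
    using that
  proof (induction c arbitrary: u)
    case (Cons e c)
    then have "awalk (head G e) c v" by (simp add: awalk_Cons_iff)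
    then have "awalk_verts (head G e) c = head G e # map (head G) c"
      using Cons.IH by (cases c) (auto simp: awalk_def)
    then show ?case by simp
  qed simp
  have shift: "map (tail G) c @ [v] = u # map (head G) c" if "awalk u c v" for u v
    using that by (induction c arbitrary: u) (auto simp: awalk_Cons_iff awalk_Nil_iff)
  have "distinct (map (tail G) c) \<longleftrightarrow> distinct (map (head G) c)" if "awalk u c u" for u
  proof -
    have "mset (map (tail G) c) = mset (map (head G) c)"
      using arg_cong[OF shift[OF that], of mset] by simp
    then show ?thesis by (metis mset_eq_imp_distinct_iff)
  qed
  then show ?thesis
    unfolding cycle_def using heads by metis
qed

definition same_cycle :: "'e list \<Rightarrow> 'e list \<Rightarrow> bool" where
  "same_cycle c d \<longleftrightarrow> (\<exists>n. d = rotate n c)"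

definition unique_cycle :: "('v, 'e) pre_digraph \<Rightarrow> 'e list \<Rightarrow> bool" where
  "unique_cycle E c \<longleftrightarrow> pre_digraph.cycle E c \<and> (\<forall>d. pre_digraph.cycle E d \<longrightarrow> same_cycle c d)"

definition cycle_verts :: "('v, 'e) pre_digraph \<Rightarrow> 'e list \<Rightarrow> 'v set" where
  "cycle_verts E c = tail E ` set c"

definition cycle_base :: "('v, 'e) pre_digraph \<Rightarrow> 'e list \<Rightarrow> 'v" where
  "cycle_base E c = tail E (hd c)"

definition has_exit :: "('v, 'e) pre_digraph \<Rightarrow> 'e list \<Rightarrow> bool" where
  "has_exit E c \<longleftrightarrow> (\<exists>e\<in>arcs E. \<exists>i<length c. tail E e = tail E (c ! i) \<and> e \<noteq> c ! i)"

definition acyclic_graph :: "('v, 'e) pre_digraph \<Rightarrow> bool" where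
  "acyclic_graph E \<longleftrightarrow> (\<nexists>c. pre_digraph.cycle E c)"

definition infinite_path :: "('v, 'e) pre_digraph \<Rightarrow> (nat \<Rightarrow> 'e) \<Rightarrow> bool" where
  "infinite_path E f \<longleftrightarrow> (\<forall>i. f i \<in> arcs E \<and> head E (f i) = tail E (f (Suc i)))"

definition ends_in_cycle :: "(nat \<Rightarrow> 'e) \<Rightarrow> 'e list \<Rightarrow> bool" where
  "ends_in_cycle f c \<longleftrightarrow> (\<exists>N. \<forall>i\<ge>N. f i \<in> set c)"

definition comet :: "('v, 'e) pre_digraph \<Rightarrow> bool" where
  "comet E \<longleftrightarrow> (\<exists>c. unique_cycle E c \<and>
     (\<forall>v\<in>verts E. vertex_tree E v \<inter> cycle_verts E c \<noteq> {}) \<and>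
     (\<forall>f. infinite_path E f \<longrightarrow> ends_in_cycle f c))"


section \<open>Leavitt path algebras\<close>

datatype ('v, 'e) lpa_gen = Vertex 'v | Edge 'e | Ghost 'e

definition lpa_gens :: "('v, 'e) pre_digraph \<Rightarrow> ('v, 'e) lpa_gen set" where
  "lpa_gens E = Vertex ` verts E \<union> Edge ` arcs E \<union> Ghost ` arcs E"

abbreviation lpa_word :: "('v, 'e) lpa_gen list \<Rightarrow> ('v, 'e) lpa_gen free_word \<Rightarrow>\<^sub>0 'k::field" where
  "lpa_word gs \<equiv> Poly_Mapping.single (Free_Word gs) 1"

definition lpa_relators ::
    "('v, 'e) pre_digraph \<Rightarrow> (('v, 'e) lpa_gen free_word \<Rightarrow>\<^sub>0 'k::field) set" where
  "lpa_relators E =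
     {lpa_word [Vertex v, Vertex w] - (if v = w then lpa_word [Vertex v] else 0) | v w.
        v \<in> verts E \<and> w \<in> verts E}
   \<union> {lpa_word [Vertex (tail E e), Edge e] - lpa_word [Edge e] | e. e \<in> arcs E}
   \<union> {lpa_word [Edge e, Vertex (head E e)] - lpa_word [Edge e] | e. e \<in> arcs E}
   \<union> {lpa_word [Vertex (head E e), Ghost e] - lpa_word [Ghost e] | e. e \<in> arcs E}
   \<union> {lpa_word [Ghost e, Vertex (tail E e)] - lpa_word [Ghost e] | e. e \<in> arcs E}
   \<union> {lpa_word [Ghost e, Edge f] - (if e = f then lpa_word [Vertex (head E e)] else 0) | e f.
        e \<in> arcs E \<and> f \<in> arcs E}
   \<union> {lpa_word [Vertex v] - (\<Sum>e\<in>out_arcs E v. lpa_word [Edge e, Ghost e]) | v.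
        regular_vertex E v}"

definition lpa_ideal ::
    "('v, 'e) pre_digraph \<Rightarrow> (('v, 'e) lpa_gen free_word \<Rightarrow>\<^sub>0 'k::field) set" where
  "lpa_ideal E = alg_ideal_generated (free_algebra (lpa_gens E)) (lpa_relators E)"

text \<open>The first argument only fixes the field of coefficients.\<close>

definition leavitt_path_algebra :: "'k::field itself \<Rightarrow> ('v, 'e) pre_digraph \<Rightarrow>
    ('k, (('v, 'e) lpa_gen free_word \<Rightarrow>\<^sub>0 'k) set) kalgebra" where
  "leavitt_path_algebra K E = alg_quotient (free_algebra (lpa_gens E)) (lpa_ideal E)"

primrec lpa_gen_degree :: "('v, 'e) lpa_gen \<Rightarrow> int" where
  "lpa_gen_degree (Vertex v) = 0"
| "lpa_gen_degree (Edge e) = 1"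
| "lpa_gen_degree (Ghost e) = -1"

definition lpa_word_degree :: "('v, 'e) lpa_gen free_word \<Rightarrow> int" where
  "lpa_word_degree w = sum_list (map lpa_gen_degree (letters w))"

definition lpa_component :: "'k::field itself \<Rightarrow> ('v, 'e) pre_digraph \<Rightarrow> int \<Rightarrow>
    (('v, 'e) lpa_gen free_word \<Rightarrow>\<^sub>0 'k) set set" where
  "lpa_component K E n = alg_coset (free_algebra (lpa_gens E)) (lpa_ideal E) `
     {p \<in> carrier (free_algebra (lpa_gens E)). \<forall>w\<in>Poly_Mapping.keys p. lpa_word_degree w = n}"

end

theory Submission
  imports Defs
begin

text \<open>Write \<open>L\<close> for the Leavitt path algebra. If \<open>L\<close> is prime, an element \<open>\<tau>\<close> of the centroid is determined by
  its value at a single nonzero element, so \<open>\<tau>\<close> is a scalar as soon as \<open>\<tau> u\<close> is a multiple of \<open>u\<close> for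
  one vertex \<open>u\<close>. For a path \<open>m\<close> from \<open>v\<close> to \<open>u\<close> we have \<open>\<tau> u = m\<^sup>* (\<tau> v) m\<close>; writing \<open>\<tau> v\<close> as a
  combination of monomials \<open>p q\<^sup>*\<close> and taking \<open>m\<close> long, this is a multiple of \<open>u\<close> if there is an
  infinite emitter, a cycle with an exit, or if \<open>m\<close> can be chosen without repeated vertices. In a
  prime algebra these cases only leave row-finite comets whose cycle \<open>c\<close> has no exit. There the
  corner at a vertex \<open>v\<close> of \<open>c\<close> consists of the Laurent polynomials in \<open>c\<close>, the ideal generated by
  \<open>v\<close> is everything, and each element of this commutative corner extends to the centroid.
  Such an algebra is not simple because \<open>1 - x\<close> is not invertible, while centroid elements of a simple
  algebra are. A graded simple algebra is prime, and if it is not simple, an element of minimal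
  support in a proper ideal yields a nonscalar element of the centroid.\<close>

section \<open>Quotients of semigroup algebras and their centroids\<close>

text \<open>Elements of the algebra are cosets of a large ideal, so computations are done with
  representatives in the free algebra modulo the congruence \<open>\<approx>\<close>;
  \<open>idl\<close> and \<open>cent\<close> pull ideals and centroid elements back to
  representatives, and cosets return only in the final isomorphisms. The algebra need not have a
  unit, so a centroid element is not multiplication by its value at 1: the value at one vertex takes
  over that role, and local units serve in the passage from ideals to elements. No basis is
  constructed. Monomials are only shown to span, and the independence required rests on two facts:
  vertices are nonzero, by a representation, and the relators are homogeneous, so that distinct
  powers of a cycle are separated by degree. All six claims come from one dichotomy under
  \<open>prime_elementwise\<close>: either every centroid element is scalar, or the graph is a
  row-finite comet none of whose cycles has an exit, where the centroid is computed and simplicity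
  fails.\<close>

definition scal :: "'k::field \<Rightarrow> ('m::monoid_add \<Rightarrow>\<^sub>0 'k) \<Rightarrow> ('m \<Rightarrow>\<^sub>0 'k)" where
  "scal c x = Poly_Mapping.single 0 c * x"

lemma map_eq_scal: "Poly_Mapping.map ((*) c) x = scal c x"
  unfolding scal_def by (rule mult_map_scale_conv_mult)

lemma lookup_scal: "Poly_Mapping.lookup (scal c x) k = c * Poly_Mapping.lookup x k"
  by (simp add: Poly_Mapping.map.rep_eq when_def flip: map_eq_scal)

lemma scal_add: "scal c (x + y) = scal c x + scal c y"
  and scal_diff: "scal c (x - y) = scal c x - scal c y"
  and scal_add_left: "scal (c + d) x = scal c x + scal d x"
  and scal_diff_left: "scal (c - d) x = scal c x - scal d x"
  and scal_scal: "scal c (scal d x) = scal (c * d) x"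
  by (auto intro!: poly_mapping_eqI simp: lookup_scal lookup_add lookup_minus algebra_simps)

lemma scal_zero [simp]: "scal 0 x = 0" "scal c 0 = 0"
  and scal_one [simp]: "scal 1 x = x"
  and scal_uminus_one: "scal (-1) x = - x"
  by (auto intro!: poly_mapping_eqI simp: lookup_scal)

lemma scal_sum: "scal c (sum f S) = (\<Sum>i\<in>S. scal c (f i))"
  by (auto intro!: poly_mapping_eqI simp: lookup_scal lookup_sum sum_distrib_left)

lemma keys_scal: "Poly_Mapping.keys (scal c x) \<subseteq> Poly_Mapping.keys x"
  by (auto simp: in_keys_iff lookup_scal)

lemma poly_mapping_eq_sum_single:
  "x = (\<Sum>k\<in>Poly_Mapping.keys x. Poly_Mapping.single k (Poly_Mapping.lookup x k))"
  by (rule poly_mapping_eqI) (auto simp: lookup_sum lookup_single when_def in_keys_iff)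

lemma scal_single: "scal c (Poly_Mapping.single k d) = Poly_Mapping.single k (c * d)"
  by (simp add: scal_def mult_single)

lemma scal_mult_left: "scal c x * y = scal c (x * y)"
  by (simp add: scal_def mult.assoc)

text \<open>The monoid of exponents need not be commutative, but its neutral element 0 commutes with
  every exponent, so the constants \<open>Poly_Mapping.single 0 c\<close> are central.\<close>

lemma scal_mult_right: "x * scal c y = scal c (x * y)"
proof -
  have "x * Poly_Mapping.single 0 c = Poly_Mapping.single 0 c * x"
    by (subst (1 2) poly_mapping_eq_sum_single[of x])
      (simp add: sum_distrib_left sum_distrib_right mult_single mult.commute)
  then show ?thesis
    by (simp add: scal_def flip: mult.assoc)
qed

text \<open>\<open>M\<close> need not contain 0, since the free algebra omits the empty word.
  Accordingly \<open>I\<close> is an ideal of \<open>A\<close>, not of the whole monoid algebra, and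
  a congruence may be multiplied only by elements of \<open>A\<close>.\<close>

locale quot_alg =
  fixes M :: "'m::monoid_add set" and I :: "('m \<Rightarrow>\<^sub>0 'k::field) set"
  assumes M_add: "u \<in> M \<Longrightarrow> v \<in> M \<Longrightarrow> u + v \<in> M"
    and ideal_I: "alg_ideal (semigroup_algebra M) I"
begin

definition A :: "('m \<Rightarrow>\<^sub>0 'k) set" where
  "A = {p. Poly_Mapping.keys p \<subseteq> M}"

abbreviation S where "S \<equiv> semigroup_algebra M :: ('k, 'm \<Rightarrow>\<^sub>0 'k) kalgebra"

definition L where "L = alg_quotient S I"

definition cls where "cls = alg_coset S I"

definition eqv :: "('m \<Rightarrow>\<^sub>0 'k) \<Rightarrow> ('m \<Rightarrow>\<^sub>0 'k) \<Rightarrow> bool" (infix "\<approx>" 50) where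
  "x \<approx> y \<longleftrightarrow> x - y \<in> I"

lemma S_simps: "carrier S = A" "alg_add S = (+)" "alg_zero S = 0" "alg_mult S = (*)"
    "alg_scale S = scal"
  by (simp_all add: semigroup_algebra_def A_def) (intro ext, rule map_eq_scal)

lemma mem_A: "x \<in> A \<longleftrightarrow> (\<forall>k. k \<notin> M \<longrightarrow> Poly_Mapping.lookup x k = 0)"
  by (auto simp: A_def in_keys_iff)

lemma A_0 [simp, intro]: "0 \<in> A"
  and A_add [simp, intro]: "x \<in> A \<Longrightarrow> y \<in> A \<Longrightarrow> x + y \<in> A"
  and A_diff [simp, intro]: "x \<in> A \<Longrightarrow> y \<in> A \<Longrightarrow> x - y \<in> A"
  and A_uminus [simp, intro]: "x \<in> A \<Longrightarrow> - x \<in> A"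
  and A_scal [simp, intro]: "x \<in> A \<Longrightarrow> scal c x \<in> A"
  by (auto simp: mem_A lookup_add lookup_minus lookup_scal)

lemma A_mult [simp, intro]: "x \<in> A \<Longrightarrow> y \<in> A \<Longrightarrow> x * y \<in> A"
  using keys_mult[of x y] M_add unfolding A_def by blast

lemma A_sum [intro]: "(\<And>i. i \<in> T \<Longrightarrow> f i \<in> A) \<Longrightarrow> sum f T \<in> A"
  by (induction T rule: infinite_finite_induct) auto

lemma I_A: "x \<in> I \<Longrightarrow> x \<in> A"
  and I_0 [simp, intro]: "0 \<in> I"
  and I_add [intro]: "x \<in> I \<Longrightarrow> y \<in> I \<Longrightarrow> x + y \<in> I"
  and I_scal [intro]: "x \<in> I \<Longrightarrow> scal c x \<in> I"
  and I_mult_left [intro]: "a \<in> A \<Longrightarrow> x \<in> I \<Longrightarrow> a * x \<in> I"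
  and I_mult_right [intro]: "a \<in> A \<Longrightarrow> x \<in> I \<Longrightarrow> x * a \<in> I"
  using ideal_I unfolding alg_ideal_def alg_subspace_def S_simps by auto

lemma I_uminus [intro]: "x \<in> I \<Longrightarrow> - x \<in> I"
  using I_scal[of x "-1"] by (simp add: scal_uminus_one)

lemma I_diff [intro]: "x \<in> I \<Longrightarrow> y \<in> I \<Longrightarrow> x - y \<in> I"
  using I_add[OF _ I_uminus, of x y] by simp

lemma I_sum [intro]: "(\<And>i. i \<in> T \<Longrightarrow> f i \<in> I) \<Longrightarrow> sum f T \<in> I"
  by (induction T rule: infinite_finite_induct) auto

lemma eqv_refl [simp, intro]: "x \<approx> x"
  by (simp add: eqv_def)

lemma eqv_sym: "x \<approx> y \<Longrightarrow> y \<approx> x"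
  unfolding eqv_def using I_uminus by fastforce

lemma eqv_trans [trans]: "x \<approx> y \<Longrightarrow> y \<approx> z \<Longrightarrow> x \<approx> z"
  unfolding eqv_def using I_add by fastforce

lemma eqv_0_iff: "x \<approx> 0 \<longleftrightarrow> x \<in> I"
  by (simp add: eqv_def)

lemma eqv_add: "x \<approx> x' \<Longrightarrow> y \<approx> y' \<Longrightarrow> x + y \<approx> x' + y'"
  unfolding eqv_def using I_add[of "x - x'" "y - y'"] by (simp add: algebra_simps)

lemma eqv_scal: "x \<approx> x' \<Longrightarrow> scal c x \<approx> scal c x'"
  unfolding eqv_def using I_scal[of "x - x'"] by (simp add: scal_diff)

lemma eqv_sum: "(\<And>i. i \<in> T \<Longrightarrow> f i \<approx> g i) \<Longrightarrow> sum f T \<approx> sum g T"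
  by (induction T rule: infinite_finite_induct) (auto intro: eqv_add)

lemma eqv_mult_left: "a \<in> A \<Longrightarrow> x \<approx> y \<Longrightarrow> a * x \<approx> a * y"
  unfolding eqv_def by (metis I_mult_left right_diff_distrib)

lemma eqv_mult_right: "a \<in> A \<Longrightarrow> x \<approx> y \<Longrightarrow> x * a \<approx> y * a"
  unfolding eqv_def by (metis I_mult_right left_diff_distrib)

lemma eqv_A: "x \<approx> y \<Longrightarrow> x \<in> A \<longleftrightarrow> y \<in> A"
  unfolding eqv_def using A_add[OF _ I_A, of y "x - y"] A_diff[OF _ I_A, of x "x - y"] by auto

lemma eqv_I: "x \<approx> y \<Longrightarrow> x \<in> I \<longleftrightarrow> y \<in> I"
  by (meson eqv_0_iff eqv_sym eqv_trans)

lemma cls_eq_iff: "cls x = cls y \<longleftrightarrow> x \<approx> y"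
proof
  assume "cls x = cls y"
  moreover have "x \<in> cls x"
    by (auto simp: cls_def alg_coset_def S_simps image_iff intro: bexI[of _ 0])
  ultimately obtain i where "i \<in> I" "x = y + i"
    by (auto simp: cls_def alg_coset_def S_simps)
  then show "x \<approx> y"
    by (simp add: eqv_def)
next
  have *: "cls x \<subseteq> cls y" if "x \<approx> y" for x y
  proof
    fix z assume "z \<in> cls x"
    then obtain i where "i \<in> I" "z = x + i"
      by (auto simp: cls_def alg_coset_def S_simps)
    then have "z = y + ((x - y) + i)" "(x - y) + i \<in> I"
      using that by (auto simp: eqv_def)
    then show "z \<in> cls y"
      unfolding cls_def alg_coset_def S_simps by (rule image_eqI)
  qed
  assume "x \<approx> y"
  then show "cls x = cls y"
    using * eqv_sym by blast
qed

lemma mem_cls: "z \<in> cls x \<longleftrightarrow> z \<approx> x"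
proof -
  have "z \<in> cls x \<longleftrightarrow> (\<exists>i\<in>I. z = x + i)"
    by (auto simp: cls_def alg_coset_def S_simps)
  also have "\<dots> \<longleftrightarrow> z \<approx> x"
    unfolding eqv_def by (metis add.commute add_diff_cancel_left' diff_add_cancel)
  finally show ?thesis .
qed

lemma carrier_L: "carrier L = cls ` A"
  by (simp add: L_def alg_quotient_def S_simps cls_def)

lemma zero_L: "alg_zero L = cls 0"
  by (simp add: L_def alg_quotient_def S_simps cls_def)

text \<open>The operations of the quotient are unions over all choices of representatives;
  compatibility of \<open>\<approx>\<close> makes all members of such a union the same coset. The
  product and the scalar action are treated alike.\<close>

lemma add_L: "alg_add L (cls x) (cls y) = cls (x + y)"
proof -
  have "alg_add L (cls x) (cls y) = (\<Union>x'\<in>cls x. \<Union>y'\<in>cls y. cls (x' + y'))"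
    by (simp add: L_def alg_quotient_def S_simps cls_def)
  also have "\<dots> = (\<Union>x'\<in>cls x. \<Union>y'\<in>cls y. cls (x + y))"
    by (intro SUP_cong refl) (auto simp: cls_eq_iff mem_cls intro: eqv_add)
  finally show ?thesis
    using mem_cls[of x x] mem_cls[of y y] by auto
qed

lemma mult_L: "x \<in> A \<Longrightarrow> y \<in> A \<Longrightarrow> alg_mult L (cls x) (cls y) = cls (x * y)"
proof -
  assume xy: "x \<in> A" "y \<in> A"
  have "alg_mult L (cls x) (cls y) = (\<Union>x'\<in>cls x. \<Union>y'\<in>cls y. cls (x' * y'))"
    by (simp add: L_def alg_quotient_def S_simps cls_def)
  also have "\<dots> = (\<Union>x'\<in>cls x. \<Union>y'\<in>cls y. cls (x * y))"
    using xy by (intro SUP_cong refl)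
      (auto simp: cls_eq_iff mem_cls intro: eqv_trans[OF eqv_mult_left eqv_mult_right] dest: eqv_A)
  finally show ?thesis
    using mem_cls[of x x] mem_cls[of y y] by auto
qed

lemma scale_L: "alg_scale L c (cls x) = cls (scal c x)"
proof -
  have "alg_scale L c (cls x) = (\<Union>x'\<in>cls x. cls (scal c x'))"
    by (simp add: L_def alg_quotient_def S_simps cls_def)
  also have "\<dots> = (\<Union>x'\<in>cls x. cls (scal c x))"
    by (intro SUP_cong refl) (auto simp: cls_eq_iff mem_cls intro: eqv_scal)
  finally show ?thesis
    using mem_cls[of x x] by auto
qed

section \<open>Ideals and primeness in terms of representatives\<close>

definition idl :: "('m \<Rightarrow>\<^sub>0 'k) set \<Rightarrow> bool" where
  "idl P \<longleftrightarrow> I \<subseteq> P \<and> P \<subseteq> A \<and> (\<forall>x\<in>P. \<forall>y\<in>P. x + y \<in> P) \<and> (\<forall>c. \<forall>x\<in>P. scal c x \<in> P) \<and>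
     (\<forall>a\<in>A. \<forall>x\<in>P. a * x \<in> P \<and> x * a \<in> P)"

text \<open>Containing \<open>I\<close> makes \<open>P\<close> a union of congruence classes. Such
  sets therefore correspond exactly to the ideals of the quotient, and \<open>P = I\<close>,
  \<open>P = A\<close> are the two trivial cases.\<close>

lemma idl_eqv: "idl P \<Longrightarrow> x \<approx> y \<Longrightarrow> y \<in> P \<Longrightarrow> x \<in> P"
  unfolding idl_def eqv_def by (metis diff_add_cancel subsetD)

lemma idl_diff: "idl P \<Longrightarrow> x \<in> P \<Longrightarrow> y \<in> P \<Longrightarrow> x - y \<in> P"
  unfolding idl_def by (metis add_uminus_conv_diff scal_uminus_one)

lemma idl_cls: "idl P \<Longrightarrow> cls x \<in> cls ` P \<longleftrightarrow> x \<in> P"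
  using idl_eqv by (auto simp: cls_eq_iff image_iff)

lemma idl_imp_alg_ideal:
  assumes "idl P" shows "alg_ideal L (cls ` P)"
  using assms unfolding alg_ideal_def alg_subspace_def carrier_L zero_L
  by (auto simp: idl_def add_L scale_L mult_L subset_iff)

lemma alg_ideal_imp_idl:
  assumes "alg_ideal L N"
  shows "idl {x \<in> A. cls x \<in> N}" "N = cls ` {x \<in> A. cls x \<in> N}"
proof -
  show "N = cls ` {x \<in> A. cls x \<in> N}"
    using assms unfolding alg_ideal_def alg_subspace_def carrier_L by auto
  have N: "cls 0 \<in> N" "\<And>X Y. X \<in> N \<Longrightarrow> Y \<in> N \<Longrightarrow> alg_add L X Y \<in> N"
    "\<And>c X. X \<in> N \<Longrightarrow> alg_scale L c X \<in> N"
    "\<And>a X. a \<in> A \<Longrightarrow> X \<in> N \<Longrightarrow> alg_mult L (cls a) X \<in> N \<and> alg_mult L X (cls a) \<in> N"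
    using assms unfolding alg_ideal_def alg_subspace_def carrier_L zero_L by auto
  have "x \<in> A \<and> cls x \<in> N" if "x \<in> I" for x
    using that N(1) I_A by (metis cls_eq_iff eqv_0_iff)
  moreover have "cls (x + y) \<in> N" if "cls x \<in> N" "cls y \<in> N" for x y
    using N(2)[OF that] by (simp add: add_L)
  moreover have "cls (scal c x) \<in> N" if "cls x \<in> N" for c x
    using N(3)[OF that] by (simp add: scale_L)
  moreover have "cls (a * x) \<in> N \<and> cls (x * a) \<in> N" if "a \<in> A" "x \<in> A" "cls x \<in> N" for a x
    using N(4)[of a "cls x"] that by (simp add: mult_L)
  ultimately show "idl {x \<in> A. cls x \<in> N}"
    unfolding idl_def by auto
qed

lemma cls_image_eq_zero: "idl P \<Longrightarrow> cls ` P = {alg_zero L} \<longleftrightarrow> P = I"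
proof -
  assume P: "idl P"
  then have "0 \<in> P"
    unfolding idl_def by blast
  have "cls ` P = {alg_zero L} \<longleftrightarrow> (\<forall>x\<in>P. cls x = cls 0)"
    using \<open>0 \<in> P\<close> unfolding zero_L by blast
  also have "\<dots> \<longleftrightarrow> P = I"
    using P unfolding cls_eq_iff eqv_0_iff idl_def by blast
  finally show ?thesis .
qed

lemma idl_A: "idl A"
  unfolding idl_def using I_A by auto

lemma cls_image_eq_carrier: "idl P \<Longrightarrow> cls ` P = carrier L \<longleftrightarrow> P = A"
  unfolding carrier_L using idl_cls[of P] idl_cls[OF idl_A] by (auto simp: set_eq_iff)

lemma carrier_L_eq_zero: "carrier L = {alg_zero L} \<longleftrightarrow> A = I"
  using cls_image_eq_zero[OF idl_A] by (simp add: carrier_L)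

lemma alg_simple_iff: "alg_simple L \<longleftrightarrow> A \<noteq> I \<and> (\<forall>P. idl P \<longrightarrow> P = I \<or> P = A)"
proof -
  have "(\<forall>N. alg_ideal L N \<longrightarrow> N = {alg_zero L} \<or> N = carrier L) \<longleftrightarrow>
      (\<forall>P. idl P \<longrightarrow> cls ` P = {alg_zero L} \<or> cls ` P = carrier L)"
  proof (intro iffI allI impI)
    fix N
    assume "\<forall>P. idl P \<longrightarrow> cls ` P = {alg_zero L} \<or> cls ` P = carrier L" "alg_ideal L N"
    then show "N = {alg_zero L} \<or> N = carrier L"
      using alg_ideal_imp_idl[of N] by metis
  qed (use idl_imp_alg_ideal in blast)
  then show ?thesis
    unfolding alg_simple_def carrier_L_eq_zero
    using cls_image_eq_zero cls_image_eq_carrier by auto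
qed

text \<open>Primeness, simplicity and graded simplicity are all converted into this one condition,
  so that the later arguments need not distinguish between them. The middle factor \<open>a\<close>
  takes the place of a product of ideals.\<close>

definition prime_elementwise :: bool where
  "prime_elementwise \<longleftrightarrow> A \<noteq> I \<and> (\<forall>x\<in>A. \<forall>y\<in>A. (\<forall>a\<in>A. x * a * y \<in> I) \<longrightarrow> x \<in> I \<or> y \<in> I)"

text \<open>\<open>cent t\<close> says that \<open>t\<close> lifts an element of the centroid of the quotient to representatives.\<close>

definition cent :: "(('m \<Rightarrow>\<^sub>0 'k) \<Rightarrow> ('m \<Rightarrow>\<^sub>0 'k)) \<Rightarrow> bool" where
  "cent t \<longleftrightarrow> (\<forall>x\<in>A. t x \<in> A) \<and> (\<forall>x\<in>A. \<forall>y\<in>A. x \<approx> y \<longrightarrow> t x \<approx> t y) \<and>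
     (\<forall>x\<in>A. \<forall>y\<in>A. t (x + y) \<approx> t x + t y) \<and> (\<forall>c. \<forall>x\<in>A. t (scal c x) \<approx> scal c (t x)) \<and>
     (\<forall>x\<in>A. \<forall>y\<in>A. t (x * y) \<approx> t x * y \<and> t (x * y) \<approx> x * t y)"

lemma centD:
  assumes "cent t" "x \<in> A"
  shows "t x \<in> A" "y \<in> A \<Longrightarrow> x \<approx> y \<Longrightarrow> t x \<approx> t y" "y \<in> A \<Longrightarrow> t (x + y) \<approx> t x + t y"
    "t (scal c x) \<approx> scal c (t x)" "y \<in> A \<Longrightarrow> t (x * y) \<approx> t x * y" "y \<in> A \<Longrightarrow> t (x * y) \<approx> x * t y"
  using assms by (auto simp: cent_def)

lemma cent_scal: "cent (scal c)"
  unfolding cent_def scal_mult_left scal_mult_right scal_add scal_scal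
  by (auto simp: mult.commute[of c] intro: eqv_scal)

lemma cent_add:
  assumes "cent t" "cent s"
  shows "cent (\<lambda>x. t x + s x)"
  unfolding cent_def
proof (intro conjI ballI allI impI)
  note t = centD[OF assms(1)] and s = centD[OF assms(2)]
  fix x y c assume xy: "x \<in> A" "y \<in> A"
  show "t x + s x \<in> A"
    using xy t(1) s(1) by auto
  show "t x + s x \<approx> t y + s y" if "x \<approx> y"
    using that xy t(2) s(2) by (intro eqv_add) auto
  have "t (x + y) + s (x + y) \<approx> (t x + t y) + (s x + s y)"
    using xy t(3) s(3) by (intro eqv_add) auto
  then show "t (x + y) + s (x + y) \<approx> t x + s x + (t y + s y)"
    by (simp add: algebra_simps)
  show "t (scal c x) + s (scal c x) \<approx> scal c (t x + s x)"
    unfolding scal_add using xy t(4) s(4) by (intro eqv_add) auto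
  show "t (x * y) + s (x * y) \<approx> (t x + s x) * y"
    unfolding distrib_right using xy t(5) s(5) by (intro eqv_add) auto
  show "t (x * y) + s (x * y) \<approx> x * (t y + s y)"
    unfolding distrib_left using xy t(6) s(6) by (intro eqv_add) auto
qed

lemma cent_comp:
  assumes "cent t" "cent s"
  shows "cent (\<lambda>x. t (s x))"
  unfolding cent_def
proof (intro conjI ballI allI impI)
  note t = centD[OF assms(1)] and s = centD[OF assms(2)]
  fix x y c assume xy: "x \<in> A" "y \<in> A"
  note [simp] = xy s(1) t(1)
  show "t (s x) \<in> A"
    by simp
  show "t (s x) \<approx> t (s y)" if "x \<approx> y"
    using that s(2) by (intro t(2)) auto
  show "t (s (x + y)) \<approx> t (s x) + t (s y)"
    by (rule eqv_trans[OF t(2)[OF _ _ s(3)] t(3)]) auto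
  show "t (s (scal c x)) \<approx> scal c (t (s x))"
    by (rule eqv_trans[OF t(2)[OF _ _ s(4)] t(4)]) auto
  show "t (s (x * y)) \<approx> t (s x) * y"
    by (rule eqv_trans[OF t(2)[OF _ _ s(5)] t(5)]) auto
  show "t (s (x * y)) \<approx> x * t (s y)"
    by (rule eqv_trans[OF t(2)[OF _ _ s(6)] t(6)]) auto
qed

text \<open>The lift \<open>t\<close> picks a representative of each value by choice, so it is
  linear and multiplicative only modulo \<open>I\<close>; this is why \<open>cent\<close> asks for
  congruences throughout.\<close>

lemma centroid_iff:
  "\<tau> \<in> carrier (centroid L) \<longleftrightarrow>
     \<tau> \<in> extensional (carrier L) \<and> (\<exists>t. cent t \<and> (\<forall>x\<in>A. \<tau> (cls x) = cls (t x)))"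
proof (intro iffI conjI)
  assume "\<tau> \<in> carrier (centroid L)"
  then have ext: "\<tau> \<in> cls ` A \<rightarrow>\<^sub>E cls ` A"
    and \<tau>: "\<And>x y. x \<in> A \<Longrightarrow> y \<in> A \<Longrightarrow> \<tau> (alg_add L (cls x) (cls y)) = alg_add L (\<tau> (cls x)) (\<tau> (cls y))"
    "\<And>c x. x \<in> A \<Longrightarrow> \<tau> (alg_scale L c (cls x)) = alg_scale L c (\<tau> (cls x))"
    "\<And>x y. x \<in> A \<Longrightarrow> y \<in> A \<Longrightarrow> \<tau> (alg_mult L (cls x) (cls y)) = alg_mult L (\<tau> (cls x)) (cls y)"
    "\<And>x y. x \<in> A \<Longrightarrow> y \<in> A \<Longrightarrow> \<tau> (alg_mult L (cls x) (cls y)) = alg_mult L (cls x) (\<tau> (cls y))"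
    unfolding centroid_def carrier_L partial_object.simps mem_Collect_eq ball_simps by blast+
  show "\<tau> \<in> extensional (carrier L)"
    using ext by (auto simp: carrier_L PiE_def)
  define t where "t x = (SOME y. y \<in> A \<and> \<tau> (cls x) = cls y)" for x
  have t: "t x \<in> A" "\<tau> (cls x) = cls (t x)" if "x \<in> A" for x
  proof -
    have "\<tau> (cls x) \<in> cls ` A"
      using ext that by (auto simp: PiE_def)
    then have "\<exists>y. y \<in> A \<and> \<tau> (cls x) = cls y"
      by blast
    from someI_ex[OF this] show "t x \<in> A" "\<tau> (cls x) = cls (t x)"
      by (simp_all add: t_def)
  qed
  have 1: "t x \<approx> t y" if "x \<in> A" "y \<in> A" "x \<approx> y" for x y
    using that t by (metis cls_eq_iff)
  have 2: "t (x + y) \<approx> t x + t y" if "x \<in> A" "y \<in> A" for x y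
    using \<tau>(1)[OF that] that t by (simp add: add_L cls_eq_iff)
  have 3: "t (scal c x) \<approx> scal c (t x)" if "x \<in> A" for c x
    using \<tau>(2)[OF that] that t by (simp add: scale_L cls_eq_iff)
  have 4: "t (x * y) \<approx> t x * y" "t (x * y) \<approx> x * t y" if "x \<in> A" "y \<in> A" for x y
    using \<tau>(3,4)[OF that] that t by (simp_all add: mult_L cls_eq_iff)
  have "cent t"
    unfolding cent_def using 1 2 3 4 t by auto
  then show "\<exists>t. cent t \<and> (\<forall>x\<in>A. \<tau> (cls x) = cls (t x))"
    using t by blast
next
  assume "\<tau> \<in> extensional (carrier L) \<and> (\<exists>t. cent t \<and> (\<forall>x\<in>A. \<tau> (cls x) = cls (t x)))"
  then obtain t where ext: "\<tau> \<in> extensional (carrier L)" and "cent t"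
    and \<tau>: "\<And>x. x \<in> A \<Longrightarrow> \<tau> (cls x) = cls (t x)"
    by blast
  note t = centD[OF \<open>cent t\<close>]
  have "\<tau> \<in> carrier L \<rightarrow>\<^sub>E carrier L"
    using ext \<tau> t(1) by (auto simp: carrier_L PiE_def)
  moreover have "\<tau> (alg_add L X Y) = alg_add L (\<tau> X) (\<tau> Y)"
    "\<tau> (alg_mult L X Y) = alg_mult L (\<tau> X) Y" "\<tau> (alg_mult L X Y) = alg_mult L X (\<tau> Y)"
    "\<tau> (alg_scale L c X) = alg_scale L c (\<tau> X)"
    if XY: "X \<in> carrier L" "Y \<in> carrier L" for X Y c
  proof -
    obtain x y where "x \<in> A" "X = cls x" "y \<in> A" "Y = cls y"
      using XY unfolding carrier_L by blast
    then show "\<tau> (alg_add L X Y) = alg_add L (\<tau> X) (\<tau> Y)"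
      "\<tau> (alg_mult L X Y) = alg_mult L (\<tau> X) Y" "\<tau> (alg_mult L X Y) = alg_mult L X (\<tau> Y)"
      "\<tau> (alg_scale L c X) = alg_scale L c (\<tau> X)"
      by (simp_all add: add_L mult_L scale_L \<tau> cls_eq_iff t)
  qed
  ultimately show "\<tau> \<in> carrier (centroid L)"
    unfolding centroid_def by simp
qed

lemma centroidI:
  "\<tau> \<in> extensional (carrier L) \<Longrightarrow> cent t \<Longrightarrow> (\<And>x. x \<in> A \<Longrightarrow> \<tau> (cls x) = cls (t x)) \<Longrightarrow>
    \<tau> \<in> carrier (centroid L)"
  unfolding centroid_iff by blast

lemma centroid_lift:
  assumes "\<tau> \<in> carrier (centroid L)"
  obtains t where "cent t" "\<And>x. x \<in> A \<Longrightarrow> \<tau> (cls x) = cls (t x)"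
  using assms unfolding centroid_iff by blast

lemma cent_imp_centroid:
  assumes "cent t"
  obtains \<tau> where "\<tau> \<in> carrier (centroid L)" "\<And>x. x \<in> A \<Longrightarrow> \<tau> (cls x) = cls (t x)"
proof -
  define \<tau> where "\<tau> = (\<lambda>X\<in>carrier L. cls (t (SOME x. x \<in> A \<and> X = cls x)))"
  have \<tau>: "\<tau> (cls x) = cls (t x)" if "x \<in> A" for x
  proof -
    have "(SOME y. y \<in> A \<and> cls x = cls y) \<in> A \<and> cls x = cls (SOME y. y \<in> A \<and> cls x = cls y)"
      by (rule someI[of _ x]) (use that in auto)
    then show ?thesis
      using that centD(2)[OF assms] by (auto simp: \<tau>_def carrier_L cls_eq_iff intro: eqv_sym)
  qed
  have "\<tau> \<in> carrier (centroid L)"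
    unfolding centroid_iff using assms \<tau> by (auto simp: \<tau>_def)
  then show ?thesis
    using that \<tau> by blast
qed

lemma centroid_ops:
  assumes "\<sigma> \<in> carrier (centroid L)" "\<And>x. x \<in> A \<Longrightarrow> \<sigma> (cls x) = cls (s x)" "cent s"
    and "\<tau> \<in> carrier (centroid L)" "\<And>x. x \<in> A \<Longrightarrow> \<tau> (cls x) = cls (t x)" "cent t"
  shows "alg_add (centroid L) \<sigma> \<tau> \<in> carrier (centroid L)"
    "alg_mult (centroid L) \<sigma> \<tau> \<in> carrier (centroid L)"
    "alg_scale (centroid L) c \<tau> \<in> carrier (centroid L)"
    and "\<And>x. x \<in> A \<Longrightarrow> alg_add (centroid L) \<sigma> \<tau> (cls x) = cls (s x + t x)"
    "\<And>x. x \<in> A \<Longrightarrow> alg_mult (centroid L) \<sigma> \<tau> (cls x) = cls (s (t x))"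
    "\<And>x. x \<in> A \<Longrightarrow> alg_scale (centroid L) c \<tau> (cls x) = cls (scal c (t x))"
proof -
  show ops: "alg_add (centroid L) \<sigma> \<tau> (cls x) = cls (s x + t x)"
    "alg_mult (centroid L) \<sigma> \<tau> (cls x) = cls (s (t x))"
    "alg_scale (centroid L) c \<tau> (cls x) = cls (scal c (t x))" if "x \<in> A" for x
    using that assms centD(1) by (auto simp: centroid_def carrier_L compose_def add_L scale_L)
  have "alg_add (centroid L) \<sigma> \<tau> \<in> extensional (carrier L)"
    "alg_mult (centroid L) \<sigma> \<tau> \<in> extensional (carrier L)"
    "alg_scale (centroid L) c \<tau> \<in> extensional (carrier L)"
    by (auto simp: centroid_def)
  then show "alg_add (centroid L) \<sigma> \<tau> \<in> carrier (centroid L)"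
    "alg_mult (centroid L) \<sigma> \<tau> \<in> carrier (centroid L)"
    "alg_scale (centroid L) c \<tau> \<in> carrier (centroid L)"
    using ops cent_add[OF assms(3,6)] cent_comp[OF assms(3,6)] cent_comp[OF cent_scal assms(6)]
    using centroidI[of "alg_add (centroid L) \<sigma> \<tau>"] centroidI[of "alg_mult (centroid L) \<sigma> \<tau>"]
      centroidI[of "alg_scale (centroid L) c \<tau>"]
    by (metis (no_types, lifting))+
qed

lemma centroid_eqI:
  assumes "\<tau> \<in> carrier (centroid L)" "\<sigma> \<in> carrier (centroid L)" "\<And>x. x \<in> A \<Longrightarrow> \<tau> (cls x) = \<sigma> (cls x)"
  shows "\<tau> = \<sigma>"
proof (rule PiE_ext)
  show "\<tau> \<in> carrier L \<rightarrow>\<^sub>E carrier L" "\<sigma> \<in> carrier L \<rightarrow>\<^sub>E carrier L"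
    using assms by (auto simp: centroid_def)
qed (use assms in \<open>auto simp: carrier_L\<close>)

text \<open>Both \<open>w * a * t x\<close> and \<open>t w * (a * x)\<close> represent the value of
  \<open>t\<close> at \<open>w * a * x\<close>, and likewise for \<open>s\<close>. If
  \<open>t\<close> and \<open>s\<close> agree at \<open>w\<close>, then
  \<open>w * a * (t x - s x)\<close> lies in \<open>I\<close> for all \<open>a\<close>, and
  primeness removes the nonzero \<open>w\<close>.\<close>

lemma cent_eqvI:
  assumes "prime_elementwise" "cent t" "cent s" "w \<in> A" "w \<notin> I" "t w \<approx> s w" "x \<in> A"
  shows "t x \<approx> s x"
proof -
  have "w * a * (t x - s x) \<in> I" if a: "a \<in> A" for a
  proof -
    have *: "w * a * u x \<approx> u w * (a * x)" if "cent u" for u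
    proof -
      have "w * a * u x \<approx> u (w * a * x)"
        using that a assms by (intro eqv_sym[OF centD(6)]) auto
      also have "u (w * a * x) = u (w * (a * x))"
        by (simp add: mult.assoc)
      also have "\<dots> \<approx> u w * (a * x)"
        using that a assms by (intro centD(5)) auto
      finally show ?thesis .
    qed
    have "w * a * t x \<approx> t w * (a * x)"
      using * assms by blast
    also have "\<dots> \<approx> s w * (a * x)"
      using a assms by (intro eqv_mult_right) auto
    also have "\<dots> \<approx> w * a * s x"
      using * assms eqv_sym by blast
    finally show ?thesis
      by (simp add: eqv_def right_diff_distrib)
  qed
  then show ?thesis
    using assms unfolding prime_elementwise_def eqv_def by (meson A_diff centD(1))
qed

definition all_scalar :: bool where
  "all_scalar \<longleftrightarrow> (\<forall>t. cent t \<longrightarrow> (\<exists>c. \<forall>x\<in>A. t x \<approx> scal c x))"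

lemma scal_eqv_imp_eq:
  assumes "w \<in> A" "w \<notin> I" "scal c w \<approx> scal d w"
  shows "c = d"
proof (rule ccontr)
  assume "c \<noteq> d"
  have "scal (c - d) w \<in> I"
    using assms(3) by (simp add: eqv_def scal_diff_left)
  then have "scal (inverse (c - d)) (scal (c - d) w) \<in> I"
    by (rule I_scal)
  with \<open>c \<noteq> d\<close> assms(2) show False
    by (simp add: scal_scal)
qed

lemma all_scalar_imp_isomorphic:
  assumes "A \<noteq> I" "all_scalar"
  shows "alg_isomorphic (centroid L) base_field_algebra"
proof -
  obtain w where w: "w \<in> A" "w \<notin> I"
    using assms(1) I_A by blast
  have ex: "\<exists>c. \<forall>x\<in>A. \<tau> (cls x) = cls (scal c x)" if "\<tau> \<in> carrier (centroid L)" for \<tau>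
    using assms(2) centroid_lift[OF that] unfolding all_scalar_def by (metis cls_eq_iff)
  define h where "h \<tau> = (SOME c. \<forall>x\<in>A. \<tau> (cls x) = cls (scal c x))" for \<tau>
  have h: "\<tau> (cls x) = cls (scal (h \<tau>) x)" if "\<tau> \<in> carrier (centroid L)" "x \<in> A" for \<tau> x
    using someI_ex[OF ex[OF that(1)]] that(2) by (auto simp: h_def)
  \<comment> \<open>The scalar can be recognised at the single element \<open>w\<close>, which turns
    each homomorphism law below into one congruence at \<open>w\<close>.\<close>
  have h_eq: "h \<tau> = c" if "\<tau> \<in> carrier (centroid L)" "\<tau> (cls w) = cls (scal c w)" for \<tau> c
    using scal_eqv_imp_eq[OF w, of c "h \<tau>"] h[OF that(1) w(1)] that(2) by (simp add: cls_eq_iff)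
  note ops = centroid_ops[OF _ h cent_scal _ h cent_scal]
  have "bij_betw h (carrier (centroid L)) UNIV"
  proof (rule bij_betwI')
    show "h \<sigma> = h \<tau> \<longleftrightarrow> \<sigma> = \<tau>" if "\<sigma> \<in> carrier (centroid L)" "\<tau> \<in> carrier (centroid L)" for \<sigma> \<tau>
      using h that centroid_eqI by metis
    show "\<exists>\<tau>\<in>carrier (centroid L). c = h \<tau>" for c
      using cent_imp_centroid[OF cent_scal[of c]] h_eq w by metis
  qed auto
  moreover have "h (alg_add (centroid L) \<sigma> \<tau>) = h \<sigma> + h \<tau>"
    "h (alg_mult (centroid L) \<sigma> \<tau>) = h \<sigma> * h \<tau>"
    "h (alg_scale (centroid L) c \<tau>) = c * h \<tau>"
    if "\<sigma> \<in> carrier (centroid L)" "\<tau> \<in> carrier (centroid L)" for \<sigma> \<tau> c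
    using that w by (auto intro!: h_eq ops simp: ops scal_add_left scal_scal)
  ultimately show ?thesis
    unfolding alg_isomorphic_def base_field_algebra_def by auto
qed

end

section \<open>Primeness and extension of centroid elements\<close>

locale local_unit_alg = quot_alg M I
  for M :: "'m::monoid_add set" and I :: "('m \<Rightarrow>\<^sub>0 'k::field) set" +
  assumes local_unit: "x \<in> A \<Longrightarrow> \<exists>g\<in>A. g * x \<approx> x \<and> x * g \<approx> x"
begin

lemma idlI:
  assumes "\<And>x. x \<in> I \<Longrightarrow> x \<in> P" "\<And>x. x \<in> P \<Longrightarrow> x \<in> A"
    "\<And>x y. x \<in> P \<Longrightarrow> y \<in> P \<Longrightarrow> x + y \<in> P" "\<And>c x. x \<in> P \<Longrightarrow> scal c x \<in> P"
    "\<And>a x. a \<in> A \<Longrightarrow> x \<in> P \<Longrightarrow> a * x \<in> P" "\<And>a x. a \<in> A \<Longrightarrow> x \<in> P \<Longrightarrow> x * a \<in> P"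
  shows "idl P"
  using assms unfolding idl_def by (simp add: subset_iff)

text \<open>The arbitrary middle factor \<open>a\<close> makes the annihilator two-sided: in
  \<open>u * b * a * w\<close> the factor \<open>b\<close> is absorbed into it.\<close>

lemma idl_left_annihilator:
  assumes "W \<subseteq> A"
  shows "idl {u \<in> A. \<forall>a\<in>A. \<forall>w\<in>W. u * a * w \<in> I}"
proof -
  have "u * b * a * w \<in> I \<and> b * u * a * w \<in> I"
    if "\<forall>a\<in>A. \<forall>w\<in>W. u * a * w \<in> I" "a \<in> A" "w \<in> W" "b \<in> A" for u a b w
  proof -
    have "u * (b * a) * w \<in> I" "b * (u * a * w) \<in> I"
      using that by blast+
    then show ?thesis
      by (simp add: mult.assoc)
  qed
  then show ?thesis
    using assms unfolding idl_def
    by (auto simp: distrib_right scal_mult_left I_A subset_iff)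
qed

lemma idl_right_annihilator:
  assumes "U \<subseteq> A"
  shows "idl {w \<in> A. \<forall>a\<in>A. \<forall>u\<in>U. u * a * w \<in> I}"
proof -
  have "u * a * (w * b) \<in> I \<and> u * a * (b * w) \<in> I"
    if "\<forall>a\<in>A. \<forall>u\<in>U. u * a * w \<in> I" "a \<in> A" "u \<in> U" "b \<in> A" for u a b w
  proof -
    have "u * (a * b) * w \<in> I" "u * a * w * b \<in> I"
      using that by blast+
    then show ?thesis
      by (simp add: mult.assoc)
  qed
  then show ?thesis
    using assms unfolding idl_def
    by (auto simp: distrib_left scal_mult_right I_A subset_iff)
qed

text \<open>Take \<open>u = a = g\<close> for a left unit \<open>g\<close> of \<open>y\<close>; then
  \<open>g * g * y \<approx> y\<close>. This serves to show that the annihilator of a nonzero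
  element is a proper ideal.\<close>

lemma mem_I_if_annihilated:
  assumes "y \<in> A" "\<And>u a. u \<in> A \<Longrightarrow> a \<in> A \<Longrightarrow> u * a * y \<in> I"
  shows "y \<in> I"
proof -
  obtain g where g: "g \<in> A" "g * y \<approx> y"
    using local_unit assms(1) by blast
  have "g * g * y \<approx> y"
    using eqv_trans[OF eqv_mult_left[OF g] g(2)] by (simp add: mult.assoc)
  then show ?thesis
    using assms g eqv_I by blast
qed

text \<open>Instead of the ideals generated by \<open>x\<close> and \<open>y\<close>, which would
  need an explicit description, annihilators are used: \<open>P\<close> annihilates \<open>y\<close>
  from the left and contains \<open>x\<close>, and \<open>Q\<close> is annihilated by
  \<open>P\<close> and contains \<open>y\<close>. A local unit inserted between the factors shows
  that the product of \<open>P\<close> and \<open>Q\<close> is zero.\<close>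

lemma alg_prime_imp_prime_elementwise:
  assumes "alg_prime L"
  shows "prime_elementwise"
  unfolding prime_elementwise_def
proof (intro conjI ballI impI)
  show "A \<noteq> I"
    using assms carrier_L_eq_zero by (simp add: alg_prime_def)
  fix x y assume xy: "x \<in> A" "y \<in> A" "\<forall>a\<in>A. x * a * y \<in> I"
  define P where "P = {u \<in> A. \<forall>a\<in>A. \<forall>w\<in>{y}. u * a * w \<in> I}"
  define Q where "Q = {w \<in> A. \<forall>a\<in>A. \<forall>u\<in>P. u * a * w \<in> I}"
  have idl: "idl P" "idl Q"
    unfolding Q_def using xy idl_left_annihilator[of "{y}"] idl_right_annihilator[of P]
    by (auto simp: P_def)
  have P_A: "\<And>u. u \<in> P \<Longrightarrow> u \<in> A" and Q_A: "\<And>u. u \<in> Q \<Longrightarrow> u \<in> A"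
    by (auto simp: P_def Q_def)
  have "u * w \<in> I" if "u \<in> P" "w \<in> Q" for u w
  proof -
    from that have "u \<in> A" "w \<in> A"
      by (auto simp: P_def Q_def)
    then obtain g where "g \<in> A" "g * w \<approx> w"
      using local_unit by blast
    moreover have "u * (g * w) \<in> I"
      using that \<open>g \<in> A\<close> by (auto simp: Q_def mult.assoc)
    ultimately show ?thesis
      using eqv_I eqv_mult_left[OF \<open>u \<in> A\<close>] by blast
  qed
  then have "\<forall>X\<in>cls ` P. \<forall>Y\<in>cls ` Q. alg_mult L X Y = alg_zero L"
    by (simp add: zero_L mult_L cls_eq_iff eqv_0_iff P_A Q_A)
  then have "cls ` P = {alg_zero L} \<or> cls ` Q = {alg_zero L}"
    using assms[unfolded alg_prime_def, THEN conjunct2, rule_format, of "cls ` P" "cls ` Q"]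
      idl_imp_alg_ideal[OF idl(1)] idl_imp_alg_ideal[OF idl(2)] by simp
  then have "P = I \<or> Q = I"
    using cls_image_eq_zero idl by blast
  moreover have "x \<in> P" "y \<in> Q"
    using xy by (auto simp: P_def Q_def)
  ultimately show "x \<in> I \<or> y \<in> I"
    by blast
qed

lemma alg_simple_imp_prime_elementwise:
  assumes "alg_simple L"
  shows "prime_elementwise"
  unfolding prime_elementwise_def
proof (intro conjI ballI impI)
  show "A \<noteq> I"
    using assms by (simp add: alg_simple_iff)
  fix x y assume xy: "x \<in> A" "y \<in> A" "\<forall>a\<in>A. x * a * y \<in> I"
  define P where "P = {u \<in> A. \<forall>a\<in>A. \<forall>w\<in>{y}. u * a * w \<in> I}"
  have "P = I \<or> P = A"
    using assms xy(2) idl_left_annihilator[of "{y}"] by (auto simp: alg_simple_iff P_def)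
  moreover have "x \<in> P"
    using xy by (auto simp: P_def)
  ultimately show "x \<in> I \<or> y \<in> I"
    using mem_I_if_annihilated[OF xy(2)] by (auto simp: P_def)
qed

text \<open>The image of a centroid element is a two-sided ideal because
  \<open>a * t p \<approx> t (a * p)\<close> and \<open>t p * a \<approx> t (p * a)\<close>; the
  element \<open>w\<close> shows that it is nonzero. This is the surjectivity half of the fact that
  the centroid of a simple algebra is a field.\<close>

lemma simple_cent_surj:
  assumes "alg_simple L" "cent t" "w \<in> A" "t w \<notin> I" "u \<in> A"
  shows "\<exists>z\<in>A. u \<approx> t z"
proof -
  define P where "P = {u \<in> A. \<exists>z\<in>A. u \<approx> t z}"
  note t = centD[OF assms(2)]
  have "t 0 \<approx> 0"
    using t(4)[of 0 0] by simp
  have 1: "x \<in> P" if "x \<in> I" for x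
  proof -
    have "x \<approx> t 0"
      by (rule eqv_trans[OF _ eqv_sym[OF \<open>t 0 \<approx> 0\<close>]]) (use that eqv_0_iff in auto)
    then show ?thesis
      using that I_A by (auto simp: P_def)
  qed
  have 2: "x + y \<in> P" "scal c x \<in> P" "a * x \<in> P" "x * a \<in> P"
    if xy: "x \<in> P" "y \<in> P" and a: "a \<in> A" for x y c a
  proof -
    obtain p q where pq: "p \<in> A" "x \<approx> t p" "q \<in> A" "y \<approx> t q"
      using xy by (auto simp: P_def)
    have "x + y \<approx> t (p + q)"
      by (rule eqv_trans[OF eqv_add[OF pq(2,4)] eqv_sym[OF t(3)[OF pq(1,3)]]])
    moreover have "scal c x \<approx> t (scal c p)"
      by (rule eqv_trans[OF eqv_scal[OF pq(2)] eqv_sym[OF t(4)[OF pq(1)]]])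
    moreover have "a * x \<approx> t (a * p)"
      by (rule eqv_trans[OF eqv_mult_left[OF a pq(2)] eqv_sym[OF t(6)[OF a pq(1)]]])
    moreover have "x * a \<approx> t (p * a)"
      by (rule eqv_trans[OF eqv_mult_right[OF a pq(2)] eqv_sym[OF t(5)[OF pq(1) a]]])
    ultimately show "x + y \<in> P" "scal c x \<in> P" "a * x \<in> P" "x * a \<in> P"
      using xy a pq by (auto simp: P_def)
  qed
  have "idl P"
    by (rule idlI[OF 1 _ 2(1)[OF _ _ A_0] 2(2)[OF _ _ A_0] 2(3) 2(4)]) (auto simp: P_def)
  moreover have "t w \<in> P"
    using assms t(1) by (auto simp: P_def)
  ultimately have "P = A"
    using assms by (auto simp: alg_simple_iff)
  then show ?thesis
    using assms by (auto simp: P_def)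
qed

text \<open>If \<open>t\<close> is in the centroid and \<open>t x \<approx> z\<close>, then
  \<open>w = t u\<close> solves all these equations. So these are the \<open>u\<close> at which an
  extension of the assignment of \<open>z\<close> to \<open>x\<close> has a candidate value.\<close>

definition ext_domain :: "('m \<Rightarrow>\<^sub>0 'k) \<Rightarrow> ('m \<Rightarrow>\<^sub>0 'k) \<Rightarrow> ('m \<Rightarrow>\<^sub>0 'k) set" where
  "ext_domain x z = {u \<in> A. \<exists>w\<in>A. \<forall>a\<in>A. x * a * w \<approx> z * a * u}"

lemma idl_ext_domain:
  assumes "x \<in> A" "z \<in> A"
  shows "idl (ext_domain x z)"
proof -
  have 1: "u \<in> ext_domain x z" if "u \<in> I" for u
  proof -
    have "z * a * u \<approx> 0" if "a \<in> A" for a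
      using \<open>u \<in> I\<close> that assms by (auto simp: eqv_0_iff)
    then show ?thesis
      using that I_A eqv_sym by (auto simp: ext_domain_def intro!: bexI[of _ 0])
  qed
  have 2: "u + u' \<in> ext_domain x z" "scal c u \<in> ext_domain x z" "b * u \<in> ext_domain x z"
    "u * b \<in> ext_domain x z"
    if uu: "u \<in> ext_domain x z" "u' \<in> ext_domain x z" and b: "b \<in> A" for u u' c b
  proof -
    obtain w w' where w: "u \<in> A" "w \<in> A" "\<And>a. a \<in> A \<Longrightarrow> x * a * w \<approx> z * a * u"
      "u' \<in> A" "w' \<in> A" "\<And>a. a \<in> A \<Longrightarrow> x * a * w' \<approx> z * a * u'"
      using uu by (auto simp: ext_domain_def)
    have "x * a * (w + w') \<approx> z * a * (u + u')" if "a \<in> A" for a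
      using w that by (auto simp: distrib_left intro: eqv_add)
    moreover have "x * a * (scal c w) \<approx> z * a * (scal c u)" if "a \<in> A" for a
      using w that by (auto simp: scal_mult_right intro: eqv_scal)
    moreover have "x * a * (b * w) \<approx> z * a * (b * u)" if "a \<in> A" for a
      using w(3)[of "a * b"] that b by (auto simp: mult.assoc)
    moreover have "x * a * (w * b) \<approx> z * a * (u * b)" if "a \<in> A" for a
      using eqv_mult_right[OF b w(3)[OF that]] by (simp add: mult.assoc)
    ultimately show "u + u' \<in> ext_domain x z" "scal c u \<in> ext_domain x z" "b * u \<in> ext_domain x z"
      "u * b \<in> ext_domain x z"
      unfolding ext_domain_def using w b by blast+
  qed
  show ?thesis
    by (rule idlI[OF 1 _ 2(1)[OF _ _ A_0] 2(2)[OF _ _ A_0] 2(3) 2(4)]) (auto simp: ext_domain_def)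
qed

text \<open>The map \<open>x \<mapsto> z\<close> has at most one extension \<open>t\<close> to an element of the centroid, because
  \<open>t\<close> must satisfy \<open>x a (t u) = t (x a u) = z a u\<close>.\<close>

lemma cent_extend:
  assumes "prime_elementwise" "x \<in> A" "x \<notin> I" "z \<in> A" and xz: "\<And>a. a \<in> A \<Longrightarrow> x * a * z \<approx> z * a * x"
    and dom: "ext_domain x z = A"
  obtains t where "cent t" "t x \<approx> z"
proof -
  define R where "R u w \<longleftrightarrow> u \<in> A \<and> w \<in> A \<and> (\<forall>a\<in>A. x * a * w \<approx> z * a * u)" for u w
  have uniq: "w \<approx> w'" if "R u w" "R u' w'" "u \<approx> u'" for u u' w w'
  proof -
    have "x * a * (w - w') \<in> I" if "a \<in> A" for a
    proof -
      have "x * a * w \<approx> z * a * u"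
        using \<open>R u w\<close> that by (auto simp: R_def)
      also have "\<dots> \<approx> z * a * u'"
        using \<open>u \<approx> u'\<close> that assms by (intro eqv_mult_left) auto
      also have "\<dots> \<approx> x * a * w'"
        using \<open>R u' w'\<close> that by (auto simp: R_def intro: eqv_sym)
      finally show ?thesis
        by (simp add: right_diff_distrib eqv_def)
    qed
    then show ?thesis
      using assms(1-3) that unfolding prime_elementwise_def R_def eqv_def by (meson A_diff)
  qed
  define t where "t u = (SOME w. R u w)" for u
  have t: "R u (t u)" if "u \<in> A" for u
    unfolding t_def using that dom by (intro someI_ex[of "R u"]) (auto simp: ext_domain_def R_def)
  have Rs: "R (u + u') (w + w')" "R (scal c u) (scal c w)" "R (b * u) (b * w)" "R (u * b) (w * b)"
    if "R u w" "R u' w'" "b \<in> A" for u w u' w' c b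
  proof -
    note w = that[unfolded R_def]
    have "x * a * (w + w') \<approx> z * a * (u + u')" if "a \<in> A" for a
      using w that by (auto simp: distrib_left intro: eqv_add)
    moreover have "x * a * (scal c w) \<approx> z * a * (scal c u)" if "a \<in> A" for a
      using w that by (auto simp: scal_mult_right intro: eqv_scal)
    moreover have "x * a * (b * w) \<approx> z * a * (b * u)" if "a \<in> A" for a
    proof -
      have "a * b \<in> A"
        using that w by auto
      then have "x * (a * b) * w \<approx> z * (a * b) * u"
        using w by blast
      then show ?thesis
        by (simp add: mult.assoc)
    qed
    moreover have "x * a * (w * b) \<approx> z * a * (u * b)" if "a \<in> A" for a
      using eqv_mult_right[of b "x * a * w" "z * a * u"] w that by (auto simp: mult.assoc)
    ultimately show "R (u + u') (w + w')" "R (scal c u) (scal c w)" "R (b * u) (b * w)" "R (u * b) (w * b)"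
      unfolding R_def using w by auto
  qed
  \<comment> \<open>In each law both sides are \<open>R\<close>-related to the same or to congruent
    elements: \<open>Rs\<close> provides the relation for the right-hand side, and
    \<open>uniq\<close> compares it with the chosen value.\<close>
  have "cent t"
    unfolding cent_def
  proof (intro conjI ballI allI impI)
    fix u u' c assume u: "u \<in> A" "u' \<in> A"
    note R = Rs[OF t[OF u(1)] t[OF u(2)]]
    show "t u \<in> A"
      using t[OF u(1)] by (simp add: R_def)
    show "t u \<approx> t u'" if "u \<approx> u'"
      using uniq t u that by blast
    show "t (u + u') \<approx> t u + t u'"
      using uniq[OF t R(1)] u by auto
    show "t (scal c u) \<approx> scal c (t u)"
      using uniq[OF t R(2)] u by auto
    show "t (u * u') \<approx> t u * u'"
      using uniq[OF t Rs(4)[OF t t]] u by auto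
    show "t (u * u') \<approx> u * t u'"
      using uniq[OF t Rs(3)[OF t t]] u by auto
  qed
  moreover have "t x \<approx> z"
    using uniq[OF t] assms(2,4) xz by (auto simp: R_def)
  ultimately show ?thesis
    using that by blast
qed

end

section \<open>Graded quotients\<close>

text \<open>The homogeneous component of degree \<open>n\<close>. Below, \<open>prt d a = a\<close>
  expresses that \<open>a\<close> is homogeneous of degree \<open>d\<close>; the element 0 satisfies
  this for every \<open>d\<close>.\<close>

definition part :: "('m \<Rightarrow> int) \<Rightarrow> int \<Rightarrow> ('m \<Rightarrow>\<^sub>0 'k::zero) \<Rightarrow> ('m \<Rightarrow>\<^sub>0 'k)" where
  "part deg n x = Poly_Mapping.mapp (\<lambda>k v. if deg k = n then v else 0) x"

lemma lookup_part: "Poly_Mapping.lookup (part deg n x) k = (if deg k = n then Poly_Mapping.lookup x k else 0)"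
  by (auto simp: part_def lookup_mapp when_def in_keys_iff)

locale degree_alg = quot_alg M I
  for M :: "'m::monoid_add set" and I :: "('m \<Rightarrow>\<^sub>0 'k::field) set" +
  fixes deg :: "'m \<Rightarrow> int"
  assumes deg_add: "deg (u + v) = deg u + deg v"
begin

abbreviation prt where "prt \<equiv> part deg :: int \<Rightarrow> ('m \<Rightarrow>\<^sub>0 'k) \<Rightarrow> _"

abbreviation degs :: "('m \<Rightarrow>\<^sub>0 'k) \<Rightarrow> int set" where "degs x \<equiv> deg ` Poly_Mapping.keys x"

lemma part_add: "prt n (x + y) = prt n x + prt n y"
  and part_diff: "prt n (x - y) = prt n x - prt n y"
  and part_scal: "prt n (scal c x) = scal c (prt n x)"
  and part_zero [simp]: "prt n 0 = 0"
  and part_part: "prt m (prt n x) = (if m = n then prt n x else 0)"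
  by (auto intro!: poly_mapping_eqI simp: lookup_part lookup_add lookup_minus lookup_scal)

lemma part_sum: "prt n (sum f T) = (\<Sum>i\<in>T. prt n (f i))"
  by (auto intro!: poly_mapping_eqI simp: lookup_part lookup_sum)

lemma part_A [simp, intro]: "x \<in> A \<Longrightarrow> prt n x \<in> A"
  by (auto simp: mem_A lookup_part)

lemma sum_part: "finite T \<Longrightarrow> degs x \<subseteq> T \<Longrightarrow> (\<Sum>n\<in>T. prt n x) = x"
  by (rule poly_mapping_eqI) (auto simp: lookup_sum lookup_part in_keys_iff image_subset_iff)

lemma part_outside_degs: "n \<notin> degs x \<Longrightarrow> prt n x = 0"
  by (rule poly_mapping_eqI) (auto simp: lookup_part in_keys_iff)

lemma keys_part: "Poly_Mapping.keys (prt n x) \<subseteq> {k. deg k = n}"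
  by (auto simp: in_keys_iff lookup_part split: if_splits)

lemma part_eq_self: "(\<And>k. k \<in> Poly_Mapping.keys x \<Longrightarrow> deg k = n) \<Longrightarrow> prt n x = x"
  by (rule poly_mapping_eqI) (auto simp: lookup_part in_keys_iff)

lemma part_part_mult: "prt N (prt m x * prt n y) = (if N = m + n then prt m x * prt n y else 0)"
proof -
  have *: "deg k = m + n" if k: "k \<in> Poly_Mapping.keys (prt m x * prt n y)" for k
  proof -
    obtain u v where "k = u + v" "u \<in> Poly_Mapping.keys (prt m x)" "v \<in> Poly_Mapping.keys (prt n y)"
      using k keys_mult[of "prt m x" "prt n y"] by blast
    then show ?thesis
      using keys_part[of m x] keys_part[of n y] by (auto simp: deg_add)
  qed
  show ?thesis
    using * part_eq_self[of "prt m x * prt n y"] part_outside_degs[of N "prt m x * prt n y"] by auto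
qed

lemma part_mult_left: "prt d a = a \<Longrightarrow> prt n (a * x) = a * prt (n - d) x"
proof -
  assume a: "prt d a = a"
  \<comment> \<open>The index \<open>n - d\<close> is inserted so that the sum contains the selected
    term even when \<open>x\<close> has no component in that degree.\<close>
  have "prt n (a * x) = prt n (a * (\<Sum>m\<in>insert (n - d) (degs x). prt m x))"
    by (subst sum_part) auto
  also have "\<dots> = (\<Sum>m\<in>insert (n - d) (degs x). prt n (prt d a * prt m x))"
    by (simp add: sum_distrib_left part_sum a del: sum.insert sum.insert_if)
  also have "\<dots> = (\<Sum>m\<in>insert (n - d) (degs x). if m = n - d then a * prt m x else 0)"
    using part_part_mult[of n d a _ x] a by (intro sum.cong refl) auto
  also have "\<dots> = a * prt (n - d) x"
    by (subst sum.delta) auto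
  finally show ?thesis .
qed

lemma part_mult_right: "prt d a = a \<Longrightarrow> prt n (x * a) = prt (n - d) x * a"
proof -
  assume a: "prt d a = a"
  have "prt n (x * a) = prt n ((\<Sum>m\<in>insert (n - d) (degs x). prt m x) * a)"
    by (subst sum_part) auto
  also have "\<dots> = (\<Sum>m\<in>insert (n - d) (degs x). prt n (prt m x * prt d a))"
    by (simp add: sum_distrib_right part_sum a del: sum.insert sum.insert_if)
  also have "\<dots> = (\<Sum>m\<in>insert (n - d) (degs x). if m = n - d then prt m x * a else 0)"
    using part_part_mult[of n _ x d a] a by (intro sum.cong refl) auto
  also have "\<dots> = prt (n - d) x * a"
    by (subst sum.delta) auto
  finally show ?thesis .
qed

lemma part_mult: "prt n (x * y) = (\<Sum>i\<in>degs x. prt i x * prt (n - i) y)"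
proof -
  have "prt n (x * y) = prt n ((\<Sum>i\<in>degs x. prt i x) * y)"
    by (subst sum_part) auto
  also have "\<dots> = (\<Sum>i\<in>degs x. prt n (prt i x * y))"
    by (simp add: sum_distrib_right part_sum)
  also have "\<dots> = (\<Sum>i\<in>degs x. prt i x * prt (n - i) y)"
    by (intro sum.cong refl part_mult_left) (simp add: part_part)
  finally show ?thesis .
qed

lemma homogeneous_induct [consumes 1, case_names homogeneous add]:
  assumes "a \<in> A"
    and hom: "\<And>a d. a \<in> A \<Longrightarrow> prt d a = a \<Longrightarrow> Q a"
    and add: "\<And>a b. Q a \<Longrightarrow> Q b \<Longrightarrow> Q (a + b)"
  shows "Q a"
proof -
  have "Q (\<Sum>n\<in>T. prt n a)" if "finite T" for T
    using that
  proof (induction T)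
    case (insert n T)
    then show ?case
      using add[OF hom[of "prt n a" n]] assms(1) by (simp add: part_part)
  qed (use hom[of 0 0] in simp)
  from this[of "degs a"] show ?thesis
    by (simp add: sum_part)
qed

text \<open>The elements of \<open>I\<close> all of whose components lie in \<open>I\<close> form an
  ideal, by the convolution formula \<open>part_mult\<close>. It contains the homogeneous
  generators, hence all of \<open>I\<close>.\<close>

lemma part_generated_ideal:
  assumes I: "I = alg_ideal_generated S R" and R: "R \<subseteq> A" "\<And>r. r \<in> R \<Longrightarrow> \<exists>d. prt d r = r"
    and "x \<in> I"
  shows "prt n x \<in> I"
proof -
  define J where "J = {x \<in> I. \<forall>n. prt n x \<in> I}"
  have "prt n (a * x) \<in> I" "prt n (x * a) \<in> I" if "a \<in> A" "x \<in> J" for a x n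
    using that by (auto simp: part_mult J_def intro!: I_sum)
  then have "alg_ideal S J"
    unfolding alg_ideal_def alg_subspace_def S_simps
    by (auto simp: J_def I_A part_add part_scal)
  moreover have "r \<in> J" if "r \<in> R" for r
  proof -
    have "r \<in> I"
      using that by (auto simp: I alg_ideal_generated_def)
    moreover obtain d where "prt d r = r"
      using R(2) \<open>r \<in> R\<close> by blast
    then have "prt n r = (if n = d then r else 0)" for n
      by (metis part_part)
    ultimately show ?thesis
      by (auto simp: J_def)
  qed
  ultimately have "alg_ideal_generated S R \<subseteq> J"
    unfolding alg_ideal_generated_def by blast
  then show ?thesis
    using \<open>x \<in> I\<close> by (auto simp flip: I simp: J_def)
qed

end

locale graded_alg = local_unit_alg M I + degree_alg M I deg
  for M :: "'m::monoid_add set" and I :: "('m \<Rightarrow>\<^sub>0 'k::field) set" and deg :: "'m \<Rightarrow> int" +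
  assumes I_part: "x \<in> I \<Longrightarrow> prt n x \<in> I"
begin

lemma part_eqv: "x \<approx> y \<Longrightarrow> prt n x \<approx> prt n y"
  using I_part unfolding eqv_def by (metis part_diff)

definition component :: "int \<Rightarrow> ('m \<Rightarrow>\<^sub>0 'k) set set" where
  "component n = cls ` {p \<in> A. \<forall>w\<in>Poly_Mapping.keys p. deg w = n}"

lemma cls_sum_mem:
  assumes "alg_subspace L U" "\<And>i. i \<in> T \<Longrightarrow> cls (f i) \<in> U"
  shows "cls (sum f T) \<in> U"
  using assms(2)
proof (induction T rule: infinite_finite_induct)
  case (insert i T)
  then show ?case
    using assms(1) unfolding alg_subspace_def by (simp flip: add_L)
qed (use assms(1) in \<open>simp_all add: alg_subspace_def zero_L\<close>)

lemma graded_idl_imp_graded_ideal: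
  assumes "idl P" and P: "\<And>x n. x \<in> P \<Longrightarrow> prt n x \<in> P"
  shows "alg_graded_ideal L component (cls ` P)"
  unfolding alg_graded_ideal_def
proof (intro conjI equalityI)
  show ideal: "alg_ideal L (cls ` P)"
    using assms idl_imp_alg_ideal by blast
  then show "alg_span L (\<Union>n. cls ` P \<inter> component n) \<subseteq> cls ` P"
    unfolding alg_span_def alg_ideal_def by auto
  show "cls ` P \<subseteq> alg_span L (\<Union>n. cls ` P \<inter> component n)"
  proof
    fix X assume "X \<in> cls ` P"
    then obtain x where x: "x \<in> P" "X = cls x"
      by auto
    have "prt n x \<in> A \<and> (\<forall>w\<in>Poly_Mapping.keys (prt n x). deg w = n)" for n
      using P x keys_part[of n x] \<open>idl P\<close> by (auto simp: idl_def)
    then have *: "cls (prt n x) \<in> cls ` P \<inter> component n" for n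
      using P x by (auto simp: component_def)
    have "cls (\<Sum>n\<in>degs x. prt n x) \<in> U"
      if "alg_subspace L U" "(\<Union>n. cls ` P \<inter> component n) \<subseteq> U" for U
    proof (intro cls_sum_mem)
      fix n
      show "cls (prt n x) \<in> U"
        by (rule subsetD[OF that(2)], rule UN_I[of n, OF UNIV_I *])
    qed (rule that(1))
    then show "X \<in> alg_span L (\<Union>n. cls ` P \<inter> component n)"
      unfolding alg_span_def using x by (simp add: sum_part)
  qed
qed

lemma graded_simpleD:
  assumes "alg_graded_simple L component" "idl P" "\<And>x n. x \<in> P \<Longrightarrow> prt n x \<in> P"
  shows "P = I \<or> P = A"
proof -
  have "cls ` P = {alg_zero L} \<or> cls ` P = carrier L"
    using assms(1) graded_idl_imp_graded_ideal[OF assms(2,3)] unfolding alg_graded_simple_def by blast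
  then show ?thesis
    using cls_image_eq_zero[OF assms(2)] cls_image_eq_carrier[OF assms(2)] by simp
qed

text \<open>The annihilator of \<open>y\<close> is seen to be graded when \<open>y\<close> is
  homogeneous, so that case is settled first. In general let \<open>m\<close> and \<open>k\<close>
  be the top degrees of \<open>x\<close> and \<open>y\<close> modulo \<open>I\<close>. For
  \<open>a\<close> homogeneous of degree \<open>d\<close>, the component of \<open>x * a * y\<close>
  in degree \<open>m + d + k\<close> is congruent to \<open>prt m x * a * prt k y\<close>, which
  reduces the claim to the first case.\<close>

lemma graded_simple_imp_prime_elementwise:
  assumes "alg_graded_simple L component"
  shows "prime_elementwise"
proof -
  have homogeneous: "u \<in> I"
    if y: "y \<in> A" "prt k y = y" "y \<notin> I" and u: "u \<in> A" "\<And>a. a \<in> A \<Longrightarrow> u * a * y \<in> I" for y k u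
  proof -
    define P where "P = {u \<in> A. \<forall>a\<in>A. \<forall>w\<in>{y}. u * a * w \<in> I}"
    have "prt n u \<in> P" if "u \<in> P" for u n
    proof -
      have "prt n u * a * y \<in> I" if "a \<in> A" for a
        using that
      proof (induction rule: homogeneous_induct)
        case (homogeneous a d)
        have "prt (n + d + k) (u * a * y) \<in> I"
          using \<open>u \<in> P\<close> homogeneous by (intro I_part) (auto simp: P_def)
        then show ?case
          using part_mult_right[OF y(2)] part_mult_right[OF homogeneous(2)] by simp
      qed (auto simp: distrib_left distrib_right)
      then show ?thesis
        using that by (auto simp: P_def)
    qed
    then have "P = I \<or> P = A"
      using assms idl_left_annihilator[of "{y}"] y(1) by (intro graded_simpleD) (auto simp: P_def)
    moreover have "P \<noteq> A"
      using mem_I_if_annihilated[OF y(1)] y(3) by (auto simp: P_def)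
    ultimately show ?thesis
      using u by (auto simp: P_def)
  qed
  show ?thesis
    unfolding prime_elementwise_def
  proof (intro conjI ballI impI)
    show "A \<noteq> I"
      using assms carrier_L_eq_zero by (simp add: alg_graded_simple_def)
    fix x y assume xy: "x \<in> A" "y \<in> A" "\<forall>a\<in>A. x * a * y \<in> I"
    show "x \<in> I \<or> y \<in> I"
    proof (rule ccontr)
      assume "\<not> ?thesis"
      then have not_I: "x \<notin> I" "y \<notin> I"
        by auto
      \<comment> \<open>The top degree is taken modulo \<open>I\<close>, because a representative
        may have higher components that vanish in the quotient.\<close>
      have top: "\<exists>m. prt m z \<notin> I \<and> (\<forall>i>m. prt i z \<in> I)" if "z \<notin> I" for z
      proof -
        define T where "T = {n \<in> degs z. prt n z \<notin> I}"
        have "finite T"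
          by (simp add: T_def)
        moreover have "T \<noteq> {}"
        proof
          assume "T = {}"
          then have "(\<Sum>n\<in>degs z. prt n z) \<in> I"
            by (intro I_sum) (auto simp: T_def)
          with \<open>z \<notin> I\<close> show False
            by (simp add: sum_part)
        qed
        ultimately have "Max T \<in> T" "\<forall>i>Max T. i \<notin> T"
          by (auto simp: not_le[symmetric])
        moreover have "prt i z \<in> I" if "i \<notin> T" for i
          using that part_outside_degs[of i z] unfolding T_def by (cases "i \<in> degs z") simp_all
        ultimately show ?thesis
          unfolding T_def by blast
      qed
      obtain m where m: "prt m x \<notin> I" "\<And>i. i > m \<Longrightarrow> prt i x \<in> I"
        using top not_I by blast
      obtain k where k: "prt k y \<notin> I" "\<And>i. i > k \<Longrightarrow> prt i y \<in> I"
        using top not_I by blast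
      have "prt m x * a * prt k y \<in> I" if "a \<in> A" for a
        using that
      proof (induction rule: homogeneous_induct)
        case (homogeneous a d)
        have m_degs: "m \<in> degs x"
          using m(1) part_outside_degs by fastforce
        let ?f = "\<lambda>i. prt i x * (a * prt (m + k - i) y)"
        have "prt (m + d + k) (x * (a * y)) = (\<Sum>i\<in>degs x. ?f i)"
          using part_mult[of "m + d + k" x "a * y"] part_mult_left[OF homogeneous(2), of _ y]
          by (simp add: algebra_simps)
        moreover have "prt (m + d + k) (x * (a * y)) \<in> I"
          using homogeneous xy by (intro I_part) (auto simp flip: mult.assoc)
        moreover have "(\<Sum>i\<in>degs x. ?f i) = ?f m + (\<Sum>i\<in>degs x - {m}. ?f i)"
          using m_degs by (intro sum.remove) auto
        moreover have "(\<Sum>i\<in>degs x - {m}. ?f i) \<in> I"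
        proof (intro I_sum)
          fix i assume "i \<in> degs x - {m}"
          then consider "i > m" | "m + k - i > k"
            by fastforce
          then have "prt i x \<in> I \<or> prt (m + k - i) y \<in> I"
            using m(2) k(2) by cases blast+
          then show "?f i \<in> I"
            using homogeneous xy by auto
        qed
        ultimately have "?f m \<in> I"
          using I_diff by fastforce
        then show ?case
          by (simp add: mult.assoc)
      qed (auto simp: distrib_left distrib_right)
      then show False
        using homogeneous[of "prt k y" k "prt m x"] m k xy by (auto simp: part_part)
    qed
  qed
qed

text \<open>If \<open>x\<close> is an element of minimal support of a non-graded ideal and \<open>h\<close> is one of its
  components, then \<open>h a x - x a h\<close> has smaller support for each homogeneous \<open>a\<close>, so it vanishes;
  hence mapping \<open>h\<close> to another component of \<open>x\<close> extends to the centroid.\<close>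

lemma graded_simple_not_all_scalar:
  assumes gs: "alg_graded_simple L component" and "\<not> alg_simple L"
  shows "\<not> all_scalar"
proof
  assume all_scalar
  have "A \<noteq> I"
    using gs carrier_L_eq_zero by (simp add: alg_graded_simple_def)
  then obtain P where P: "idl P" "P \<noteq> I" "P \<noteq> A"
    using assms(2) by (auto simp: alg_simple_iff)
  define supp where "supp x = {n. prt n x \<notin> I}" for x
  have fin: "finite (supp x)" for x
    by (rule finite_subset[of _ "degs x"]) (use part_outside_degs in \<open>force simp: supp_def\<close>)+
  obtain x where x: "x \<in> P" "x \<notin> I" and min: "\<And>y. y \<in> P \<Longrightarrow> y \<notin> I \<Longrightarrow> card (supp x) \<le> card (supp y)"
  proof -
    obtain x where "x \<in> P \<and> x \<notin> I"
      using P by (auto simp: idl_def)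
    from ex_has_least_nat[of "\<lambda>x. x \<in> P \<and> x \<notin> I" x "\<lambda>x. card (supp x)", OF this]
    show ?thesis
      using that by blast
  qed
  have xA: "x \<in> A"
    using x P by (auto simp: idl_def)
  have x_sum: "x \<approx> (\<Sum>n\<in>supp x. prt n x)"
  proof -
    have "x = (\<Sum>n\<in>degs x \<union> supp x. prt n x)"
      using fin by (simp add: sum_part)
    also have "\<dots> = (\<Sum>n\<in>supp x. prt n x) + (\<Sum>n\<in>degs x - supp x. prt n x)"
      using fin by (subst sum.union_disjoint[symmetric]) (auto intro: sum.cong)
    also have "\<dots> \<approx> (\<Sum>n\<in>supp x. prt n x) + 0"
      by (intro eqv_add) (auto simp: eqv_0_iff supp_def)
    finally show ?thesis
      by simp
  qed
  have "supp x \<noteq> {}"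
    using x_sum x(2) eqv_0_iff by auto
  then obtain n0 where n0: "n0 \<in> supp x"
    by blast
  have "supp x \<noteq> {n0}"
  proof
    assume "supp x = {n0}"
    then have "prt n0 x \<in> P"
      using x_sum x(1) P(1) idl_eqv eqv_sym by fastforce
    \<comment> \<open>\<open>Q\<close> is the largest graded ideal inside \<open>P\<close>. If
      \<open>x\<close> had only one component modulo \<open>I\<close>, that component would make
      \<open>Q\<close> nonzero, so graded simplicity would force \<open>Q = A\<close> and hence
      \<open>P = A\<close>.\<close>
    define Q where "Q = {u \<in> A. \<forall>n. prt n u \<in> P}"
    have P': "\<And>x. x \<in> I \<Longrightarrow> x \<in> P" "\<And>x y. x \<in> P \<Longrightarrow> y \<in> P \<Longrightarrow> x + y \<in> P"
      "\<And>x c. x \<in> P \<Longrightarrow> scal c x \<in> P" "\<And>a x. a \<in> A \<Longrightarrow> x \<in> P \<Longrightarrow> a * x \<in> P"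
      "\<And>a x. a \<in> A \<Longrightarrow> x \<in> P \<Longrightarrow> x * a \<in> P"
      using P(1) by (auto simp: idl_def)
    have P_sum: "sum f T \<in> P" if "\<And>i. i \<in> T \<Longrightarrow> f i \<in> P" for f and T :: "int set"
      using that P' by (induction T rule: infinite_finite_induct) auto
    have "prt n (a * u) \<in> P" "prt n (u * a) \<in> P" if "a \<in> A" "u \<in> Q" for a u n
      using that P' by (auto simp: part_mult Q_def intro!: P_sum)
    then have "idl Q"
      unfolding idl_def using I_part I_A P' by (auto simp: Q_def part_add part_scal)
    moreover have "prt n u \<in> Q" if "u \<in> Q" for n u
      using that P' by (auto simp: Q_def part_part)
    ultimately have "Q = I \<or> Q = A"
      using gs by (intro graded_simpleD)
    moreover have "prt n0 x \<in> Q"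
      using \<open>prt n0 x \<in> P\<close> xA P' by (auto simp: Q_def part_part)
    ultimately have "Q = A"
      using n0 by (auto simp: supp_def)
    have "u \<in> P" if "u \<in> A" for u
      using that \<open>Q = A\<close> P_sum[of "degs u" "\<lambda>n. prt n u"] by (auto simp: Q_def sum_part)
    then show False
      using P by (auto simp: idl_def)
  qed
  then obtain n1 where n1: "n1 \<in> supp x" "n1 \<noteq> n0"
    using n0 by blast
  define h where "h = prt n0 x"
  define g where "g = prt n1 x"
  have hg: "h \<in> A" "g \<in> A" "prt n0 h = h" "prt n1 g = g" "h \<notin> I" "g \<notin> I"
    using xA n0 n1 by (auto simp: h_def g_def part_part supp_def)
  have comm: "h * a * g \<approx> g * a * h" if "a \<in> A" for a
    using that
  proof (induction rule: homogeneous_induct)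
    case (homogeneous a d)
    \<comment> \<open>The shift by \<open>n0 + d\<close> is the degree of \<open>h * a\<close> and
      of \<open>a * h\<close>. The component of \<open>y\<close> coming from \<open>prt n0 x\<close>
      is \<open>h * a * h - h * a * h = 0\<close>, so the support loses at least the place of
      \<open>n0\<close>; the component coming from \<open>prt n1 x\<close> is the desired
      commutation relation.\<close>
    define y where "y = h * a * x - x * a * h"
    have ha: "prt (n0 + d) (h * a) = h * a" "prt (n0 + d) (a * h) = a * h"
      using part_mult_right[OF homogeneous(2), of "n0 + d" h]
        part_mult_left[OF homogeneous(2), of "n0 + d" h] hg by auto
    have part_y: "prt (n + (n0 + d)) y = h * a * prt n x - prt n x * a * h" for n
      using part_mult_left[OF ha(1), of "n + (n0 + d)" x] part_mult_right[OF ha(2), of "n + (n0 + d)" x]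
      by (simp add: y_def part_diff mult.assoc)
    have "y \<in> I"
    proof (rule ccontr)
      assume "y \<notin> I"
      have "y \<in> P"
        using P(1) x(1) homogeneous hg unfolding y_def
        by (intro idl_diff) (auto simp: idl_def mult.assoc)
      have "supp y \<subseteq> (\<lambda>n. n + (n0 + d)) ` (supp x - {n0})"
      proof
        fix m assume "m \<in> supp y"
        then have m: "prt (m - (n0 + d) + (n0 + d)) y \<notin> I"
          by (simp add: supp_def)
        then have "m - (n0 + d) \<in> supp x"
          unfolding part_y using homogeneous hg by (auto simp: supp_def mult.assoc)
        moreover have "m - (n0 + d) \<noteq> n0"
        proof
          assume "m - (n0 + d) = n0"
          with m show False
            unfolding part_y by (simp flip: h_def)
        qed
        ultimately show "m \<in> (\<lambda>n. n + (n0 + d)) ` (supp x - {n0})"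
          by (intro image_eqI[of _ _ "m - (n0 + d)"]) auto
      qed
      then have "card (supp y) \<le> card (supp x - {n0})"
        using fin by (metis surj_card_le finite_Diff)
      also have "\<dots> < card (supp x)"
        using fin n0 by (intro psubset_card_mono) auto
      finally show False
        using min[OF \<open>y \<in> P\<close> \<open>y \<notin> I\<close>] by simp
    qed
    then show ?case
      using I_part[of y "n1 + (n0 + d)"] by (simp add: part_y g_def eqv_def)
  qed (auto simp: distrib_left distrib_right intro: eqv_add)
  \<comment> \<open>The extension to be constructed sends degree \<open>n0\<close> to degree
    \<open>n1\<close>, so the solution belonging to \<open>prt n u\<close> is the component of
    \<open>w\<close> in degree \<open>n + n1 - n0\<close>. Thus the domain is graded.\<close>
  have "prt n u \<in> ext_domain h g" if u: "u \<in> ext_domain h g" for n u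
  proof -
    obtain w where w: "u \<in> A" "w \<in> A" "\<And>a. a \<in> A \<Longrightarrow> h * a * w \<approx> g * a * u"
      using u by (auto simp: ext_domain_def)
    have "h * a * prt (n + n1 - n0) w \<approx> g * a * prt n u" if "a \<in> A" for a
      using that
    proof (induction rule: homogeneous_induct)
      case (homogeneous a d)
      have ha: "prt (n0 + d) (h * a) = h * a" "prt (n1 + d) (g * a) = g * a"
        using part_mult_right[OF homogeneous(2), of "n0 + d" h]
          part_mult_right[OF homogeneous(2), of "n1 + d" g] hg by auto
      show ?case
        using part_eqv[OF w(3)[OF homogeneous(1)], of "n + n1 + d"]
        unfolding part_mult_left[OF ha(1)] part_mult_left[OF ha(2)] by (simp add: algebra_simps)
    qed (auto simp: distrib_left distrib_right intro: eqv_add)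
    then show ?thesis
      using w by (auto simp: ext_domain_def intro!: bexI[of _ "prt (n + n1 - n0) w"])
  qed
  then have "ext_domain h g = I \<or> ext_domain h g = A"
    using gs hg by (intro graded_simpleD idl_ext_domain)
  moreover have "h \<in> ext_domain h g"
    using hg comm by (auto simp: ext_domain_def)
  ultimately have "ext_domain h g = A"
    using hg by blast
  then obtain t where t: "cent t" "t h \<approx> g"
    using cent_extend[OF graded_simple_imp_prime_elementwise[OF gs] hg(1,5,2) comm] by blast
  then obtain c where "t h \<approx> scal c h"
    using \<open>all_scalar\<close> hg unfolding all_scalar_def by blast
  then have "g \<approx> scal c h"
    using t eqv_sym eqv_trans by blast
  \<comment> \<open>A scalar multiple of \<open>h\<close> has no component in degree
    \<open>n1\<close>, while the nonzero \<open>g\<close> is concentrated there.\<close>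
  then have "prt n1 g \<approx> scal c (prt n1 h)"
    using part_eqv part_scal by metis
  moreover have "prt n1 h = 0"
    using n1 by (simp add: h_def part_part)
  ultimately show False
    using hg by (simp add: eqv_0_iff)
qed

end

section \<open>Monomials in Leavitt path algebras\<close>

text \<open>The hypotheses put the whole carrier into the family that is intersected, so the
  intersection stays inside the carrier.\<close>

lemma alg_ideal_generated_ideal:
  assumes "alg_ideal A (carrier A)" "R \<subseteq> carrier A"
  shows "alg_ideal A (alg_ideal_generated A R)"
proof -
  have "alg_ideal_generated A R \<subseteq> carrier A"
    using assms by (auto simp: alg_ideal_generated_def)
  then show ?thesis
    unfolding alg_ideal_def alg_subspace_def alg_ideal_generated_def by blast
qed

definition lpa_words :: "('v, 'e) pre_digraph \<Rightarrow> ('v, 'e) lpa_gen free_word set" where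
  "lpa_words E = {w. letters w \<noteq> [] \<and> set (letters w) \<subseteq> lpa_gens E}"

lemma free_algebra_eq: "free_algebra (lpa_gens E) = semigroup_algebra (lpa_words E)"
  by (simp add: free_algebra_def lpa_words_def)

lemma lpa_words_add: "u \<in> lpa_words E \<Longrightarrow> v \<in> lpa_words E \<Longrightarrow> u + v \<in> lpa_words E"
  by (auto simp: lpa_words_def plus_free_word_def)

text \<open>With the zero ideal, \<open>quot_alg\<close> already yields the closure properties of
  \<open>A\<close>; they are used to show that the relators lie in the carrier and that
  \<open>lpa_ideal\<close> is an ideal.\<close>

lemma alg_ideal_zero: "alg_ideal (semigroup_algebra M) {0 :: 'm::monoid_add \<Rightarrow>\<^sub>0 'k::field}"
  unfolding alg_ideal_def alg_subspace_def semigroup_algebra_def by (auto simp: map_eq_scal)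

lemma lpa_word_mult: "lpa_word xs * lpa_word ys = lpa_word (xs @ ys)"
  by (simp add: mult_single plus_free_word_def)

lemma single_mem_carrier:
  "xs \<noteq> [] \<Longrightarrow> set xs \<subseteq> lpa_gens E \<Longrightarrow>
    Poly_Mapping.single (Free_Word xs) c \<in> carrier (semigroup_algebra (lpa_words E))"
  by (auto simp: semigroup_algebra_def lpa_words_def)

lemma (in wf_digraph) lpa_relators_subset:
  "(lpa_relators G :: (('a, 'b) lpa_gen free_word \<Rightarrow>\<^sub>0 'k::field) set) \<subseteq> carrier (free_algebra (lpa_gens G))"
proof -
  interpret quot_alg "lpa_words G" "{0 :: ('a, 'b) lpa_gen free_word \<Rightarrow>\<^sub>0 'k}"
    by unfold_locales (auto intro: lpa_words_add alg_ideal_zero)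
  have *: "lpa_word xs \<in> A" if "xs \<noteq> []" "set xs \<subseteq> lpa_gens G" for xs
    using single_mem_carrier[OF that, of "1::'k"] by (simp add: S_simps)
  show ?thesis
    unfolding free_algebra_eq S_simps lpa_relators_def
    by (auto intro!: A_diff A_sum * simp: lpa_gens_def regular_vertex_def)
qed

lemma (in wf_digraph) alg_ideal_lpa_ideal:
  "alg_ideal (semigroup_algebra (lpa_words G))
     (lpa_ideal G :: (('a, 'b) lpa_gen free_word \<Rightarrow>\<^sub>0 'k::field) set)"
proof -
  interpret quot_alg "lpa_words G" "{0 :: ('a, 'b) lpa_gen free_word \<Rightarrow>\<^sub>0 'k}"
    by unfold_locales (auto intro: lpa_words_add alg_ideal_zero)
  show ?thesis
    unfolding lpa_ideal_def free_algebra_eq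
  proof (rule alg_ideal_generated_ideal)
    show "alg_ideal S (carrier S)"
      unfolding alg_ideal_def alg_subspace_def S_simps by auto
  qed (use lpa_relators_subset free_algebra_eq in metis)
qed

locale lpa = wf_digraph E
  for E :: "('v, 'e) pre_digraph" +
  fixes K :: "'k::field itself"
begin

sublocale quot_alg "lpa_words E" "lpa_ideal E :: (('v, 'e) lpa_gen free_word \<Rightarrow>\<^sub>0 'k) set"
  by unfold_locales (auto intro: lpa_words_add alg_ideal_lpa_ideal)

sublocale degree_alg "lpa_words E" "lpa_ideal E :: (('v, 'e) lpa_gen free_word \<Rightarrow>\<^sub>0 'k) set" lpa_word_degree
  by unfold_locales (simp add: lpa_word_degree_def plus_free_word_def)

notation eqv (infix "\<approx>" 50)

abbreviation I :: "(('v, 'e) lpa_gen free_word \<Rightarrow>\<^sub>0 'k) set" where "I \<equiv> lpa_ideal E"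

abbreviation wd :: "('v, 'e) lpa_gen list \<Rightarrow> ('v, 'e) lpa_gen free_word \<Rightarrow>\<^sub>0 'k" where
  "wd \<equiv> lpa_word"

abbreviation "V v \<equiv> wd [Vertex v]"
abbreviation "Ed e \<equiv> wd [Edge e]"
abbreviation "Gh e \<equiv> wd [Ghost e]"

lemma wd_A [intro]: "xs \<noteq> [] \<Longrightarrow> set xs \<subseteq> lpa_gens E \<Longrightarrow> wd xs \<in> A"
  using single_mem_carrier[of xs E "1::'k"] by (simp add: S_simps)

lemma gens_A [simp, intro]: "v \<in> verts E \<Longrightarrow> V v \<in> A" "e \<in> arcs E \<Longrightarrow> Ed e \<in> A" "e \<in> arcs E \<Longrightarrow> Gh e \<in> A"
  by (auto intro!: wd_A simp: lpa_gens_def)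

lemma relators_subset_I: "lpa_relators E \<subseteq> I"
  by (auto simp: lpa_ideal_def alg_ideal_generated_def)

lemma part_single: "prt n (Poly_Mapping.single w c) = (if lpa_word_degree w = n then Poly_Mapping.single w c else 0)"
  by (rule poly_mapping_eqI) (auto simp: lookup_part lookup_single when_def)

lemma I_homogeneous: "x \<in> I \<Longrightarrow> prt n x \<in> I"
proof (rule part_generated_ideal)
  show "I = alg_ideal_generated S (lpa_relators E)"
    by (simp add: lpa_ideal_def free_algebra_eq)
  show "lpa_relators E \<subseteq> A"
    using relators_subset_I I_A by blast
  fix r :: "('v, 'e) lpa_gen free_word \<Rightarrow>\<^sub>0 'k" assume "r \<in> lpa_relators E"
  then have "prt 0 r = r \<or> prt 1 r = r \<or> prt (- 1) r = r"
    unfolding lpa_relators_def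
    by (auto simp: part_diff part_sum part_single lpa_word_degree_def)
  then show "\<exists>d. prt d r = r"
    by blast
qed

lemma V_V: "v \<in> verts E \<Longrightarrow> w \<in> verts E \<Longrightarrow> V v * V w \<approx> (if v = w then V v else 0)"
  and V_Ed: "e \<in> arcs E \<Longrightarrow> V (tail E e) * Ed e \<approx> Ed e"
  and Ed_V: "e \<in> arcs E \<Longrightarrow> Ed e * V (head E e) \<approx> Ed e"
  and V_Gh: "e \<in> arcs E \<Longrightarrow> V (head E e) * Gh e \<approx> Gh e"
  and Gh_V: "e \<in> arcs E \<Longrightarrow> Gh e * V (tail E e) \<approx> Gh e"
  and Gh_Ed: "e \<in> arcs E \<Longrightarrow> f \<in> arcs E \<Longrightarrow> Gh e * Ed f \<approx> (if e = f then V (head E e) else 0)"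
  and V_sum: "regular_vertex E v \<Longrightarrow> V v \<approx> (\<Sum>e\<in>out_arcs E v. Ed e * Gh e)"
  unfolding eqv_def lpa_word_mult append.simps
  by (rule subsetD[OF relators_subset_I], unfold lpa_relators_def, blast)+

section \<open>Vertices as one-sided units on words, and local units\<close>

primrec left_vertex :: "('v, 'e) lpa_gen \<Rightarrow> 'v" where
  "left_vertex (Vertex v) = v"
| "left_vertex (Edge e) = tail E e"
| "left_vertex (Ghost e) = head E e"

primrec right_vertex :: "('v, 'e) lpa_gen \<Rightarrow> 'v" where
  "right_vertex (Vertex v) = v"
| "right_vertex (Edge e) = head E e"
| "right_vertex (Ghost e) = tail E e"

lemma gen_vertex_verts: "g \<in> lpa_gens E \<Longrightarrow> left_vertex g \<in> verts E \<and> right_vertex g \<in> verts E"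
  by (auto simp: lpa_gens_def)

lemma eqv_mult: "x \<approx> x' \<Longrightarrow> y \<approx> y' \<Longrightarrow> x \<in> A \<Longrightarrow> y \<in> A \<Longrightarrow> x * y \<approx> x' * y'"
  using eqv_mult_left eqv_mult_right eqv_trans eqv_A by meson

lemma V_gen: "g \<in> lpa_gens E \<Longrightarrow> V (left_vertex g) * wd [g] \<approx> wd [g]"
  and gen_V: "g \<in> lpa_gens E \<Longrightarrow> wd [g] * V (right_vertex g) \<approx> wd [g]"
  using V_V[of "left_vertex g" "left_vertex g"] V_Ed V_Gh Ed_V Gh_V by (auto simp: lpa_gens_def)

lemma V_word:
  assumes "xs \<noteq> []" "set xs \<subseteq> lpa_gens E" "v \<in> verts E"
  shows "V v * wd xs \<approx> (if v = left_vertex (hd xs) then wd xs else 0)"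
proof -
  obtain g ys where xs: "xs = g # ys"
    using assms by (cases xs) auto
  have g: "g \<in> lpa_gens E"
    using assms xs by auto
  have *: "V v * wd [g] \<approx> (if v = left_vertex g then wd [g] else 0)"
  proof (cases "v = left_vertex g")
    case True
    then show ?thesis
      using V_gen g by simp
  next
    case False
    have "V v * wd [g] \<approx> V v * (V (left_vertex g) * wd [g])"
      using assms g by (intro eqv_mult_left eqv_sym[OF V_gen]) auto
    also have "\<dots> = V v * V (left_vertex g) * wd [g]"
      by (simp add: mult.assoc)
    also have "\<dots> \<approx> 0 * wd [g]"
      using V_V[of v "left_vertex g"] False assms g gen_vertex_verts
      by (intro eqv_mult_right wd_A) auto
    finally show ?thesis
      using False by simp
  qed
  show ?thesis
  proof (cases "ys = []")
    case True
    then show ?thesis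
      using * xs by (auto split: if_splits)
  next
    case False
    then have "V v * wd [g] * wd ys \<approx> (if v = left_vertex g then wd [g] else 0) * wd ys"
      using assms xs by (intro eqv_mult_right * wd_A) auto
    then show ?thesis
      by (auto simp: lpa_word_mult mult.assoc xs split: if_splits)
  qed
qed

lemma word_V:
  assumes "xs \<noteq> []" "set xs \<subseteq> lpa_gens E" "v \<in> verts E"
  shows "wd xs * V v \<approx> (if v = right_vertex (last xs) then wd xs else 0)"
proof -
  obtain g ys where xs: "xs = ys @ [g]"
    using assms by (cases xs rule: rev_cases) auto
  have g: "g \<in> lpa_gens E"
    using assms xs by auto
  have *: "wd [g] * V v \<approx> (if v = right_vertex g then wd [g] else 0)"
  proof (cases "v = right_vertex g")
    case True
    then show ?thesis
      using gen_V g by simp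
  next
    case False
    have "wd [g] * V v \<approx> wd [g] * V (right_vertex g) * V v"
      using assms g by (intro eqv_mult_right eqv_sym[OF gen_V]) auto
    also have "\<dots> = wd [g] * (V (right_vertex g) * V v)"
      by (simp add: mult.assoc)
    also have "\<dots> \<approx> wd [g] * 0"
      using V_V[of "right_vertex g" v] False assms g gen_vertex_verts
      by (intro eqv_mult_left wd_A) auto
    finally show ?thesis
      using False by simp
  qed
  show ?thesis
  proof (cases "ys = []")
    case True
    then show ?thesis
      using * xs by (auto split: if_splits)
  next
    case False
    then have "wd ys * (wd [g] * V v) \<approx> wd ys * (if v = right_vertex g then wd [g] else 0)"
      using assms xs by (intro eqv_mult_left * wd_A) auto
    then show ?thesis
      by (auto simp: lpa_word_mult mult.assoc xs split: if_splits)
  qed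
qed

text \<open>The sum of the finitely many vertices at which the words of \<open>x\<close> begin or
  end fixes each of these words from both sides, since different vertices annihilate them.\<close>

lemma local_units: "x \<in> A \<Longrightarrow> \<exists>g\<in>A. g * x \<approx> x \<and> x * g \<approx> x"
proof -
  assume x: "x \<in> A"
  define T where "T = (\<lambda>w. left_vertex (hd (letters w))) ` Poly_Mapping.keys x \<union>
    (\<lambda>w. right_vertex (last (letters w))) ` Poly_Mapping.keys x"
  have keys: "letters w \<noteq> []" "set (letters w) \<subseteq> lpa_gens E" if "w \<in> Poly_Mapping.keys x" for w
    using x that unfolding A_def by (auto simp: lpa_words_def)
  have "left_vertex (hd (letters w)) \<in> verts E \<and> right_vertex (last (letters w)) \<in> verts E"
    if "w \<in> Poly_Mapping.keys x" for w
    using keys[OF that] gen_vertex_verts hd_in_set last_in_set by blast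
  then have T: "finite T" "T \<subseteq> verts E"
    by (auto simp: T_def)
  define g where "g = (\<Sum>v\<in>T. V v)"
  have gA: "g \<in> A"
    using T by (auto simp: g_def intro!: A_sum)
  have w: "g * wd (letters w) \<approx> wd (letters w)" "wd (letters w) * g \<approx> wd (letters w)"
    if "w \<in> Poly_Mapping.keys x" for w
  proof -
    have "g * wd (letters w) \<approx> (\<Sum>v\<in>T. if v = left_vertex (hd (letters w)) then wd (letters w) else 0)"
      unfolding g_def sum_distrib_right using keys[OF that] T by (intro eqv_sum V_word) auto
    then show "g * wd (letters w) \<approx> wd (letters w)"
      using that T by (simp add: T_def)
    have "wd (letters w) * g \<approx> (\<Sum>v\<in>T. if v = right_vertex (last (letters w)) then wd (letters w) else 0)"
      unfolding g_def sum_distrib_left using keys[OF that] T by (intro eqv_sum word_V) auto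
    then show "wd (letters w) * g \<approx> wd (letters w)"
      using that T by (simp add: T_def)
  qed
  have x_eq: "x = (\<Sum>w\<in>Poly_Mapping.keys x. scal (Poly_Mapping.lookup x w) (wd (letters w)))"
    by (subst poly_mapping_eq_sum_single) (simp add: scal_single)
  have "g * x \<approx> x"
    by (subst (1 2) x_eq, unfold sum_distrib_left scal_mult_right) (intro eqv_sum eqv_scal w)
  moreover have "x * g \<approx> x"
    by (subst (1 2) x_eq, unfold sum_distrib_right scal_mult_left) (intro eqv_sum eqv_scal w)
  ultimately show ?thesis
    using gA by blast
qed

sublocale graded_alg "lpa_words E" "lpa_ideal E :: (('v, 'e) lpa_gen free_word \<Rightarrow>\<^sub>0 'k) set" lpa_word_degree
  by unfold_locales (auto intro: local_units I_homogeneous)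

section \<open>Paths and ghost paths as elements of the algebra\<close>

definition pth :: "'v \<Rightarrow> 'e list \<Rightarrow> ('v, 'e) lpa_gen free_word \<Rightarrow>\<^sub>0 'k" where
  "pth v p = wd (Vertex v # map Edge p)"

text \<open>As in \<open>pth\<close>, the vertex letter keeps the word nonempty for a path of length
  0. The reversal makes this the element \<open>p\<^sup>*\<close>, which leads from the range of
  \<open>p\<close> back to its source \<open>v\<close>.\<close>

definition gst :: "'v \<Rightarrow> 'e list \<Rightarrow> ('v, 'e) lpa_gen free_word \<Rightarrow>\<^sub>0 'k" where
  "gst v p = wd (map Ghost (rev p) @ [Vertex v])"

lemma pth_Nil: "pth v [] = V v" and gst_Nil: "gst v [] = V v"
  by (simp_all add: pth_def gst_def)

lemma awalk_gens:
  "awalk v p w \<Longrightarrow> set (Vertex v # map Edge p) \<subseteq> lpa_gens E"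
  "awalk v p w \<Longrightarrow> set (map Ghost (rev p) @ [Vertex v]) \<subseteq> lpa_gens E"
  by (auto simp: awalk_def lpa_gens_def)

lemma pth_A [intro]: "awalk v p w \<Longrightarrow> pth v p \<in> A"
  and gst_A [intro]: "awalk v p w \<Longrightarrow> gst v p \<in> A"
  unfolding pth_def gst_def by (rule wd_A[OF _ awalk_gens(1)] wd_A[OF _ awalk_gens(2)]; simp)+

lemma right_vertex_awalk: "awalk v p w \<Longrightarrow> right_vertex (last (Vertex v # map Edge p)) = w"
  by (induction p arbitrary: v) (auto simp: awalk_simps)

lemma left_vertex_awalk: "awalk v p w \<Longrightarrow> left_vertex (hd (map Ghost (rev p) @ [Vertex v])) = w"
  by (induction p arbitrary: v) (auto simp: awalk_simps hd_append)

lemma pth_V: "awalk v p w \<Longrightarrow> u \<in> verts E \<Longrightarrow> pth v p * V u \<approx> (if u = w then pth v p else 0)"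
  using word_V[of "Vertex v # map Edge p" u] awalk_gens(1)[of v p w] right_vertex_awalk[of v p w]
  by (simp add: pth_def split: if_splits)

lemma V_gst: "awalk v p w \<Longrightarrow> u \<in> verts E \<Longrightarrow> V u * gst v p \<approx> (if u = w then gst v p else 0)"
  using V_word[of "map Ghost (rev p) @ [Vertex v]" u] awalk_gens(2)[of v p w] left_vertex_awalk[of v p w]
  by (simp add: gst_def split: if_splits)

lemma V_pth: "awalk v p w \<Longrightarrow> u \<in> verts E \<Longrightarrow> V u * pth v p \<approx> (if u = v then pth v p else 0)"
  using V_word[of "Vertex v # map Edge p" u] awalk_gens(1)[of v p w] by (simp add: pth_def split: if_splits)

lemma gst_V: "awalk v p w \<Longrightarrow> u \<in> verts E \<Longrightarrow> gst v p * V u \<approx> (if u = v then gst v p else 0)"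
  using word_V[of "map Ghost (rev p) @ [Vertex v]" u] awalk_gens(2)[of v p w] by (simp add: gst_def split: if_splits)

lemma pth_append:
  assumes "awalk v p u" "awalk u q w"
  shows "pth v p * pth u q \<approx> pth v (p @ q)"
proof (cases "q = []")
  case True
  then show ?thesis
    using pth_V[OF assms(1), of u] assms by (auto simp: pth_Nil)
next
  case False
  have "pth v p * V u * wd (map Edge q) \<approx> pth v p * wd (map Edge q)"
    using pth_V[OF assms(1), of u] assms False by (intro eqv_mult_right wd_A) (auto simp: awalk_def lpa_gens_def)
  then show ?thesis
    by (simp add: pth_def lpa_word_mult)
qed

lemma gst_append:
  assumes "awalk v p u" "awalk u q w"
  shows "gst u q * gst v p \<approx> gst v (p @ q)"
proof (cases "q = []")
  case True
  then show ?thesis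
    using V_gst[OF assms(1), of u] assms by (auto simp: gst_Nil)
next
  case False
  have "wd (map Ghost (rev q)) * (V u * gst v p) \<approx> wd (map Ghost (rev q)) * gst v p"
    using V_gst[OF assms(1), of u] assms False by (intro eqv_mult_left wd_A) (auto simp: awalk_def lpa_gens_def)
  then show ?thesis
    by (simp add: gst_def lpa_word_mult)
qed

lemma pth_single: "e \<in> arcs E \<Longrightarrow> pth (tail E e) [e] \<approx> Ed e"
  using V_Ed by (simp add: pth_def lpa_word_mult)

lemma gst_single: "e \<in> arcs E \<Longrightarrow> gst (tail E e) [e] \<approx> Gh e"
  using Gh_V by (simp add: gst_def lpa_word_mult)

lemma awalk_single: "e \<in> arcs E \<Longrightarrow> awalk (tail E e) [e] (head E e)"
  by (simp add: awalk_simps)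

lemma pth_Cons:
  assumes "awalk v (e # p) w"
  shows "pth v (e # p) \<approx> Ed e * pth (head E e) p"
proof -
  have e: "e \<in> arcs E" "v = tail E e" "awalk (head E e) p w"
    using assms by (auto simp: awalk_simps)
  have "pth v (e # p) \<approx> pth v [e] * pth (head E e) p"
    using pth_append[of v "[e]" "head E e" p w] e awalk_single by (auto intro: eqv_sym)
  also have "\<dots> \<approx> Ed e * pth (head E e) p"
    using e pth_single by (intro eqv_mult_right) auto
  finally show ?thesis .
qed

lemma gst_Cons:
  assumes "awalk v (e # p) w"
  shows "gst v (e # p) \<approx> gst (head E e) p * Gh e"
proof -
  have e: "e \<in> arcs E" "v = tail E e" "awalk (head E e) p w"
    using assms by (auto simp: awalk_simps)
  have "gst v (e # p) \<approx> gst (head E e) p * gst v [e]"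
    using gst_append[of v "[e]" "head E e" p w] e awalk_single by (auto intro: eqv_sym)
  also have "\<dots> \<approx> gst (head E e) p * Gh e"
    using e gst_single by (intro eqv_mult_left) auto
  finally show ?thesis .
qed

lemma gst_pth_Cons:
  assumes "awalk v (e # p) w" "awalk v (f # q) u"
  shows "gst v (e # p) * pth v (f # q) \<approx> (if e = f then gst (head E e) p * pth (head E e) q else 0)"
proof -
  have e: "e \<in> arcs E" "f \<in> arcs E" "awalk (head E e) p w" "awalk (head E f) q u"
    using assms by (auto simp: awalk_simps)
  have "gst v (e # p) * pth v (f # q) \<approx> (gst (head E e) p * Gh e) * (Ed f * pth (head E f) q)"
    using assms by (intro eqv_mult gst_Cons pth_Cons) auto
  also have "\<dots> = gst (head E e) p * ((Gh e * Ed f) * pth (head E f) q)"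
    by (simp add: mult.assoc)
  also have "\<dots> \<approx> gst (head E e) p * ((if e = f then V (head E e) else 0) * pth (head E f) q)"
    using e by (intro eqv_mult_left eqv_mult_right Gh_Ed) auto
  also have "\<dots> \<approx> (if e = f then gst (head E e) p * pth (head E e) q else 0)"
    using e V_pth[OF e(4), of "head E f"] by (auto intro!: eqv_mult_left)
  finally show ?thesis .
qed

lemma gst_pth_same: "awalk v p w \<Longrightarrow> gst v p * pth v p \<approx> V w"
proof (induction p arbitrary: v)
  case Nil
  then show ?case
    using V_V[of v v] by (auto simp: awalk_simps pth_Nil gst_Nil)
next
  case (Cons e p)
  then show ?case
    using gst_pth_Cons[OF Cons.prems Cons.prems] eqv_trans by (auto simp: awalk_simps)
qed

text \<open>Common first edges are cancelled one at a time. Since neither path is a prefix of the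
  other, two different edges \<open>e\<close> and \<open>f\<close> eventually meet, and
  \<open>Gh e * Ed f\<close> is zero.\<close>

lemma gst_pth_incomparable:
  assumes "awalk v p w" "awalk v q u" "\<And>r. q \<noteq> p @ r" "\<And>r. p \<noteq> q @ r"
  shows "gst v p * pth v q \<in> I"
  using assms
proof (induction p arbitrary: v q)
  case (Cons e p)
  then obtain f q' where q: "q = f # q'"
    by (cases q) auto
  show ?case
  proof (cases "e = f")
    case True
    have "gst (head E e) p * pth (head E e) q' \<in> I"
      using Cons True q by (intro Cons.IH) (auto simp: awalk_simps)
    then show ?thesis
      using gst_pth_Cons[OF Cons.prems(1) Cons.prems(2)[unfolded q]] True q eqv_I by auto
  next
    case False
    then show ?thesis
      using gst_pth_Cons[OF Cons.prems(1) Cons.prems(2)[unfolded q]] q eqv_0_iff by auto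
  qed
qed auto

lemma gst_pth_append:
  assumes "awalk v p w" "awalk w q u"
  shows "gst v p * pth v (p @ q) \<approx> pth w q"
proof -
  have "gst v p * pth v (p @ q) \<approx> gst v p * (pth v p * pth w q)"
    using assms by (intro eqv_mult_left eqv_sym[OF pth_append]) auto
  also have "\<dots> = gst v p * pth v p * pth w q"
    by (simp add: mult.assoc)
  also have "\<dots> \<approx> V w * pth w q"
    using assms by (intro eqv_mult_right gst_pth_same) auto
  also have "\<dots> \<approx> pth w q"
    using V_pth[OF assms(2), of w] assms by auto
  finally show ?thesis .
qed

lemma gst_append_pth:
  assumes "awalk v q w" "awalk w p u"
  shows "gst v (q @ p) * pth v q \<approx> gst w p"
proof -
  have "gst v (q @ p) * pth v q \<approx> gst w p * gst v q * pth v q"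
    using assms by (intro eqv_mult_right eqv_sym[OF gst_append]) auto
  also have "\<dots> = gst w p * (gst v q * pth v q)"
    by (simp add: mult.assoc)
  also have "\<dots> \<approx> gst w p * V w"
    using assms by (intro eqv_mult_left gst_pth_same) auto
  also have "\<dots> \<approx> gst w p"
    using gst_V[OF assms(2), of w] assms by auto
  finally show ?thesis .
qed

lemma gst_pth_other:
  assumes "awalk v p w" "awalk u q x" "u \<noteq> v"
  shows "gst v p * pth u q \<in> I"
proof -
  have "gst v p * pth u q \<approx> gst v p * V v * pth u q"
    using assms gst_V[OF assms(1), of v] by (intro eqv_mult_right) (auto intro: eqv_sym)
  also have "\<dots> = gst v p * (V v * pth u q)"
    by (simp add: mult.assoc)
  also have "\<dots> \<approx> gst v p * 0"
    using assms V_pth[OF assms(2), of v] by (intro eqv_mult_left) auto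
  finally show ?thesis
    by (simp add: eqv_0_iff)
qed

text \<open>Closure under \<open>\<approx>\<close> makes this the span modulo \<open>I\<close>. As
  an inductive predicate it provides the rule \<open>lpa_induct\<close>, which reduces properties
  compatible with sums, scalars and congruence to the monomials.\<close>

inductive mspan :: "(('v, 'e) lpa_gen free_word \<Rightarrow>\<^sub>0 'k) \<Rightarrow> bool" where
  monomial: "awalk v p w \<Longrightarrow> awalk u q w \<Longrightarrow> mspan (pth v p * gst u q)"
| add: "mspan x \<Longrightarrow> mspan y \<Longrightarrow> mspan (x + y)"
| scal: "mspan x \<Longrightarrow> mspan (scal c x)"
| zero: "mspan 0"
| eqv: "mspan x \<Longrightarrow> x \<approx> y \<Longrightarrow> mspan y"

text \<open>A vertex fixes or kills the monomial. A ghost edge either lengthens \<open>q\<close> or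
  gives zero. An edge cancels against the first edge of \<open>q\<close> or gives zero; if
  \<open>q\<close> is trivial, it lengthens \<open>p\<close> instead, provided the vertices
  match.\<close>

lemma mspan_mult_gen:
  assumes "mspan x" "g \<in> lpa_gens E"
  shows "mspan (x * wd [g])"
  using assms(1)
proof induction
  case (monomial v p w u q)
  note walks = monomial
  have gA: "wd [g] \<in> A"
    using assms(2) by (intro wd_A) auto
  have uv: "u \<in> verts E" "w \<in> verts E"
    using walks by auto
  have to_left: "mspan (pth v p * gst u q * wd [g])" if "gst u q * wd [g] \<approx> y" "mspan (pth v p * y)" for y
  proof (rule mspan.eqv[OF that(2)])
    show "pth v p * y \<approx> pth v p * gst u q * wd [g]"
      using that(1) walks(1) unfolding mult.assoc by (intro eqv_mult_left) (auto intro: eqv_sym)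
  qed
  consider x where "g = Vertex x" "x \<in> verts E" | e where "g = Ghost e" "e \<in> arcs E"
    | e where "g = Edge e" "e \<in> arcs E"
    using assms(2) by (auto simp: lpa_gens_def)
  then show ?case
  proof cases
    case 1
    then show ?thesis
      using gst_V[OF walks(2), of x] walks by (intro to_left[of "if x = u then gst u q else 0"])
        (auto intro: mspan.monomial mspan.zero)
  next
    case 2
    have "gst u q * Gh e \<approx> gst u q * V u * Gh e"
      using gst_V[OF walks(2), of u] uv 2 by (intro eqv_mult_right) (auto intro: eqv_sym)
    also have "\<dots> = gst u q * (V u * Gh e)"
      by (simp add: mult.assoc)
    also have "\<dots> \<approx> gst u q * (if u = head E e then Gh e else 0)"
      using V_word[of "[Ghost e]" u] 2 uv walks by (intro eqv_mult_left) (auto simp: lpa_gens_def)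
    also have "\<dots> \<approx> (if u = head E e then gst (tail E e) (e # q) else 0)"
      using eqv_sym[OF gst_Cons[of "tail E e" e q w]] 2 walks by (auto simp: awalk_simps)
    finally show ?thesis
      using 2 walks by (intro to_left[of "if u = head E e then gst (tail E e) (e # q) else 0"])
        (auto intro: mspan.monomial mspan.zero simp: awalk_simps)
  next
    case 3
    show ?thesis
    proof (cases q)
      case Nil
      then have "w = u"
        using walks by (simp add: awalk_simps)
      have "gst u q * Ed e \<approx> (if u = tail E e then Ed e else 0)"
        using V_word[of "[Edge e]" u] 3 uv by (auto simp: lpa_gens_def Nil gst_Nil)
      moreover have "mspan (pth v p * Ed e)" if "u = tail E e"
      proof -
        have walk: "awalk v (p @ [e]) (head E e)"
          using walks 3 that \<open>w = u\<close> by (auto simp: awalk_simps)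
        have "pth v (p @ [e]) * gst (head E e) [] \<approx> pth v (p @ [e])"
          using pth_V[OF walk, of "head E e"] 3 by (simp add: gst_Nil)
        also have "\<dots> \<approx> pth v p * pth (tail E e) [e]"
          using pth_append[of v p u "[e]" "head E e"] walks 3 that \<open>w = u\<close>
          by (auto intro: eqv_sym simp: awalk_simps)
        also have "\<dots> \<approx> pth v p * Ed e"
          using walks 3 pth_single by (intro eqv_mult_left) auto
        finally show ?thesis
          using 3 walk mspan.monomial[OF walk, of "head E e" "[]"] mspan.eqv by (auto simp: awalk_simps)
      qed
      ultimately show ?thesis
        using 3 by (intro to_left[of "if u = tail E e then Ed e else 0"]) (auto intro: mspan.zero)
    next
      case (Cons f q')
      have f: "f \<in> arcs E" "awalk (head E f) q' w"
        using walks Cons by (auto simp: awalk_simps)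
      have "gst u q * Ed e \<approx> gst (head E f) q' * Gh f * Ed e"
        using walks 3 unfolding Cons by (intro eqv_mult_right gst_Cons) auto
      also have "\<dots> = gst (head E f) q' * (Gh f * Ed e)"
        by (simp add: mult.assoc)
      also have "\<dots> \<approx> gst (head E f) q' * (if f = e then V (head E f) else 0)"
        using f 3 by (intro eqv_mult_left Gh_Ed) auto
      also have "\<dots> \<approx> (if f = e then gst (head E f) q' else 0)"
        using f gst_V[OF f(2), of "head E f"] by auto
      finally show ?thesis
        using 3 walks f by (intro to_left[of "if f = e then gst (head E f) q' else 0"])
          (auto intro: mspan.monomial mspan.zero)
    qed
  qed
next
  case (eqv x y)
  then have "x * wd [g] \<approx> y * wd [g]"
    using assms(2) by (intro eqv_mult_right wd_A) auto
  with eqv.IH show ?case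
    by (rule mspan.eqv)
qed (auto simp: distrib_right scal_mult_left intro: mspan.add mspan.scal mspan.zero)

lemma mspan_word: "xs \<noteq> [] \<Longrightarrow> set xs \<subseteq> lpa_gens E \<Longrightarrow> mspan (wd xs)"
proof (induction xs rule: rev_induct)
  case (snoc g xs)
  have "mspan (V (left_vertex g))"
  proof (rule mspan.eqv)
    have v: "left_vertex g \<in> verts E"
      using snoc.prems gen_vertex_verts by auto
    then show "mspan (pth (left_vertex g) [] * gst (left_vertex g) [])"
      by (intro mspan.monomial) (auto simp: awalk_simps)
    show "pth (left_vertex g) [] * gst (left_vertex g) [] \<approx> V (left_vertex g)"
      using V_V[OF v v] by (simp add: pth_Nil gst_Nil)
  qed
  then have "mspan (V (left_vertex g) * wd [g])"
    using snoc.prems by (intro mspan_mult_gen) auto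
  then have "mspan (wd [g])"
    by (rule mspan.eqv) (use V_gen snoc.prems in auto)
  then show ?case
    using snoc mspan_mult_gen[of "wd xs" g] by (cases "xs = []") (auto simp: lpa_word_mult)
qed auto

lemma A_imp_mspan: "x \<in> A \<Longrightarrow> mspan x"
proof -
  assume x: "x \<in> A"
  have "mspan (sum f T)" if "\<And>i. i \<in> T \<Longrightarrow> mspan (f i)" for f and T :: "('v, 'e) lpa_gen free_word set"
    using that by (induction T rule: infinite_finite_induct) (simp_all add: mspan.zero mspan.add)
  moreover have "mspan (scal (Poly_Mapping.lookup x w) (wd (letters w)))" if "w \<in> Poly_Mapping.keys x" for w
    using mspan.scal[OF mspan_word[of "letters w"]] that x unfolding A_def by (auto simp: lpa_words_def)
  ultimately have "mspan (\<Sum>w\<in>Poly_Mapping.keys x. scal (Poly_Mapping.lookup x w) (wd (letters w)))"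
    by simp
  then show ?thesis
    by (subst poly_mapping_eq_sum_single) (simp add: scal_single)
qed

lemmas lpa_induct [consumes 1, case_names monomial add scal zero eqv] = mspan.induct[OF A_imp_mspan]


subsection \<open>A representation in which vertices are nonzero\<close>

text \<open>Boundary paths from \<open>v\<close>: infinite paths, and finite paths ending in a vertex that is not
  regular, whose end is marked by \<open>None\<close>. What follows the first \<open>None\<close> is irrelevant.\<close>

coinductive boundary_path :: "'v \<Rightarrow> (nat \<Rightarrow> 'e option) \<Rightarrow> bool" where
  stop: "v \<in> verts E \<Longrightarrow> \<not> regular_vertex E v \<Longrightarrow> f 0 = None \<Longrightarrow> boundary_path v f"
| step: "e \<in> arcs E \<Longrightarrow> boundary_path (head E e) f \<Longrightarrow> boundary_path (tail E e) (case_nat (Some e) f)"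

text \<open>A fixed outgoing edge is followed at every regular vertex. The recursion for
  \<open>pos\<close> runs on past a vertex that is not regular, but what it produces there does not
  matter, because \<open>boundary_path\<close> looks only at the entry 0 when it stops.\<close>

lemma ex_boundary_path:
  assumes "v \<in> verts E"
  shows "\<exists>f. boundary_path v f"
proof -
  define nxt where "nxt u = (SOME e. e \<in> out_arcs E u)" for u
  have nxt: "nxt u \<in> arcs E" "tail E (nxt u) = u" if "regular_vertex E u" for u
  proof -
    have "\<exists>e. e \<in> out_arcs E u"
      using that by (auto simp: regular_vertex_def sink_def)
    from someI_ex[OF this] show "nxt u \<in> arcs E" "tail E (nxt u) = u"
      by (auto simp: nxt_def)
  qed
  define pos where "pos u n = ((\<lambda>w. head E (nxt w)) ^^ n) u" for u n
  define p where "p u n = (if regular_vertex E (pos u n) then Some (nxt (pos u n)) else None)" for u n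
  have p0: "p u 0 = (if regular_vertex E u then Some (nxt u) else None)" for u
    by (simp add: p_def pos_def)
  have pSuc: "p u (Suc n) = p (head E (nxt u)) n" for u n
    by (simp add: p_def pos_def funpow_Suc_right del: funpow.simps)
  have "boundary_path v (p v)"
    using assms
  proof (coinduction arbitrary: v)
    case boundary_path
    show ?case
    proof (cases "regular_vertex E v")
      case True
      have "p v = case_nat (Some (nxt v)) (p (head E (nxt v)))"
        using True p0 pSuc by (auto simp: fun_eq_iff split: nat.split)
      then show ?thesis
        using nxt[OF True]
        by (intro disjI2 exI[of _ "nxt v"] exI[of _ "p (head E (nxt v))"]) auto
    next
      case False
      then show ?thesis
        using boundary_path p0 by auto
    qed
  qed
  then show ?thesis
    by blast
qed

text \<open>The Leavitt path algebra acts on the functions on pairs of a vertex and a path; only the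
  values at boundary paths matter.\<close>

primrec act :: "('v, 'e) lpa_gen \<Rightarrow> ('v \<times> (nat \<Rightarrow> 'e option) \<Rightarrow> 'k) \<Rightarrow> 'v \<times> (nat \<Rightarrow> 'e option) \<Rightarrow> 'k" where
  "act (Vertex v) \<phi> = (\<lambda>(u, f). if u = v \<and> boundary_path v f then \<phi> (u, f) else 0)"
| "act (Edge e) \<phi> = (\<lambda>(u, f). if u = tail E e \<and> f 0 = Some e \<and> boundary_path (head E e) (f \<circ> Suc)
     then \<phi> (head E e, f \<circ> Suc) else 0)"
| "act (Ghost e) \<phi> = (\<lambda>(u, f). if u = head E e \<and> boundary_path (head E e) f
     then \<phi> (tail E e, case_nat (Some e) f) else 0)"

definition wact :: "('v, 'e) lpa_gen list \<Rightarrow> ('v \<times> (nat \<Rightarrow> 'e option) \<Rightarrow> 'k) \<Rightarrow> 'v \<times> (nat \<Rightarrow> 'e option) \<Rightarrow> 'k" where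
  "wact ws \<phi> = foldr act ws \<phi>"

lemma act_sum: "act g (\<lambda>x. \<Sum>j\<in>T. c j * \<psi> j x) = (\<lambda>x. \<Sum>j\<in>T. c j * act g (\<psi> j) x)"
  by (cases g) (auto simp: fun_eq_iff)

lemma wact_sum: "wact ws (\<lambda>x. \<Sum>j\<in>T. c j * \<psi> j x) = (\<lambda>x. \<Sum>j\<in>T. c j * wact ws (\<psi> j) x)"
  by (induction ws) (simp_all add: wact_def act_sum)

definition pact :: "(('v, 'e) lpa_gen free_word \<Rightarrow>\<^sub>0 'k) \<Rightarrow> ('v \<times> (nat \<Rightarrow> 'e option) \<Rightarrow> 'k) \<Rightarrow>
    'v \<times> (nat \<Rightarrow> 'e option) \<Rightarrow> 'k" where
  "pact p \<phi> x = (\<Sum>w\<in>Poly_Mapping.keys p. Poly_Mapping.lookup p w * wact (letters w) \<phi> x)"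

lemma pact_superset:
  "finite T \<Longrightarrow> Poly_Mapping.keys p \<subseteq> T \<Longrightarrow>
    pact p \<phi> x = (\<Sum>w\<in>T. Poly_Mapping.lookup p w * wact (letters w) \<phi> x)"
  unfolding pact_def by (rule sum.mono_neutral_left) (auto simp: in_keys_iff)

lemma pact_add: "pact (p + q) \<phi> x = pact p \<phi> x + pact q \<phi> x"
  using keys_add[of p q]
  by (simp add: pact_superset[of "Poly_Mapping.keys p \<union> Poly_Mapping.keys q"] lookup_add
      distrib_right sum.distrib)

lemma pact_scal: "pact (scal c p) \<phi> x = c * pact p \<phi> x"
  using keys_scal[of c p]
  by (simp add: pact_superset[of "Poly_Mapping.keys p"] lookup_scal sum_distrib_left mult.assoc)

lemma pact_diff: "pact (p - q) \<phi> x = pact p \<phi> x - pact q \<phi> x"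
  using pact_add[of p "- q" \<phi> x] pact_scal[of "-1" q \<phi> x] by (simp add: scal_uminus_one)

lemma pact_zero: "pact 0 \<phi> x = 0"
  by (simp add: pact_def)

lemma pact_sum: "pact (\<Sum>i\<in>T. f i) \<phi> x = (\<Sum>i\<in>T. pact (f i) \<phi> x)"
  by (induction T rule: infinite_finite_induct) (auto simp: pact_add pact_zero)

lemma pact_wd: "pact (wd xs) \<phi> x = wact xs \<phi> x"
  by (simp add: pact_def)

lemma pact_single: "pact (Poly_Mapping.single w c) \<phi> x = c * wact (letters w) \<phi> x"
  using pact_scal[of c "Poly_Mapping.single w 1" \<phi> x] by (simp add: scal_single pact_def)

lemma pact_mult: "pact (p * q) \<phi> x = pact p (pact q \<phi>) x"
proof -
  have "p * q = (\<Sum>u\<in>Poly_Mapping.keys p. Poly_Mapping.single u (Poly_Mapping.lookup p u)) *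
      (\<Sum>v\<in>Poly_Mapping.keys q. Poly_Mapping.single v (Poly_Mapping.lookup q v))"
    by (simp flip: poly_mapping_eq_sum_single)
  also have "\<dots> = (\<Sum>u\<in>Poly_Mapping.keys p. \<Sum>v\<in>Poly_Mapping.keys q.
      Poly_Mapping.single (u + v) (Poly_Mapping.lookup p u * Poly_Mapping.lookup q v))"
    by (simp add: sum_product mult_single)
  finally have "pact (p * q) \<phi> x = (\<Sum>u\<in>Poly_Mapping.keys p. \<Sum>v\<in>Poly_Mapping.keys q.
      Poly_Mapping.lookup p u * Poly_Mapping.lookup q v * wact (letters (u + v)) \<phi> x)"
    by (simp add: pact_sum pact_single)
  also have "\<dots> = (\<Sum>u\<in>Poly_Mapping.keys p. Poly_Mapping.lookup p u *
      wact (letters u) (\<lambda>x. \<Sum>v\<in>Poly_Mapping.keys q. Poly_Mapping.lookup q v * wact (letters v) \<phi> x) x)"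
    by (simp only: wact_sum) (simp add: wact_def plus_free_word_def sum_distrib_left mult.assoc)
  also have "\<dots> = pact p (pact q \<phi>) x"
    by (simp add: pact_def[of p] pact_def[of q, abs_def])
  finally show ?thesis .
qed

text \<open>A boundary path at a regular vertex cannot stop there, so it has exactly one first edge,
  and only the summand of that edge contributes. This is the reason for allowing finite boundary
  paths to end only at vertices that are not regular.\<close>

lemma pact_V_sum:
  assumes "regular_vertex E v"
  shows "wact [Vertex v] \<phi> (u, f) = (\<Sum>e\<in>out_arcs E v. wact [Edge e, Ghost e] \<phi> (u, f))"
proof (cases "u = v \<and> boundary_path v f")
  case True
  then have uv: "u = v" and bp: "boundary_path v f"
    by auto
  from bp obtain e g where e: "e \<in> arcs E" "tail E e = v" "f = case_nat (Some e) g" "boundary_path (head E e) g"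
    using assms by cases auto
  have comp: "f \<circ> Suc = g"
    using e by (auto simp: fun_eq_iff)
  have fin: "finite (out_arcs E v)"
    using assms by (auto simp: regular_vertex_def infinite_emitter_def)
  have "(\<Sum>e'\<in>out_arcs E v. wact [Edge e', Ghost e'] \<phi> (u, f)) =
      (\<Sum>e'\<in>out_arcs E v. if e' = e then \<phi> (v, f) else 0)"
    by (intro sum.cong refl) (use uv e comp in \<open>auto simp: wact_def\<close>)
  also have "\<dots> = \<phi> (v, f)"
    using e fin by simp
  finally show ?thesis
    using uv bp by (simp add: wact_def)
next
  case False
  have "wact [Edge e, Ghost e] \<phi> (u, f) = 0" if "e \<in> out_arcs E v" for e
  proof (rule ccontr)
    assume "wact [Edge e, Ghost e] \<phi> (u, f) \<noteq> 0"
    then have "u = tail E e" "f 0 = Some e" "boundary_path (head E e) (f \<circ> Suc)"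
      by (auto simp: wact_def split: if_splits)
    moreover from this have "f = case_nat (Some e) (f \<circ> Suc)"
      by (auto simp: fun_eq_iff split: nat.split)
    ultimately show False
      using False that boundary_path.step[of e "f \<circ> Suc"] by auto
  qed
  then show ?thesis
    using False by (auto simp: wact_def)
qed

text \<open>The elements of \<open>A\<close> acting as zero form an ideal, and the relators are
  among them; so the action factors through the quotient.\<close>

lemma pact_I:
  assumes "p \<in> I"
  shows "pact p \<phi> x = 0"
proof -
  define J where "J = {p \<in> A. \<forall>\<phi> x. pact p \<phi> x = 0}"
  have "alg_ideal S J"
    unfolding alg_ideal_def alg_subspace_def S_simps
  proof (intro conjI ballI allI)
    fix a p assume "a \<in> A" "p \<in> J"
    then have "pact p \<phi> = (\<lambda>x. 0)" for \<phi>
      by (auto simp: J_def)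
    moreover have "pact a (\<lambda>x. 0) y = 0" for y
      using wact_sum[of _ _ _ "{}"] by (simp add: pact_def)
    ultimately show "a * p \<in> J" "p * a \<in> J"
      using \<open>a \<in> A\<close> \<open>p \<in> J\<close> by (auto simp: J_def pact_mult)
  qed (auto simp: J_def pact_zero pact_add pact_scal)
  moreover have "lpa_relators E \<subseteq> J"
  proof
    fix r :: "('v, 'e) lpa_gen free_word \<Rightarrow>\<^sub>0 'k" assume r: "r \<in> lpa_relators E"
    have bp: "boundary_path (tail E e) f"
      if "e \<in> arcs E" "f 0 = Some e" "boundary_path (head E e) (f \<circ> Suc)" for e f
    proof -
      have "f = case_nat (Some e) (f \<circ> Suc)"
        using that(2) by (auto simp: fun_eq_iff split: nat.split)
      then show ?thesis
        using boundary_path.step[OF that(1,3)] by simp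
    qed
    have bp': "boundary_path (tail E e) (case_nat (Some e) f)" if "e \<in> arcs E" "boundary_path (head E e) f" for e f
      using boundary_path.step[OF that] .
    have comp: "case_nat (Some e) f \<circ> Suc = f" for e :: 'e and f
      by (auto simp: fun_eq_iff)
    have "pact r \<phi> (u, f) = 0" for \<phi> u f
      using r unfolding lpa_relators_def
    proof (elim UnE)
      assume "r \<in> {lpa_word [Vertex v] - (\<Sum>e\<in>out_arcs E v. lpa_word [Edge e, Ghost e]) | v. regular_vertex E v}"
      then show ?thesis
        using pact_V_sum by (auto simp: pact_diff pact_sum pact_wd)
    qed (auto simp: pact_diff pact_zero pact_wd wact_def bp bp' comp)
    then show "r \<in> J"
      using r relators_subset_I I_A by (auto simp: J_def)
  qed
  ultimately have "I \<subseteq> J"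
    unfolding lpa_ideal_def alg_ideal_generated_def free_algebra_eq by blast
  then show ?thesis
    using assms unfolding J_def by blast
qed

lemma V_notin_I:
  assumes "v \<in> verts E"
  shows "V v \<notin> I"
proof
  assume "V v \<in> I"
  obtain f where "boundary_path v f"
    using ex_boundary_path[OF assms] by blast
  then have "pact (V v) (\<lambda>_. 1) (v, f) = 1"
    by (simp add: pact_wd wact_def)
  with pact_I[OF \<open>V v \<in> I\<close>] show False
    by simp
qed


subsection \<open>Compression by long paths\<close>

text \<open>\<open>W n\<close> stands for the scalar multiples of a vertex in one application and
  for the Laurent polynomials in another. The index from which a monomial behaves well depends on
  the monomial, hence the formulation with \<open>eventually\<close>, which survives finite sums.
  Monomials that do not both begin and end at \<open>v\<close> are killed by the
  compression.\<close>

lemma eventually_compress: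
  fixes m :: "nat \<Rightarrow> 'e list" and u :: "nat \<Rightarrow> 'v"
  assumes walk: "\<And>n. awalk v (m n) (u n)"
    and W_add: "\<And>n x y. x \<in> W n \<Longrightarrow> y \<in> W n \<Longrightarrow> x + y \<in> W n"
    and W_scal: "\<And>n c x. x \<in> W n \<Longrightarrow> scal c x \<in> W n"
    and W_eqv: "\<And>n x y. x \<in> W n \<Longrightarrow> x \<approx> y \<Longrightarrow> y \<in> W n"
    and W_0: "\<And>n. 0 \<in> W n"
    and monomial: "\<And>p q w. awalk v p w \<Longrightarrow> awalk v q w \<Longrightarrow>
      eventually (\<lambda>n. (gst v (m n) * pth v p) * (gst v q * pth v (m n)) \<in> W n) sequentially"
    and "z \<in> A"
  shows "eventually (\<lambda>n. gst v (m n) * z * pth v (m n) \<in> W n) sequentially"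
  using \<open>z \<in> A\<close>
proof (induction rule: lpa_induct)
  case (monomial a p w b q)
  have W_I: "x \<in> W n" if "x \<in> I" for x n
    using W_eqv[OF W_0 eqv_sym] that eqv_0_iff by blast
  note A = gst_A[OF walk] pth_A[OF walk] pth_A[OF monomial(1)] gst_A[OF monomial(2)]
  show ?case
  proof (cases "a = v \<and> b = v")
    case True
    then show ?thesis
      using assms(6)[of p w q] monomial by (simp add: mult.assoc)
  next
    case False
    have "gst v (m n) * (pth a p * gst b q) * pth v (m n) \<in> W n" for n
    proof (cases "a = v")
      case True
      then have "gst b q * pth v (m n) \<in> I"
        using False gst_pth_other[OF monomial(2) walk] by auto
      then have "gst v (m n) * (pth a p * (gst b q * pth v (m n))) \<in> I"
        using A by (intro I_mult_left[OF _ I_mult_left]) auto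
      then show ?thesis
        by (intro W_I) (simp add: mult.assoc)
    next
      case False
      then have "gst v (m n) * pth a p \<in> I"
        using gst_pth_other[OF walk monomial(1)] by auto
      then have "gst v (m n) * pth a p * gst b q * pth v (m n) \<in> I"
        using A by (intro I_mult_right[OF _ I_mult_right]) auto
      then show ?thesis
        by (intro W_I) (simp add: mult.assoc)
    qed
    then show ?thesis
      by simp
  qed
next
  case (add x y)
  from add.IH show ?case
    by eventually_elim (auto simp: distrib_left distrib_right intro: W_add)
next
  case (scal x c)
  from scal.IH show ?case
    by eventually_elim (auto simp: scal_mult_left scal_mult_right intro: W_scal)
next
  case zero
  then show ?case
    using W_0 by simp
next
  case (eqv x y)
  have *: "gst v (m n) * x * pth v (m n) \<approx> gst v (m n) * y * pth v (m n)" for n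
    using eqv(2) gst_A[OF walk] pth_A[OF walk] by (intro eqv_mult_left eqv_mult_right)
  from eqv.IH show ?case
    by eventually_elim (rule W_eqv[OF _ *])
qed

section \<open>Centroid elements at vertices\<close>

lemma cent_vertex:
  assumes "cent t" "awalk v p u"
  shows "gst v p * t (V v) * pth v p \<approx> t (V u)"
proof -
  note t = centD[OF assms(1)]
  have v: "v \<in> verts E" "u \<in> verts E"
    using assms by auto
  note A = gst_A[OF assms(2)] pth_A[OF assms(2)]
  have "V v * pth v p \<approx> pth v p"
    using V_pth[OF assms(2), of v] v by simp
  have "t (V u) \<approx> t (gst v p * (V v * pth v p))"
  proof (intro t(2))
    have "gst v p * (V v * pth v p) \<approx> gst v p * pth v p"
      using A \<open>V v * pth v p \<approx> pth v p\<close> by (intro eqv_mult_left)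
    also have "\<dots> \<approx> V u"
      by (rule gst_pth_same[OF assms(2)])
    finally show "V u \<approx> gst v p * (V v * pth v p)"
      by (rule eqv_sym)
  qed (use A v in auto)
  also have "\<dots> \<approx> gst v p * t (V v * pth v p)"
    using A v by (intro t(6)) auto
  also have "\<dots> \<approx> gst v p * (t (V v) * pth v p)"
    using A v by (intro eqv_mult_left t(5)) auto
  finally show ?thesis
    by (simp add: mult.assoc eqv_sym)
qed

lemma all_scalarI:
  assumes "prime_elementwise" and "\<And>t. cent t \<Longrightarrow> \<exists>k. \<exists>u\<in>verts E. t (V u) \<approx> scal k (V u)"
  shows "all_scalar"
  unfolding all_scalar_def
proof (intro allI impI)
  fix t assume t: "cent t"
  then obtain k u where "u \<in> verts E" "t (V u) \<approx> scal k (V u)"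
    using assms(2) by blast
  then show "\<exists>c. \<forall>x\<in>A. t x \<approx> scal c x"
    using cent_eqvI[OF assms(1) t cent_scal[of k], of "V u"] V_notin_I by auto
qed

text \<open>The range \<open>u n\<close> may change with \<open>n\<close>, but one sufficiently
  large \<open>n\<close> is enough: then the centroid element is scalar at \<open>V (u n)\<close>,
  and primeness spreads the scalar to the whole algebra.\<close>

lemma all_scalar_if_compress:
  fixes m :: "nat \<Rightarrow> 'e list" and u :: "nat \<Rightarrow> 'v"
  assumes "prime_elementwise" and walk: "\<And>n. awalk v (m n) (u n)"
    and monomial: "\<And>p q w. awalk v p w \<Longrightarrow> awalk v q w \<Longrightarrow>
      eventually (\<lambda>n. \<exists>k. (gst v (m n) * pth v p) * (gst v q * pth v (m n)) \<approx> scal k (V (u n))) sequentially"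
  shows "all_scalar"
proof (rule all_scalarI[OF assms(1)])
  fix t assume t: "cent t"
  define W where "W n = {x. \<exists>k. x \<approx> scal k (V (u n))}" for n
  have "V v \<in> A"
    using walk by blast
  have "eventually (\<lambda>n. gst v (m n) * t (V v) * pth v (m n) \<in> W n) sequentially"
  proof (rule eventually_compress[OF walk])
    show "x + y \<in> W n" if "x \<in> W n" "y \<in> W n" for n x y
    proof -
      obtain k l where "x \<approx> scal k (V (u n))" "y \<approx> scal l (V (u n))"
        using \<open>x \<in> W n\<close> \<open>y \<in> W n\<close> by (auto simp: W_def)
      then have "x + y \<approx> scal (k + l) (V (u n))"
        unfolding scal_add_left by (rule eqv_add)
      then show ?thesis
        by (auto simp: W_def)
    qed
    show "scal c x \<in> W n" if "x \<in> W n" for n c x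
    proof -
      obtain k where "x \<approx> scal k (V (u n))"
        using \<open>x \<in> W n\<close> by (auto simp: W_def)
      then have "scal c x \<approx> scal (c * k) (V (u n))"
        unfolding scal_scal[symmetric] by (rule eqv_scal)
      then show ?thesis
        by (auto simp: W_def)
    qed
    show "y \<in> W n" if "x \<in> W n" "x \<approx> y" for n x y
      using that eqv_sym eqv_trans unfolding W_def by blast
    show "0 \<in> W n" for n
      unfolding W_def by (auto intro!: exI[of _ 0])
  qed (use monomial centD(1)[OF t \<open>V v \<in> A\<close>] in \<open>auto simp: W_def\<close>)
  then obtain n where "gst v (m n) * t (V v) * pth v (m n) \<in> W n"
    by (auto simp: eventually_sequentially)
  then obtain k where "gst v (m n) * t (V v) * pth v (m n) \<approx> scal k (V (u n))"
    by (auto simp: W_def)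
  then have "t (V (u n)) \<approx> scal k (V (u n))"
    using cent_vertex[OF t walk] eqv_sym eqv_trans by blast
  moreover have "u n \<in> verts E"
    using walk by blast
  ultimately show "\<exists>k. \<exists>u\<in>verts E. t (V u) \<approx> scal k (V u)"
    by blast
qed

text \<open>Here the compressing paths have length 1: \<open>f\<close> enumerates infinitely many
  distinct edges leaving \<open>v\<close>. Any given edge equals at most one \<open>f n\<close>, so
  each monomial other than the vertex itself is eventually killed.\<close>

lemma infinite_emitter_all_scalar:
  assumes "prime_elementwise" "infinite_emitter E v"
  shows "all_scalar"
proof -
  obtain f :: "nat \<Rightarrow> 'e" where f: "inj f" "range f \<subseteq> out_arcs E v"
    using assms(2) infinite_countable_subset[of "out_arcs E v"] unfolding infinite_emitter_def by blast
  have fn: "f n \<in> arcs E" "tail E (f n) = v" for n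
  proof -
    have "f n \<in> out_arcs E v"
      using f(2) by blast
    then show "f n \<in> arcs E" "tail E (f n) = v"
      by auto
  qed
  have v: "v \<in> verts E"
    using assms(2) by (simp add: infinite_emitter_def)
  have walk: "awalk v [f n] (head E (f n))" for n
    using awalk_single[of "f n"] fn by simp
  have f_laurent_eval: "eventually (\<lambda>n. f n \<noteq> e) sequentially" for e
  proof (cases "e \<in> range f")
    case True
    then obtain m where "e = f m"
      by blast
    then have "f n \<noteq> e" if "n \<ge> Suc m" for n
      using that f(1) by (auto dest: injD)
    then show ?thesis
      by (auto simp: eventually_sequentially)
  qed (auto intro!: always_eventually)
  show ?thesis
  proof (rule all_scalar_if_compress[OF assms(1) walk])
    fix p q w assume walks: "awalk v p w" "awalk v q w"
    note A = gst_A[OF walk] pth_A[OF walk] pth_A[OF walks(1)] gst_A[OF walks(2)]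
    consider "p = []" "q = []" | e p' where "p = e # p'" | e q' where "q = e # q'"
      by (meson neq_Nil_conv)
    then show "eventually (\<lambda>n. \<exists>k. (gst v [f n] * pth v p) * (gst v q * pth v [f n]) \<approx> scal k (V (head E (f n)))) sequentially"
    proof cases
      case 1
      have "(gst v [f n] * pth v p) * (gst v q * pth v [f n]) \<approx> scal 1 (V (head E (f n)))" for n
      proof -
        have "(gst v [f n] * pth v p) * (gst v q * pth v [f n]) \<approx> gst v [f n] * pth v [f n]"
          using gst_V[OF walk[of n], of v] V_pth[OF walk[of n], of v] v 1 A
          by (intro eqv_mult) (auto simp: pth_Nil gst_Nil)
        also have "\<dots> \<approx> V (head E (f n))"
          by (rule gst_pth_same[OF walk])
        finally show ?thesis
          by simp
      qed
      then show ?thesis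
        by (intro always_eventually allI exI)
    next
      case 2
      show ?thesis
        using f_laurent_eval[of e]
      proof eventually_elim
        case (elim n)
        then have "gst v [f n] * pth v p \<in> I"
          using gst_pth_Cons[OF walk[of n] walks(1)[unfolded 2]] 2 by (simp add: eqv_0_iff)
        then have "(gst v [f n] * pth v p) * (gst v q * pth v [f n]) \<in> I"
          by (rule I_mult_right[rotated]) (use A in auto)
        then show ?case
          by (intro exI[of _ 0]) (simp add: eqv_0_iff)
      qed
    next
      case 3
      show ?thesis
        using f_laurent_eval[of e]
      proof eventually_elim
        case (elim n)
        then have "gst v q * pth v [f n] \<in> I"
          using gst_pth_Cons[OF walks(2)[unfolded 3] walk[of n]] 3 by (simp add: eqv_0_iff)
        then have "(gst v [f n] * pth v p) * (gst v q * pth v [f n]) \<in> I"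
          by (rule I_mult_left[rotated]) (use A in auto)
        then show ?case
          by (intro exI[of _ 0]) (simp add: eqv_0_iff)
      qed
    qed
  qed
qed

lemma awalk_verts_nth_append: "awalk v (p @ r) x \<Longrightarrow> awalk v p w \<Longrightarrow> awalk_verts v (p @ r) ! length p = w"
proof (induction p arbitrary: v)
  case Nil
  then show ?case
    by (cases r) (auto simp: awalk_simps)
next
  case (Cons e p)
  then have "awalk_verts (head E e) (p @ r) ! length p = w"
    by (auto simp: awalk_Cons_iff simp del: awalk_append_iff)
  then show ?case
    by simp
qed

text \<open>In the uses below, the middle case is excluded by the length of \<open>m\<close> or
  because \<open>m\<close> ends in a sink. A factor of a monomial then either cancels to a remaining
  piece of \<open>m\<close> or vanishes.\<close>

lemma gst_pth_prefix_cases: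
  assumes "awalk v m u" "awalk v p w"
  obtains r where "m = p @ r" "awalk w r u" "gst v m * pth v p \<approx> gst w r" "gst v p * pth v m \<approx> pth w r"
  | r where "p = m @ r" "r \<noteq> []" "awalk u r w"
  | "gst v m * pth v p \<in> I" "gst v p * pth v m \<in> I"
proof -
  consider r where "m = p @ r" | r where "p = m @ r" "r \<noteq> []" | "\<And>r. m \<noteq> p @ r" "\<And>r. p \<noteq> m @ r"
    by (metis append.right_neutral)
  then show ?thesis
  proof cases
    case (1 r)
    then have "awalk w r u"
      using assms by (metis awalk_append_iff awalk_ends_eqD awlast_append assms awalk_ends)
    then show ?thesis
      using that(1)[OF 1] gst_append_pth[OF assms(2)] gst_pth_append[OF assms(2)] 1 by blast
  next
    case (2 r)
    then have "awalk u r w"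
      using assms by (metis awalk_append_iff awalk_ends)
    then show ?thesis
      using that(2) 2 by blast
  next
    case 3
    then show ?thesis
      using that(3) gst_pth_incomparable[OF assms] gst_pth_incomparable[OF assms(2,1)] by blast
  qed
qed

text \<open>A monomial \<open>p q\<^sup>*\<close> survives compression by \<open>m\<close> only if \<open>m = p r = q s\<close>, where \<open>r\<close> and \<open>s\<close> start at
  the same vertex; as \<open>m\<close> has no repeated vertex, \<open>p = q\<close>.\<close>

lemma all_scalar_if_simple_paths:
  assumes "prime_elementwise"
    and ex: "\<And>n. \<exists>m u. awalk v m u \<and> distinct (awalk_verts v m) \<and> (n \<le> length m \<or> sink E u)"
  shows "all_scalar"
proof -
  obtain m u where m: "\<And>n. awalk v (m n) (u n)" "\<And>n. distinct (awalk_verts v (m n))"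
    "\<And>n. n \<le> length (m n) \<or> sink E (u n)"
    using ex by metis
  show ?thesis
  proof (rule all_scalar_if_compress[OF assms(1) m(1)])
    fix p q w assume walks: "awalk v p w" "awalk v q w"
    \<comment> \<open>Either \<open>m n\<close> already has length at least \<open>n\<close>, which
      leaves no room for \<open>r\<close>, or \<open>u n\<close> is a sink, where no edge can
      start.\<close>
    have no_ext: "r = []" if "awalk (u n) r x" "length (m n @ r) \<le> n" for n r x
      using that m(3)[of n] by (cases r) (auto simp: awalk_simps sink_def)
    have "\<exists>k. (gst v (m n) * pth v p) * (gst v q * pth v (m n)) \<approx> scal k (V (u n))"
      if n: "n \<ge> length p" "n \<ge> length q" for n
    proof -
      note walk = m(1)[of n]
      note A = gst_A[OF walk] pth_A[OF walk] pth_A[OF walks(1)] gst_A[OF walks(2)]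
      have zero: ?thesis if "gst v (m n) * pth v p \<in> I \<or> gst v q * pth v (m n) \<in> I"
      proof -
        have "(gst v (m n) * pth v p) * (gst v q * pth v (m n)) \<in> I"
          using that A by blast
        then show ?thesis
          by (intro exI[of _ 0]) (simp add: eqv_0_iff)
      qed
      show ?thesis
      proof (cases rule: gst_pth_prefix_cases[OF walk walks(1)])
        case p: (1 r)
        show ?thesis
        proof (cases rule: gst_pth_prefix_cases[OF walk walks(2)])
          case q: (1 s)
          have "awalk_verts v (m n) ! length p = w" "awalk_verts v (m n) ! length q = w"
            using awalk_verts_nth_append walk walks p(1) q(1) by metis+
          moreover have "length p < length (awalk_verts v (m n))" "length q < length (awalk_verts v (m n))"
            using arg_cong[OF p(1), of length] arg_cong[OF q(1), of length]
            by (simp_all add: length_awalk_verts)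
          ultimately have "length p = length q"
            using m(2)[of n] by (simp add: distinct_conv_nth) metis
          then have "r = s"
            using p(1) q(1) by (metis append_eq_append_conv)
          have "(gst v (m n) * pth v p) * (gst v q * pth v (m n)) \<approx> gst w r * pth w r"
            using p(3) q(4) A \<open>r = s\<close> by (intro eqv_mult) auto
          also have "\<dots> \<approx> V (u n)"
            by (rule gst_pth_same[OF p(2)])
          finally show ?thesis
            by (intro exI[of _ 1]) simp
        next
          case (2 r)
          then show ?thesis
            using no_ext n by blast
        next
          case 3
          then show ?thesis
            using zero by blast
        qed
      next
        case (2 r)
        then show ?thesis
          using no_ext n by blast
      next
        case 3
        then show ?thesis
          using zero by blast
      qed
    qed
    then show "eventually (\<lambda>n. \<exists>k. (gst v (m n) * pth v p) * (gst v q * pth v (m n)) \<approx> scal k (V (u n))) sequentially"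
      unfolding eventually_sequentially by (intro exI[of _ "max (length p) (length q)"]) auto
  qed
qed

end

section \<open>Cycles and Laurent polynomials\<close>

definition cpow :: "'e list \<Rightarrow> nat \<Rightarrow> 'e list" where
  "cpow c n = concat (replicate n c)"

lemma cpow_simps [simp]: "cpow c 0 = []" "cpow c (Suc n) = c @ cpow c n"
  by (simp_all add: cpow_def)

lemma cpow_add: "cpow c (m + n) = cpow c m @ cpow c n"
  by (simp add: cpow_def replicate_add)

lemma length_cpow: "length (cpow c n) = n * length c"
  by (induction n) auto

text \<open>Requiring \<open>c2 \<noteq> []\<close> places the cut strictly before the end of a copy
  of \<open>c\<close>, so that \<open>length c1\<close> is an index of \<open>c\<close> and the edge
  following \<open>p\<close> is \<open>c ! length c1\<close>.\<close>

lemma prefix_cpow: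
  assumes "p @ m = cpow c n" "length p < n * length c"
  shows "\<exists>a c1 c2. a < n \<and> c = c1 @ c2 \<and> c2 \<noteq> [] \<and> p = cpow c a @ c1 \<and> m = c2 @ cpow c (n - a - 1)"
  using assms
proof (induction n arbitrary: p)
  case (Suc n)
  have long: ?case if us: "p = c @ us" "us @ m = cpow c n" for us
  proof -
    have "length us < n * length c"
      using Suc.prems(2) us(1) by simp
    then obtain a c1 c2 where "a < n" "c = c1 @ c2" "c2 \<noteq> []" "us = cpow c a @ c1" "m = c2 @ cpow c (n - a - 1)"
      using Suc.IH[OF us(2)] by blast
    then show ?thesis
      using us(1) by (intro exI[of _ "Suc a"] exI[of _ c1] exI[of _ c2]) auto
  qed
  obtain us where "p = c @ us \<and> us @ m = cpow c n \<or> p @ us = c \<and> m = us @ cpow c n"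
    using Suc.prems(1) by (auto simp: append_eq_append_conv2)
  then consider "p = c @ us" "us @ m = cpow c n" | "p @ us = c" "m = us @ cpow c n" "us \<noteq> []"
    by fastforce
  then show ?case
  proof cases
    case 1
    then show ?thesis
      using long by blast
  next
    case 2
    then show ?thesis
      by (intro exI[of _ 0] exI[of _ p] exI[of _ us]) auto
  qed
qed simp

text \<open>The sum of the coefficients is the value of a Laurent polynomial at 1, and
  \<open>x\<close> itself has value 1.\<close>

lemma sum_lookup_mult_single:
  fixes q :: "int \<Rightarrow>\<^sub>0 'k::field"
  shows "Sum_any (Poly_Mapping.lookup (Poly_Mapping.single 1 1 * q)) = Sum_any (Poly_Mapping.lookup q)"
proof -
  define s :: "(int \<Rightarrow>\<^sub>0 'k) \<Rightarrow> 'k" where "s q = Sum_any (Poly_Mapping.lookup q)" for q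
  have s_add: "s (p + q) = s p + s q" for p q
    unfolding s_def plus_poly_mapping.rep_eq by (rule Sum_any.distrib) simp_all
  have s_sum: "s (\<Sum>i\<in>T. f i) = (\<Sum>i\<in>T. s (f i))" for f and T :: "int set"
    by (induction T rule: infinite_finite_induct) (simp_all add: s_add, simp_all add: s_def)
  have s_single: "s (Poly_Mapping.single k c) = c" for k c
    by (simp add: s_def lookup_single)
  have q: "q = (\<Sum>k\<in>Poly_Mapping.keys q. Poly_Mapping.single k (Poly_Mapping.lookup q k))"
    by (rule poly_mapping_eq_sum_single)
  have "s (Poly_Mapping.single 1 1 * q) = s (\<Sum>k\<in>Poly_Mapping.keys q. Poly_Mapping.single (1 + k) (Poly_Mapping.lookup q k))"
    by (subst q) (simp add: sum_distrib_left mult_single)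
  also have "\<dots> = s q"
    by (subst (2) q) (simp add: s_sum s_single)
  finally show ?thesis
    by (simp add: s_def)
qed

text \<open>The equation would give \<open>q = 1 + x * q\<close>, which is contradictory after
  evaluation at 1.\<close>

lemma one_minus_x_not_unit:
  fixes q :: "int \<Rightarrow>\<^sub>0 'k::field"
  shows "(1 - Poly_Mapping.single 1 1) * q \<noteq> 1"
proof
  assume "(1 - Poly_Mapping.single 1 1) * q = 1"
  then have "q = 1 + Poly_Mapping.single 1 1 * q"
    by (simp add: left_diff_distrib diff_eq_eq)
  then have "Sum_any (Poly_Mapping.lookup q) = Sum_any (Poly_Mapping.lookup (1 + Poly_Mapping.single 1 1 * q))"
    by simp
  also have "\<dots> = Sum_any (Poly_Mapping.lookup (1 :: int \<Rightarrow>\<^sub>0 'k)) + Sum_any (Poly_Mapping.lookup q)"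
    unfolding plus_poly_mapping.rep_eq by (subst Sum_any.distrib) (simp_all add: sum_lookup_mult_single)
  finally show False
    by (simp add: lookup_one)
qed

locale lpa_cycle = lpa E K
  for E :: "('v, 'e) pre_digraph" and K :: "'k::field itself" +
  fixes v :: 'v and c :: "'e list"
  assumes walk_c: "awalk v c v" and c_ne: "c \<noteq> []" and distinct_c: "distinct (map (tail E) c)"
begin

notation eqv (infix "\<approx>" 50)

lemma v_verts: "v \<in> verts E"
  using walk_c by auto

lemma walk_cpow: "awalk v (cpow c n) v"
  using walk_c v_verts by (induction n) (auto simp: awalk_simps)

text \<open>The ghost path \<open>c\<^sup>*\<close> plays the role of the inverse of
  \<open>c\<close>. It is always a left inverse at \<open>v\<close>, by \<open>gst_pth_same\<close>;
  that it is also a right inverse, so that exponents add, is established in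
  \<open>lpa_no_exit\<close>.\<close>

definition cycle_power :: "int \<Rightarrow> ('v, 'e) lpa_gen free_word \<Rightarrow>\<^sub>0 'k" where
  "cycle_power i = (if i \<ge> 0 then pth v (cpow c (nat i)) else gst v (cpow c (nat (- i))))"

lemma cycle_power_int: "cycle_power (int n) = pth v (cpow c n)"
  by (simp add: cycle_power_def)

lemma cycle_power_minus_int: "gst v (cpow c n) = cycle_power (- int n)"
  by (cases "n = 0") (simp_all add: cycle_power_def pth_Nil gst_Nil)

lemma cycle_power_A [simp, intro]: "cycle_power i \<in> A"
  using walk_cpow by (auto simp: cycle_power_def)

lemma V_cycle_power: "V v * cycle_power i \<approx> cycle_power i" and cycle_power_V: "cycle_power i * V v \<approx> cycle_power i"
  using V_pth[OF walk_cpow _ , of v] pth_V[OF walk_cpow, of v] V_gst[OF walk_cpow, of v] gst_V[OF walk_cpow, of v] v_verts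
  by (auto simp: cycle_power_def)

definition laurent_eval :: "(int \<Rightarrow>\<^sub>0 'k) \<Rightarrow> ('v, 'e) lpa_gen free_word \<Rightarrow>\<^sub>0 'k" where
  "laurent_eval p = (\<Sum>i\<in>Poly_Mapping.keys p. scal (Poly_Mapping.lookup p i) (cycle_power i))"

lemma laurent_eval_superset:
  "finite T \<Longrightarrow> Poly_Mapping.keys p \<subseteq> T \<Longrightarrow> laurent_eval p = (\<Sum>i\<in>T. scal (Poly_Mapping.lookup p i) (cycle_power i))"
  unfolding laurent_eval_def by (rule sum.mono_neutral_left) (auto simp: in_keys_iff)

lemma laurent_eval_add: "laurent_eval (p + q) = laurent_eval p + laurent_eval q"
  using keys_add[of p q]
  by (simp add: laurent_eval_superset[of "Poly_Mapping.keys p \<union> Poly_Mapping.keys q"] lookup_add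
      scal_add_left sum.distrib)

lemma laurent_eval_scal: "laurent_eval (scal d p) = scal d (laurent_eval p)"
  using keys_scal[of d p]
  by (simp add: laurent_eval_superset[of "Poly_Mapping.keys p"] lookup_scal scal_sum scal_scal)

lemma laurent_eval_diff: "laurent_eval (p - q) = laurent_eval p - laurent_eval q"
  using laurent_eval_add[of p "- q"] laurent_eval_scal[of "-1" q] by (simp add: scal_uminus_one)

lemma laurent_eval_zero [simp]: "laurent_eval 0 = 0"
  by (simp add: laurent_eval_def)

lemma laurent_eval_single: "laurent_eval (Poly_Mapping.single i d) = scal d (cycle_power i)"
  by (simp add: laurent_eval_def)

lemma laurent_eval_one: "laurent_eval 1 = V v"
  using laurent_eval_single[of 0 1] by (simp add: cycle_power_def pth_Nil)

lemma laurent_eval_A [simp, intro]: "laurent_eval p \<in> A"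
  by (auto simp: laurent_eval_def intro!: A_sum)

lemma V_laurent_eval: "V v * laurent_eval p \<approx> laurent_eval p" and laurent_eval_V: "laurent_eval p * V v \<approx> laurent_eval p"
  unfolding laurent_eval_def sum_distrib_left sum_distrib_right scal_mult_left scal_mult_right
  by (intro eqv_sum eqv_scal V_cycle_power cycle_power_V)+

lemma lpa_word_degree_pth: "lpa_word_degree (Free_Word (Vertex u # map Edge p)) = int (length p)"
  by (induction p) (auto simp: lpa_word_degree_def)

lemma lpa_word_degree_gst: "lpa_word_degree (Free_Word (map Ghost (rev p) @ [Vertex u])) = - int (length p)"
  by (induction p) (auto simp: lpa_word_degree_def)

lemma part_cycle_power: "prt n (cycle_power i) = (if n = i * int (length c) then cycle_power i else 0)"
proof (cases "i \<ge> 0")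
  case True
  then show ?thesis
    by (auto simp: cycle_power_def pth_def part_single lpa_word_degree_pth length_cpow)
next
  case False
  then show ?thesis
    by (auto simp: cycle_power_def gst_def part_single lpa_word_degree_gst length_cpow)
qed

lemma cycle_power_notin_I: "cycle_power i \<notin> I"
proof
  assume i: "cycle_power i \<in> I"
  define n where "n = nat \<bar>i\<bar>"
  have A: "gst v (cpow c n) \<in> A" "pth v (cpow c n) \<in> A"
    using walk_cpow by auto
  have "gst v (cpow c n) * pth v (cpow c n) \<in> I"
    using i A by (cases "i \<ge> 0") (auto simp: cycle_power_def n_def)
  then have "V v \<in> I"
    using gst_pth_same[OF walk_cpow] eqv_I by blast
  then show False
    using V_notin_I[OF v_verts] by blast
qed

text \<open>The powers of \<open>c\<close> have the pairwise different degrees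
  \<open>i * int (length c)\<close>, so taking components splits a relation into single terms, and a
  single power is nonzero because \<open>V v\<close> is.\<close>

lemma laurent_eval_I_iff: "laurent_eval p \<in> I \<longleftrightarrow> p = 0"
proof
  assume p: "laurent_eval p \<in> I"
  show "p = 0"
  proof (rule ccontr)
    assume "p \<noteq> 0"
    then obtain i where i: "Poly_Mapping.lookup p i \<noteq> 0"
      by (metis lookup_zero poly_mapping_eqI)
    have "prt (i * int (length c)) (laurent_eval p) =
        (\<Sum>j\<in>Poly_Mapping.keys p. if i = j then scal (Poly_Mapping.lookup p j) (cycle_power j) else 0)"
      unfolding laurent_eval_def part_sum part_scal part_cycle_power using c_ne by (intro sum.cong refl) auto
    also have "\<dots> = scal (Poly_Mapping.lookup p i) (cycle_power i)"
      using i by (auto simp: in_keys_iff)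
    finally have "scal (Poly_Mapping.lookup p i) (cycle_power i) \<in> I"
      using I_part[OF p, of "i * int (length c)"] by simp
    then have "scal (inverse (Poly_Mapping.lookup p i)) (scal (Poly_Mapping.lookup p i) (cycle_power i)) \<in> I"
      by (rule I_scal)
    then show False
      using i cycle_power_notin_I by (simp add: scal_scal)
  qed
qed simp

lemma laurent_eval_inj: "laurent_eval p \<approx> laurent_eval q \<longleftrightarrow> p = q"
  using laurent_eval_I_iff[of "p - q"] by (simp add: eqv_def laurent_eval_diff)

text \<open>If \<open>c\<^sup>n = p r = q s\<close> with \<open>r\<close> and \<open>s\<close> starting at the same vertex, then \<open>r\<close> and \<open>s\<close> differ by a
  power of \<open>c\<close>, because the sources of the edges of \<open>c\<close> are distinct.\<close>

lemma gst_cpow_monomial: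
  assumes "awalk v p w" "awalk v q w" "n > length p" "n > length q"
  shows "\<exists>f. (gst v (cpow c n) * pth v p) * (gst v q * pth v (cpow c n)) \<approx> laurent_eval f"
proof -
  note walk = walk_cpow[of n]
  note A = gst_A[OF walk] pth_A[OF walk] pth_A[OF assms(1)] gst_A[OF assms(2)]
  have len_c: "length c \<ge> 1"
    using c_ne by (cases c) auto
  have len: "length x < n * length c" if "length x < n" for x :: "'e list"
    using that mult_le_mono2[OF len_c, of n] by linarith
  have zero: ?thesis if "gst v (cpow c n) * pth v p \<in> I \<or> gst v q * pth v (cpow c n) \<in> I"
  proof -
    have "(gst v (cpow c n) * pth v p) * (gst v q * pth v (cpow c n)) \<in> I"
      using that A by blast
    then show ?thesis
      by (intro exI[of _ 0]) (simp add: eqv_0_iff)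
  qed
  have no_ext: False if "x = cpow c n @ r" "length x < n" for x r
    using len[OF that(2)] that(1) by (simp add: length_cpow)
  have tail_c2: "tail E (c ! length c1) = w"
    if c12: "c = c1 @ c2" "c2 \<noteq> []" "awalk v (cpow c a @ c1) w" for a c1 c2
  proof -
    have "awalk v c1 w"
      using c12(3) walk_cpow[of a] by (auto dest: awalk_ends)
    moreover obtain e c2' where "c2 = e # c2'"
      using c12(2) by (cases c2) auto
    ultimately show ?thesis
      using walk_c c12(1) by (auto simp: awalk_simps dest: awalk_ends)
  qed
  show ?thesis
  proof (cases rule: gst_pth_prefix_cases[OF walk assms(1)])
    case p: (1 r)
    show ?thesis
    proof (cases rule: gst_pth_prefix_cases[OF walk assms(2)])
      case q: (1 s)
      obtain a c1 c2 where a: "a < n" "c = c1 @ c2" "c2 \<noteq> []" "p = cpow c a @ c1" "r = c2 @ cpow c (n - a - 1)"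
        using prefix_cpow[OF p(1)[symmetric] len[OF assms(3)]] by blast
      obtain b d1 d2 where b: "b < n" "c = d1 @ d2" "d2 \<noteq> []" "q = cpow c b @ d1" "s = d2 @ cpow c (n - b - 1)"
        using prefix_cpow[OF q(1)[symmetric] len[OF assms(4)]] by blast
      have "tail E (c ! length c1) = tail E (c ! length d1)"
        using tail_c2 a b assms(1,2) by metis
      moreover have "length c1 < length c" "length d1 < length c"
        by (simp add: arg_cong[OF a(2), of length] a(3), simp add: arg_cong[OF b(2), of length] b(3))
      ultimately have "length c1 = length d1"
        using distinct_c by (simp add: distinct_conv_nth) metis
      then have "c2 = d2"
        using a(2) b(2) by auto
      have *: "(gst v (cpow c n) * pth v p) * (gst v q * pth v (cpow c n)) \<approx> gst w r * pth w s"
        using p(3) q(4) A by (intro eqv_mult) auto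
      show ?thesis
      proof (cases "a \<le> b")
        case True
        then have "n - a - 1 = (n - b - 1) + (b - a)"
          using b(1) by simp
        then have "r = s @ cpow c (b - a)"
          using a(5) b(5) \<open>c2 = d2\<close> by (simp add: cpow_add)
        then have "gst w r * pth w s \<approx> cycle_power (- int (b - a))"
          using gst_append_pth[OF q(2) walk_cpow] by (simp add: cycle_power_minus_int)
        then show ?thesis
          using * eqv_trans by (intro exI[of _ "Poly_Mapping.single (- int (b - a)) 1"]) (auto simp: laurent_eval_single)
      next
        case False
        then have "n - b - 1 = (n - a - 1) + (a - b)"
          using a(1) by simp
        then have "s = r @ cpow c (a - b)"
          using a(5) b(5) \<open>c2 = d2\<close> by (simp add: cpow_add)
        then have "gst w r * pth w s \<approx> cycle_power (int (a - b))"
          using gst_pth_append[OF p(2) walk_cpow] by (simp add: cycle_power_int del: of_nat_diff)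
        then show ?thesis
          using * eqv_trans by (intro exI[of _ "Poly_Mapping.single (int (a - b)) 1"]) (auto simp: laurent_eval_single)
      qed
    next
      case (2 r)
      then show ?thesis
        using no_ext assms by blast
    next
      case 3
      then show ?thesis
        using zero by blast
    qed
  next
    case (2 r)
    then show ?thesis
      using no_ext assms by blast
  next
    case 3
    then show ?thesis
      using zero by blast
  qed
qed

lemma compress_cycle:
  assumes "z \<in> A"
  shows "\<exists>n f. gst v (cpow c n) * z * pth v (cpow c n) \<approx> laurent_eval f"
proof -
  define W where "W n = {x. \<exists>f. x \<approx> laurent_eval f}" for n :: nat
  have "eventually (\<lambda>n. gst v (cpow c n) * z * pth v (cpow c n) \<in> W n) sequentially"
  proof (rule eventually_compress[OF walk_cpow])
    show "x + y \<in> W n" if "x \<in> W n" "y \<in> W n" for n x y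
    proof -
      obtain f g where "x \<approx> laurent_eval f" "y \<approx> laurent_eval g"
        using \<open>x \<in> W n\<close> \<open>y \<in> W n\<close> by (auto simp: W_def)
      then have "x + y \<approx> laurent_eval (f + g)"
        unfolding laurent_eval_add by (rule eqv_add)
      then show ?thesis
        by (auto simp: W_def)
    qed
    show "scal d x \<in> W n" if "x \<in> W n" for n d x
    proof -
      obtain f where "x \<approx> laurent_eval f"
        using \<open>x \<in> W n\<close> by (auto simp: W_def)
      then have "scal d x \<approx> laurent_eval (scal d f)"
        unfolding laurent_eval_scal by (rule eqv_scal)
      then show ?thesis
        by (auto simp: W_def)
    qed
    show "y \<in> W n" if "x \<in> W n" "x \<approx> y" for n x y
      using that eqv_sym eqv_trans unfolding W_def by blast
    show "0 \<in> W n" for n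
      unfolding W_def by (auto intro!: exI[of _ 0])
    show "eventually (\<lambda>n. (gst v (cpow c n) * pth v p) * (gst v q * pth v (cpow c n)) \<in> W n) sequentially"
      if "awalk v p w" "awalk v q w" for p q w
      unfolding eventually_sequentially W_def using gst_cpow_monomial[OF that]
      by (intro exI[of _ "Suc (max (length p) (length q))"]) auto
  qed (rule assms)
  then have "\<exists>n. gst v (cpow c n) * z * pth v (cpow c n) \<in> W n"
    by (rule eventually_happens'[OF sequentially_bot])
  then show ?thesis
    by (simp add: W_def)
qed

text \<open>Compression by a power of \<open>c\<close> returns to \<open>v\<close>, so it leaves the
  value at \<open>v\<close> unchanged modulo \<open>I\<close>. Cycles with exits are included, for
  use in \<open>exit_all_scalar\<close>.\<close>

lemma cent_V:
  assumes "cent t"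
  shows "\<exists>f. t (V v) \<approx> laurent_eval f"
proof -
  have "t (V v) \<in> A"
    using centD(1)[OF assms] v_verts by auto
  then obtain n f where "gst v (cpow c n) * t (V v) * pth v (cpow c n) \<approx> laurent_eval f"
    using compress_cycle by blast
  then show ?thesis
    using cent_vertex[OF assms walk_cpow[of n]] eqv_sym eqv_trans by blast
qed

text \<open>Compressing the Laurent polynomial once more by the exit \<open>e\<close> kills every
  nonzero power of \<open>c\<close>, since these begin or end with the edge \<open>hd c\<close> or
  its ghost. Only the constant coefficient remains, now as a multiple of the range of
  \<open>e\<close>.\<close>

lemma exit_all_scalar:
  assumes "prime_elementwise" and e: "e \<in> arcs E" "tail E e = v" "e \<noteq> hd c"
  shows "all_scalar"
proof (rule all_scalarI[OF assms(1)])
  fix t assume t: "cent t"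
  then obtain f where f: "t (V v) \<approx> laurent_eval f"
    using cent_V by blast
  have walk: "awalk v [e] (head E e)"
    using awalk_single[OF e(1)] e(2) by simp
  note A = gst_A[OF walk] pth_A[OF walk]
  have cycle_power: "gst v [e] * cycle_power i * pth v [e] \<approx> (if i = 0 then V (head E e) else 0)" for i
  proof -
    obtain d c' where c: "c = d # c'" "d \<noteq> e"
      using c_ne e(3) by (cases c) auto
    consider "i = 0" | n where "i = int (Suc n)" | n where "i = - int (Suc n)"
      by (metis int_cases3 gr0_implies_Suc)
    then show ?thesis
    proof cases
      case 1
      have "gst v [e] * V v * pth v [e] \<approx> gst v [e] * pth v [e]"
        using gst_V[OF walk, of v] v_verts A by (intro eqv_mult_right) auto
      also have "\<dots> \<approx> V (head E e)"
        by (rule gst_pth_same[OF walk])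
      finally show ?thesis
        using 1 by (simp add: cycle_power_def pth_Nil)
    next
      case (2 n)
      have "gst v [e] * pth v (cpow c (Suc n)) \<in> I"
        using gst_pth_Cons[OF walk, of d "c' @ cpow c n"] walk_cpow[of "Suc n"] c
        by (auto simp: eqv_0_iff)
      then have "gst v [e] * cycle_power i * pth v [e] \<in> I"
        using A 2 by (simp only: cycle_power_int) blast
      then show ?thesis
        using 2 by (simp add: eqv_0_iff)
    next
      case (3 n)
      have "gst v (cpow c (Suc n)) * pth v [e] \<in> I"
        using gst_pth_Cons[of v d "c' @ cpow c n" v, OF _ walk] walk_cpow[of "Suc n"] c
        by (auto simp: eqv_0_iff)
      then have "gst v [e] * (cycle_power i * pth v [e]) \<in> I"
        using A 3 by (simp only: cycle_power_minus_int) blast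
      then show ?thesis
        using 3 by (simp add: eqv_0_iff mult.assoc)
    qed
  qed
  have laurent_eval_f: "laurent_eval f = (\<Sum>i\<in>insert 0 (Poly_Mapping.keys f). scal (Poly_Mapping.lookup f i) (cycle_power i))"
    by (rule laurent_eval_superset) auto
  have "t (V (head E e)) \<approx> gst v [e] * t (V v) * pth v [e]"
    by (rule eqv_sym[OF cent_vertex[OF t walk]])
  also have "\<dots> \<approx> gst v [e] * laurent_eval f * pth v [e]"
    using A f by (intro eqv_mult_left eqv_mult_right)
  also have "\<dots> \<approx> (\<Sum>i\<in>insert 0 (Poly_Mapping.keys f). scal (Poly_Mapping.lookup f i) (if i = 0 then V (head E e) else 0))"
    unfolding laurent_eval_f sum_distrib_left sum_distrib_right scal_mult_left scal_mult_right
    by (intro eqv_sum eqv_scal cycle_power)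
  also have "\<dots> = (\<Sum>i\<in>insert 0 (Poly_Mapping.keys f). if i = 0 then scal (Poly_Mapping.lookup f 0) (V (head E e)) else 0)"
    by (intro sum.cong refl) auto
  also have "\<dots> = scal (Poly_Mapping.lookup f 0) (V (head E e))"
    by (subst sum.delta) auto
  finally show "\<exists>k. \<exists>u\<in>verts E. t (V u) \<approx> scal k (V u)"
    using e(1) by (intro exI bexI[of _ "head E e"]) auto
qed

end

section \<open>Cycles without exits and the corner at a vertex\<close>

locale lpa_no_exit = lpa_cycle E K v c
  for E :: "('v, 'e) pre_digraph" and K :: "'k::field itself" and v :: 'v and c :: "'e list" +
  assumes no_exit: "e \<in> arcs E \<Longrightarrow> d \<in> set c \<Longrightarrow> tail E e = tail E d \<Longrightarrow> e = d"
begin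

notation eqv (infix "\<approx>" 50)

text \<open>Without exits, \<open>e\<close> is the only edge leaving its source, so the relation at
  this regular vertex has a single summand.\<close>

lemma Ed_Gh: "e \<in> set c \<Longrightarrow> Ed e * Gh e \<approx> V (tail E e)"
proof -
  assume e: "e \<in> set c"
  then have "e \<in> arcs E"
    using walk_c by auto
  then have out: "out_arcs E (tail E e) = {e}"
    using no_exit[OF _ e] by auto
  then have "regular_vertex E (tail E e)"
    using \<open>e \<in> arcs E\<close> by (auto simp: regular_vertex_def sink_def infinite_emitter_def)
  from V_sum[OF this] show ?thesis
    by (simp add: out eqv_sym)
qed

lemma pth_gst: "set p \<subseteq> set c \<Longrightarrow> awalk u p w \<Longrightarrow> pth u p * gst u p \<approx> V u"
proof (induction p arbitrary: u)
  case Nil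
  then show ?case
    using V_V[of u u] by (auto simp: pth_Nil gst_Nil awalk_simps)
next
  case (Cons e p)
  have e: "e \<in> arcs E" "u = tail E e" "awalk (head E e) p w"
    using Cons.prems by (auto simp: awalk_simps)
  have "pth u (e # p) * gst u (e # p) \<approx> (Ed e * pth (head E e) p) * (gst (head E e) p * Gh e)"
    using Cons.prems by (intro eqv_mult pth_Cons gst_Cons) auto
  also have "\<dots> = Ed e * (pth (head E e) p * gst (head E e) p) * Gh e"
    by (simp add: mult.assoc)
  also have "\<dots> \<approx> Ed e * V (head E e) * Gh e"
    using Cons.prems e by (intro eqv_mult_left eqv_mult_right Cons.IH) auto
  also have "\<dots> \<approx> Ed e * Gh e"
    using e by (intro eqv_mult_right Ed_V) auto
  also have "\<dots> \<approx> V u"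
    using Ed_Gh Cons.prems e by auto
  finally show ?case .
qed

lemma set_cpow: "set (cpow c n) \<subseteq> set c"
  by (induction n) auto

lemma cpow_pth_gst: "pth v (cpow c n) * gst v (cpow c n) \<approx> V v"
  by (rule pth_gst[OF set_cpow walk_cpow])

text \<open>For mixed signs the common power cancels in the middle: a ghost power followed by a
  power by \<open>gst_pth_same\<close>, the opposite order by \<open>cpow_pth_gst\<close>, which
  rests on the absence of exits.\<close>

lemma cycle_power_mult: "cycle_power i * cycle_power j \<approx> cycle_power (i + j)"
proof -
  note A = pth_A[OF walk_cpow] gst_A[OF walk_cpow]
  have minus: "gst v (cpow c n) = cycle_power (- int n)" for n
    by (rule cycle_power_minus_int)
  consider m n where "i = int m" "j = int n" | m n where "i = - int m" "j = - int n"
    | m n where "i = int m" "j = - int n" | m n where "i = - int m" "j = int n"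
    by (metis int_cases2)
  then show ?thesis
  proof cases
    case (1 m n)
    then show ?thesis
      using pth_append[OF walk_cpow[of m] walk_cpow[of n]] cycle_power_int[of m] cycle_power_int[of n] cycle_power_int[of "m + n"]
      by (simp add: cpow_add)
  next
    case (2 m n)
    then show ?thesis
      using gst_append[OF walk_cpow[of n] walk_cpow[of m]] minus[of m] minus[of n] minus[of "n + m"]
      by (simp add: cpow_add[symmetric] algebra_simps)
  next
    case (3 m n)
    show ?thesis
    proof (cases "m \<ge> n")
      case True
      then obtain k where m: "m = k + n"
        using le_iff_add[of n m] by (auto simp: add.commute)
      have "pth v (cpow c m) * gst v (cpow c n) \<approx> pth v (cpow c k) * pth v (cpow c n) * gst v (cpow c n)"
        unfolding m cpow_add using A by (intro eqv_mult_right eqv_sym[OF pth_append[OF walk_cpow walk_cpow]])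
      also have "\<dots> = pth v (cpow c k) * (pth v (cpow c n) * gst v (cpow c n))"
        by (simp add: mult.assoc)
      also have "\<dots> \<approx> pth v (cpow c k) * V v"
        using A by (intro eqv_mult_left cpow_pth_gst)
      also have "\<dots> \<approx> pth v (cpow c k)"
        using cycle_power_V[of "int k"] by (simp add: cycle_power_int)
      finally show ?thesis
        using 3 cycle_power_int[of m] cycle_power_int[of k] minus[of n] by (simp add: m)
    next
      case False
      then obtain k where n: "n = k + m"
        using le_iff_add[of m n] by (auto simp: add.commute)
      have "pth v (cpow c m) * gst v (cpow c n) \<approx> pth v (cpow c m) * (gst v (cpow c m) * gst v (cpow c k))"
        unfolding n cpow_add using A by (intro eqv_mult_left eqv_sym[OF gst_append[OF walk_cpow walk_cpow]])
      also have "\<dots> = pth v (cpow c m) * gst v (cpow c m) * gst v (cpow c k)"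
        by (simp add: mult.assoc)
      also have "\<dots> \<approx> V v * gst v (cpow c k)"
        using A by (intro eqv_mult_right cpow_pth_gst)
      also have "\<dots> \<approx> gst v (cpow c k)"
        using V_cycle_power[of "- int k"] by (simp add: minus)
      finally show ?thesis
        using 3 cycle_power_int[of m] minus[of k] minus[of n] by (simp add: n)
    qed
  next
    case (4 m n)
    show ?thesis
    proof (cases "m \<ge> n")
      case True
      then obtain k where m: "m = n + k"
        using le_iff_add[of n m] by auto
      then show ?thesis
        using 4 gst_append_pth[OF walk_cpow[of n] walk_cpow[of k]]
        by (simp add: cycle_power_int minus cpow_add[symmetric])
    next
      case False
      then obtain k where n: "n = m + k"
        using le_iff_add[of m n] by auto
      then show ?thesis
        using 4 gst_pth_append[OF walk_cpow[of m] walk_cpow[of k]] cycle_power_int[of n] cycle_power_int[of k] minus[of m]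
        by (simp add: cpow_add[symmetric])
    qed
  qed
qed

lemma laurent_eval_mult: "laurent_eval p * laurent_eval q \<approx> laurent_eval (p * q)"
proof -
  have laurent_eval_sum: "laurent_eval (\<Sum>i\<in>T. f i) = (\<Sum>i\<in>T. laurent_eval (f i))" for f :: "int \<Rightarrow> _" and T
    by (induction T rule: infinite_finite_induct) (simp_all add: laurent_eval_add)
  have "p * q = (\<Sum>i\<in>Poly_Mapping.keys p. Poly_Mapping.single i (Poly_Mapping.lookup p i)) *
      (\<Sum>j\<in>Poly_Mapping.keys q. Poly_Mapping.single j (Poly_Mapping.lookup q j))"
    by (simp flip: poly_mapping_eq_sum_single)
  also have "\<dots> = (\<Sum>i\<in>Poly_Mapping.keys p. \<Sum>j\<in>Poly_Mapping.keys q.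
      Poly_Mapping.single (i + j) (Poly_Mapping.lookup p i * Poly_Mapping.lookup q j))"
    by (simp add: sum_product mult_single)
  finally have "laurent_eval (p * q) = (\<Sum>i\<in>Poly_Mapping.keys p. \<Sum>j\<in>Poly_Mapping.keys q.
      scal (Poly_Mapping.lookup p i * Poly_Mapping.lookup q j) (cycle_power (i + j)))"
    by (simp add: laurent_eval_sum laurent_eval_single)
  moreover have "laurent_eval p * laurent_eval q = (\<Sum>i\<in>Poly_Mapping.keys p. \<Sum>j\<in>Poly_Mapping.keys q.
      scal (Poly_Mapping.lookup p i * Poly_Mapping.lookup q j) (cycle_power i * cycle_power j))"
    by (simp add: laurent_eval_def sum_product scal_mult_left scal_mult_right scal_scal mult.commute)
  ultimately show ?thesis
    by (auto intro!: eqv_sum eqv_scal cycle_power_mult)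
qed

text \<open>Replacing both copies of \<open>V v\<close> by
  \<open>pth v (cpow c n) * gst v (cpow c n)\<close> surrounds \<open>z\<close> by the compression
  that is already known to be a Laurent polynomial; the outer factors only shift exponents.\<close>

lemma corner: "z \<in> A \<Longrightarrow> \<exists>f. V v * z * V v \<approx> laurent_eval f"
proof -
  assume z: "z \<in> A"
  then obtain n f where f: "gst v (cpow c n) * z * pth v (cpow c n) \<approx> laurent_eval f"
    using compress_cycle by blast
  let ?p = "pth v (cpow c n)" and ?g = "gst v (cpow c n)"
  note A = pth_A[OF walk_cpow] gst_A[OF walk_cpow]
  have ends: "?p = laurent_eval (Poly_Mapping.single (int n) 1)" "?g = laurent_eval (Poly_Mapping.single (- int n) 1)"
    by (simp_all add: laurent_eval_single cycle_power_int cycle_power_minus_int)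
  have "V v * z * V v \<approx> (?p * ?g) * z * (?p * ?g)"
    using A z v_verts by (intro eqv_mult eqv_sym[OF cpow_pth_gst] eqv_refl) auto
  also have "\<dots> = ?p * (?g * z * ?p) * ?g"
    by (simp add: mult.assoc)
  also have "\<dots> \<approx> ?p * laurent_eval f * ?g"
    using A f by (intro eqv_mult_left eqv_mult_right)
  also have "\<dots> \<approx> laurent_eval (Poly_Mapping.single (int n) 1 * f) * ?g"
    using A unfolding ends(1) by (intro eqv_mult_right laurent_eval_mult) auto
  also have "\<dots> \<approx> laurent_eval (Poly_Mapping.single (int n) 1 * f * Poly_Mapping.single (- int n) 1)"
    unfolding ends(2) by (rule laurent_eval_mult)
  finally show ?thesis
    by blast
qed

lemma laurent_eval_commute: "laurent_eval p * laurent_eval q \<approx> laurent_eval q * laurent_eval p"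
  using laurent_eval_mult[of p q] laurent_eval_mult[of q p] eqv_sym eqv_trans by (metis mult.commute)

text \<open>The corner is commutative, so for \<open>F = laurent_eval f\<close> one has \<open>V v *
  a * F \<approx> (V v * a * V v) * F \<approx> F * (V v * a * V v) \<approx> F * a * V v\<close>.
  This is the compatibility asked for in \<open>cent_extend\<close>, and it puts \<open>V v\<close>
  into the domain of the extension, which is then all of \<open>A\<close> by
  \<open>full\<close>.\<close>

lemma laurent_eval_cent:
  assumes "prime_elementwise" and full: "\<And>P. idl P \<Longrightarrow> V v \<in> P \<Longrightarrow> P = A"
  obtains t where "cent t" "t (V v) \<approx> laurent_eval f"
proof -
  have comm: "V v * a * laurent_eval f \<approx> laurent_eval f * a * V v" if a: "a \<in> A" for a
  proof -
    note vA = gens_A(1)[OF v_verts]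
    obtain g where g: "V v * a * V v \<approx> laurent_eval g"
      using corner a by blast
    have "V v * a * laurent_eval f \<approx> V v * a * (V v * laurent_eval f)"
      using vA a by (intro eqv_mult_left eqv_sym[OF V_laurent_eval]) auto
    also have "\<dots> = (V v * a * V v) * laurent_eval f"
      by (simp add: mult.assoc)
    also have "\<dots> \<approx> laurent_eval g * laurent_eval f"
      using g by (intro eqv_mult_right) auto
    also have "\<dots> \<approx> laurent_eval f * laurent_eval g"
      by (rule laurent_eval_commute)
    also have "\<dots> \<approx> laurent_eval f * (V v * a * V v)"
      using g by (intro eqv_mult_left eqv_sym[OF g]) auto
    also have "\<dots> = laurent_eval f * V v * (a * V v)"
      by (simp add: mult.assoc)
    also have "\<dots> \<approx> laurent_eval f * (a * V v)"
      using vA a by (intro eqv_mult_right laurent_eval_V) auto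
    finally show ?thesis
      by (simp add: mult.assoc)
  qed
  have "V v \<in> ext_domain (V v) (laurent_eval f)"
    using v_verts comm by (auto simp: ext_domain_def)
  then have "ext_domain (V v) (laurent_eval f) = A"
    using v_verts by (intro full idl_ext_domain) auto
  then show ?thesis
    using cent_extend[OF assms(1) _ V_notin_I[OF v_verts] _ comm] that v_verts by auto
qed

lemma cent_comp_V:
  assumes "cent s" "cent t" "s (V v) \<approx> laurent_eval g" "t (V v) \<approx> laurent_eval f"
  shows "s (t (V v)) \<approx> laurent_eval (g * f)"
proof -
  note s = centD[OF assms(1)] and t = centD[OF assms(2)]
  note vA = gens_A(1)[OF v_verts]
  have "s (t (V v)) \<approx> s (laurent_eval f)"
    using assms(4) t(1) vA by (intro s(2)) auto
  also have "\<dots> \<approx> s (V v * laurent_eval f)"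
    using vA by (intro s(2) eqv_sym[OF V_laurent_eval]) auto
  also have "\<dots> \<approx> s (V v) * laurent_eval f"
    using vA by (intro s(5)) auto
  also have "\<dots> \<approx> laurent_eval g * laurent_eval f"
    using assms(3) by (intro eqv_mult_right) auto
  also have "\<dots> \<approx> laurent_eval (g * f)"
    by (rule laurent_eval_mult)
  finally show ?thesis .
qed

text \<open>The isomorphism is evaluation at \<open>V v\<close>: it is injective by primeness and
  surjective by \<open>laurent_eval_cent\<close>. Composition becomes multiplication by
  \<open>cent_comp_V\<close>.\<close>

lemma centroid_isomorphic_laurent:
  assumes "prime_elementwise" and full: "\<And>P. idl P \<Longrightarrow> V v \<in> P \<Longrightarrow> P = A"
  shows "alg_isomorphic (centroid L) laurent_algebra"
proof -
  note vA = gens_A(1)[OF v_verts]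
  have lift: "\<exists>t f. cent t \<and> (\<forall>x\<in>A. \<tau> (cls x) = cls (t x)) \<and> t (V v) \<approx> laurent_eval f"
    if \<tau>: "\<tau> \<in> carrier (centroid L)" for \<tau>
  proof -
    obtain t where t: "cent t" "\<And>x. x \<in> A \<Longrightarrow> \<tau> (cls x) = cls (t x)"
      using centroid_lift[OF \<tau>] by metis
    then show ?thesis
      using cent_V by blast
  qed
  then obtain T h where T: "\<And>\<tau>. \<tau> \<in> carrier (centroid L) \<Longrightarrow> cent (T \<tau>)"
    "\<And>\<tau> x. \<tau> \<in> carrier (centroid L) \<Longrightarrow> x \<in> A \<Longrightarrow> \<tau> (cls x) = cls (T \<tau> x)"
    "\<And>\<tau>. \<tau> \<in> carrier (centroid L) \<Longrightarrow> T \<tau> (V v) \<approx> laurent_eval (h \<tau>)"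
    by metis
  have h_eq: "h \<tau> = f" if "\<tau> \<in> carrier (centroid L)" "\<tau> (cls (V v)) = cls (laurent_eval f)" for \<tau> f
  proof -
    have "T \<tau> (V v) \<approx> laurent_eval f"
      using that(2) T(2)[OF that(1) vA] by (simp add: cls_eq_iff)
    then have "laurent_eval (h \<tau>) \<approx> laurent_eval f"
      using T(3)[OF that(1)] eqv_sym eqv_trans by blast
    then show ?thesis
      by (simp add: laurent_eval_inj)
  qed
  have "bij_betw h (carrier (centroid L)) UNIV"
  proof (rule bij_betwI')
    fix \<sigma> \<tau> assume st: "\<sigma> \<in> carrier (centroid L)" "\<tau> \<in> carrier (centroid L)"
    show "h \<sigma> = h \<tau> \<longleftrightarrow> \<sigma> = \<tau>"
    proof
      assume "h \<sigma> = h \<tau>"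
      then have "T \<sigma> (V v) \<approx> T \<tau> (V v)"
        using T(3)[OF st(1)] T(3)[OF st(2)] eqv_sym eqv_trans by metis
      then have "T \<sigma> x \<approx> T \<tau> x" if "x \<in> A" for x
        using cent_eqvI[OF assms(1) T(1)[OF st(1)] T(1)[OF st(2)] vA V_notin_I[OF v_verts]] that by blast
      then show "\<sigma> = \<tau>"
        using T(2)[OF st(1)] T(2)[OF st(2)] by (intro centroid_eqI[OF st]) (simp add: cls_eq_iff)
    qed simp
  next
    fix f
    obtain t where t: "cent t" "t (V v) \<approx> laurent_eval f"
      using laurent_eval_cent[OF assms] by blast
    obtain \<tau> where \<tau>: "\<tau> \<in> carrier (centroid L)" "\<And>x. x \<in> A \<Longrightarrow> \<tau> (cls x) = cls (t x)"
      using cent_imp_centroid[OF t(1)] by blast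
    have "h \<tau> = f"
      using \<tau> t(2) vA by (intro h_eq) (simp_all add: cls_eq_iff)
    then show "\<exists>\<tau>\<in>carrier (centroid L). f = h \<tau>"
      using \<tau>(1) by blast
  qed simp
  moreover have "h (alg_add (centroid L) \<sigma> \<tau>) = h \<sigma> + h \<tau>"
    "h (alg_mult (centroid L) \<sigma> \<tau>) = h \<sigma> * h \<tau>"
    "h (alg_scale (centroid L) d \<tau>) = scal d (h \<tau>)"
    if st: "\<sigma> \<in> carrier (centroid L)" "\<tau> \<in> carrier (centroid L)" for \<sigma> \<tau> d
  proof -
    note ops = centroid_ops[OF st(1) T(2)[OF st(1)] T(1)[OF st(1)] st(2) T(2)[OF st(2)] T(1)[OF st(2)]]
    have "T \<sigma> (V v) + T \<tau> (V v) \<approx> laurent_eval (h \<sigma> + h \<tau>)"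
      unfolding laurent_eval_add using st by (intro eqv_add T(3))
    then show "h (alg_add (centroid L) \<sigma> \<tau>) = h \<sigma> + h \<tau>"
      using vA by (intro h_eq ops(1)) (simp_all add: ops(4) cls_eq_iff)
    have "T \<sigma> (T \<tau> (V v)) \<approx> laurent_eval (h \<sigma> * h \<tau>)"
      using st by (intro cent_comp_V T)
    then show "h (alg_mult (centroid L) \<sigma> \<tau>) = h \<sigma> * h \<tau>"
      using vA by (intro h_eq ops(2)) (simp_all add: ops(5) cls_eq_iff)
    have "scal d (T \<tau> (V v)) \<approx> laurent_eval (scal d (h \<tau>))"
      unfolding laurent_eval_scal using st by (intro eqv_scal T(3))
    then show "h (alg_scale (centroid L) d \<tau>) = scal d (h \<tau>)"
      using vA by (intro h_eq ops(3)) (simp_all add: ops(6) cls_eq_iff)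
  qed
  ultimately show ?thesis
    unfolding alg_isomorphic_def laurent_algebra_def semigroup_algebra_def
    by (intro exI[of _ h]) (simp add: map_eq_scal)
qed

text \<open>Extend \<open>1 - x\<close> to a centroid element \<open>t\<close>. Simplicity gives
  \<open>z\<close> with \<open>t z \<approx> V v\<close>, but \<open>z\<close> may lie outside the
  corner; multiplying by \<open>V v\<close> on both sides moves it there and turns it into an
  inverse of \<open>1 - x\<close>.\<close>

lemma not_simple:
  assumes full: "\<And>P. idl P \<Longrightarrow> V v \<in> P \<Longrightarrow> P = A"
  shows "\<not> alg_simple L"
proof
  assume simple: "alg_simple L"
  note vA = gens_A(1)[OF v_verts]
  let ?f = "1 - Poly_Mapping.single 1 1 :: int \<Rightarrow>\<^sub>0 'k"
  obtain t where t: "cent t" "t (V v) \<approx> laurent_eval ?f"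
    using laurent_eval_cent[OF alg_simple_imp_prime_elementwise[OF simple] full] by blast
  have "?f \<noteq> 0"
    using one_minus_x_not_unit[of 0] by (metis eq_iff_diff_eq_0 one_poly_mapping.rep_eq single_one inj_single
        zero_neq_one lookup_single_not_eq lookup_one_zero)
  then have "t (V v) \<notin> I"
    using t(2) laurent_eval_I_iff eqv_I by blast
  then obtain z where z: "z \<in> A" "V v \<approx> t z"
    using simple_cent_surj[OF simple t(1) vA _ vA] by blast
  obtain g where g: "V v * z * V v \<approx> laurent_eval g"
    using corner z by blast
  note tD = centD[OF t(1)]
  have "V v \<approx> V v * V v * V v"
  proof -
    have "V v * V v \<approx> V v"
      using V_V[OF v_verts v_verts] by simp
    then show ?thesis
      using eqv_mult_right[OF vA] eqv_trans eqv_sym by blast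
  qed
  also have "\<dots> \<approx> V v * t z * V v"
    using z vA by (intro eqv_mult_left eqv_mult_right) auto
  also have "\<dots> \<approx> t (V v * z) * V v"
    using z vA by (intro eqv_mult_right eqv_sym[OF tD(6)]) auto
  also have "\<dots> \<approx> t (V v * z * V v)"
    using z vA by (intro eqv_sym[OF tD(5)]) auto
  also have "\<dots> \<approx> t (laurent_eval g)"
    using z vA g by (intro tD(2)) auto
  also have "\<dots> \<approx> t (V v * laurent_eval g)"
    using vA by (intro tD(2) eqv_sym[OF V_laurent_eval]) auto
  also have "\<dots> \<approx> t (V v) * laurent_eval g"
    using vA by (intro tD(5)) auto
  also have "\<dots> \<approx> laurent_eval ?f * laurent_eval g"
    using t(2) by (intro eqv_mult_right) auto
  also have "\<dots> \<approx> laurent_eval (?f * g)"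
    by (rule laurent_eval_mult)
  finally have "laurent_eval 1 \<approx> laurent_eval (?f * g)"
    by (simp add: laurent_eval_one)
  then have "?f * g = 1"
    using laurent_eval_inj by metis
  then show False
    using one_minus_x_not_unit by blast
qed

end

section \<open>Scalar centroid or comet\<close>

lemma same_cycle_set: "same_cycle c d \<Longrightarrow> set d = set c"
  by (auto simp: same_cycle_def)

lemma has_exit_iff: "has_exit E c \<longleftrightarrow> (\<exists>e\<in>arcs E. \<exists>d\<in>set c. tail E e = tail E d \<and> e \<noteq> d)"
  unfolding has_exit_def by (metis in_set_conv_nth)

lemma same_cycle_if_rotations_eq:
  assumes "rotate i c = rotate j d" "d \<noteq> []"
  shows "same_cycle c d"
proof -
  \<comment> \<open>After \<open>j\<close> rotations, another \<open>j * (length d - 1)\<close> give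
    \<open>j * length d\<close> in total, that is, \<open>j\<close> full turns.\<close>
  have "(j * (length d - 1) + j) mod length d = 0"
    using assms(2) by (cases d) (auto simp: algebra_simps simp flip: mult_Suc_right)
  then have "rotate (j * (length d - 1)) (rotate i c) = d"
    unfolding assms(1) by (simp add: rotate_rotate rotate_id)
  then show ?thesis
    unfolding same_cycle_def rotate_rotate by metis
qed

section \<open>Closed walks, rotations and exits of cycles\<close>

context wf_digraph
begin

text \<open>If the vertices visited after the first edge are distinct, the walk is itself a cycle;
  otherwise \<open>r'\<close> contains a strictly shorter closed walk.\<close>

lemma closed_walk_cycle:
  assumes "awalk w r w" "r \<noteq> []"
  shows "\<exists>d. cycle d \<and> set d \<subseteq> set r"
  using assms
proof (induction "length r" arbitrary: w r rule: less_induct)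
  case less
  obtain e r' where r: "r = e # r'"
    using less.prems(2) by (cases r) auto
  have r': "awalk (head G e) r' w"
    using less.prems(1) r by (auto simp: awalk_simps)
  show ?case
  proof (cases "distinct (awalk_verts (head G e) r')")
    case True
    then have "cycle r"
      using less.prems r unfolding cycle_def by (intro exI[of _ w]) simp
    then show ?thesis
      by blast
  next
    case False
    obtain q s t x where s: "r' = q @ s @ t" "0 < length s" "awalk x s x"
      using awalk_not_distinct_decomp[OF r' False] by blast
    then obtain d where "cycle d" "set d \<subseteq> set s"
      using less.hyps[of s x] r by auto
    then show ?thesis
      using s r by auto
  qed
qed

lemma not_distinct_cycle:
  assumes "awalk u p w" "\<not> distinct (awalk_verts u p)"
  shows "\<exists>d. cycle d \<and> set d \<subseteq> set p"
proof -
  obtain q s t x where "p = q @ s @ t" "0 < length s" "awalk x s x"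
    using awalk_not_distinct_decomp[OF assms] by blast
  then show ?thesis
    using closed_walk_cycle[of x s] by auto
qed

lemma cycle_rotate:
  assumes "cycle c" "d \<in> set c"
  obtains i c' where "rotate i c = d # c'" "awalk (tail G d) (d # c') (tail G d)"
    "distinct (map (tail G) (d # c'))" "set (d # c') = set c"
proof -
  obtain u where u: "awalk u c u" "distinct (map (tail G) c)"
    using assms(1) cycle_iff_distinct_sources by blast
  obtain x y where c: "c = x @ d # y"
    using assms(2) by (auto simp: in_set_conv_decomp)
  have "rotate (length x) c = d # (y @ x)"
    unfolding c using rotate_append[of x "d # y"] by simp
  moreover have "awalk (tail G d) (d # (y @ x)) (tail G d)"
  proof -
    have "awalk u x (tail G d)" "awalk (head G d) y u" "d \<in> arcs G"
      using u(1) unfolding c by (auto simp: awalk_simps dest: awalk_ends)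
    then show ?thesis
      by (auto simp: awalk_simps)
  qed
  moreover have "distinct (map (tail G) (d # (y @ x)))" "set (d # (y @ x)) = set c"
    using u(2) by (auto simp: c)
  ultimately show ?thesis
    using that by blast
qed

lemma greedy_walk:
  assumes "v \<in> verts G"
  shows "\<exists>p u. awalk v p u \<and> (n \<le> length p \<or> sink G u)"
  using assms
proof (induction n arbitrary: v)
  case 0
  then show ?case
    by (intro exI[of _ "[]"]) (auto simp: awalk_simps)
next
  case (Suc n)
  show ?case
  proof (cases "sink G v")
    case True
    then show ?thesis
      using Suc.prems by (intro exI[of _ "[]"]) (auto simp: awalk_simps)
  next
    case False
    then have "\<exists>e. e \<in> arcs G \<and> tail G e = v"
      using Suc.prems by (auto simp: sink_def)
    then obtain e where e: "e \<in> arcs G" "tail G e = v"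
      by blast
    then obtain p u where "awalk (head G e) p u" "n \<le> length p \<or> sink G u"
      using Suc.IH[of "head G e"] by auto
    then show ?thesis
      using e by (intro exI[of _ "e # p"] exI[of _ u]) (auto simp: awalk_simps)
  qed
qed

lemma infinite_path_walk:
  assumes "infinite_path G f"
  shows "awalk (tail G (f 0)) (map f [0..<n]) (tail G (f n))"
  using assms
proof (induction n)
  case (Suc n)
  then show ?case
    by (auto simp: infinite_path_def awalk_simps)
qed (auto simp: infinite_path_def awalk_simps)

lemma no_exit_edge:
  assumes "\<not> has_exit G c" "e \<in> arcs G" "tail G e \<in> cycle_verts G c"
  shows "e \<in> set c"
  using assms by (auto simp: has_exit_iff cycle_verts_def)

lemma head_in_cycle_verts:
  assumes "cycle c" "e \<in> set c"
  shows "head G e \<in> cycle_verts G c"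
proof -
  obtain i c' where c': "awalk (tail G e) (e # c') (tail G e)" "set (e # c') = set c"
    using cycle_rotate[OF assms] by metis
  show ?thesis
  proof (cases c')
    case Nil
    then show ?thesis
      using c' assms(2) by (auto simp: awalk_simps cycle_verts_def)
  next
    case (Cons f c'')
    then have "head G e = tail G f" "f \<in> set c"
      using c' by (auto simp: awalk_simps)
    then show ?thesis
      by (auto simp: cycle_verts_def)
  qed
qed

lemma no_exit_walk:
  assumes "cycle c" "\<not> has_exit G c" "awalk u p w" "u \<in> cycle_verts G c"
  shows "w \<in> cycle_verts G c"
  using assms(3,4)
proof (induction p arbitrary: u)
  case (Cons e p)
  then show ?case
    using no_exit_edge[OF assms(2)] head_in_cycle_verts[OF assms(1)] by (auto simp: awalk_simps)
qed (auto simp: awalk_simps)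

lemma awalk_appendD: "awalk u (p @ q) w \<Longrightarrow> awalk u p x \<Longrightarrow> awalk x q w"
  by (induction p arbitrary: u) (auto simp: awalk_simps)

text \<open>Without exits the continuation from a vertex of the cycle is forced, so after rotation
  to a common first edge one cycle is a prefix of the other. A nonempty remainder would be a closed
  walk starting again at the source of \<open>f\<close>, contrary to the distinctness of the
  sources.\<close>

lemma no_exit_same_cycle:
  assumes "cycle c" "cycle d" "\<not> has_exit G c" "\<not> has_exit G d"
    and "x \<in> cycle_verts G c" "x \<in> cycle_verts G d"
  shows "same_cycle c d"
proof -
  obtain e f where e: "e \<in> set c" "x = tail G e" and f: "f \<in> set d" "x = tail G f"
    using assms(5,6) by (auto simp: cycle_verts_def)
  have arcs: "set c \<subseteq> arcs G" "set d \<subseteq> arcs G"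
    using assms(1,2) by (auto simp: cycle_def)
  have "f \<in> set c"
    using no_exit_edge[OF assms(3)] arcs assms(5) f by blast
  obtain i c' where c': "rotate i c = f # c'" "awalk (tail G f) (f # c') (tail G f)"
    "distinct (map (tail G) (f # c'))" "set (f # c') = set c"
    using cycle_rotate[OF assms(1) \<open>f \<in> set c\<close>] by blast
  obtain j d' where d': "rotate j d = f # d'" "awalk (tail G f) (f # d') (tail G f)"
    "distinct (map (tail G) (f # d'))" "set (f # d') = set d"
    using cycle_rotate[OF assms(2) f(1)] by blast
  have comparable: "(\<exists>r. q = p @ r) \<or> (\<exists>r. p = q @ r)"
    if "awalk u p w" "awalk u q y" "set p \<subseteq> set c" for u p q w y
    using that
  proof (induction p arbitrary: u q)
    case (Cons e p)
    show ?case
    proof (cases q)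
      case (Cons e' q')
      have "e' = e"
        using Cons.prems Cons assms(3) by (auto simp: awalk_simps has_exit_iff)
      then show ?thesis
        using Cons.IH[of "head G e" q'] Cons.prems Cons by (auto simp: awalk_simps)
    qed auto
  qed auto
  have no_closed: "r = []" if "awalk (tail G f) (f # p) (tail G f)" "awalk (tail G f) ((f # p) @ r) (tail G f)"
    "distinct (map (tail G) ((f # p) @ r))" for p r
  proof (rule ccontr)
    assume "r \<noteq> []"
    then obtain g r' where "r = g # r'"
      by (cases r) auto
    moreover have "awalk (tail G f) r (tail G f)"
      by (rule awalk_appendD[OF that(2,1)])
    ultimately show False
      using that(3) by (auto simp: awalk_simps)
  qed
  have "f # c' = f # d'"
    using comparable[OF c'(2) d'(2)] no_closed[OF c'(2)] no_closed[OF d'(2)] c' d' by fastforce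
  moreover have "d \<noteq> []"
    using f(1) by auto
  ultimately show ?thesis
    using same_cycle_if_rotations_eq[of i c j d] c'(1) d'(1) by simp
qed

end

section \<open>From primeness to comets\<close>

context lpa
begin

lemma ex_vertex:
  assumes "A \<noteq> I"
  shows "\<exists>v. v \<in> verts E"
proof -
  obtain x where x: "x \<in> A" "x \<notin> I"
    using assms I_A by blast
  then have "x \<noteq> 0"
    by auto
  then obtain w where "w \<in> Poly_Mapping.keys x"
    by (metis keys_eq_empty ex_in_conv)
  then have "letters w \<noteq> []" "set (letters w) \<subseteq> lpa_gens E"
    using x unfolding A_def by (auto simp: lpa_words_def)
  then show ?thesis
    using gen_vertex_verts hd_in_set by blast
qed

lemma cycle_exit_all_scalar:
  assumes "prime_elementwise" "cycle c" "has_exit E c"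
  shows "all_scalar"
proof -
  obtain e d where e: "e \<in> arcs E" "d \<in> set c" "tail E e = tail E d" "e \<noteq> d"
    using assms(3) by (auto simp: has_exit_iff)
  \<comment> \<open>The cycle is rotated so that the exit leaves from its base, the position treated
    in \<open>exit_all_scalar\<close>.\<close>
  obtain i c' where c': "awalk (tail E d) (d # c') (tail E d)" "distinct (map (tail E) (d # c'))"
    using cycle_rotate[OF assms(2) e(2)] by metis
  interpret lpa_cycle E K "tail E d" "d # c'"
    by unfold_locales (use c' in auto)
  show ?thesis
    using exit_all_scalar[OF assms(1) e(1,3)] e(4) by simp
qed

text \<open>A walk cannot leave a cycle without exits. A monomial \<open>p q\<^sup>*\<close>
  surviving between a vertex of \<open>c\<close> and a vertex of \<open>d\<close> would have the
  common range of \<open>p\<close> and \<open>q\<close> on both cycles, so for different cycles all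
  of \<open>V u * a * V w\<close> vanishes, against primeness.\<close>

lemma prime_elementwise_no_exit_cycles:
  assumes "prime_elementwise" "cycle c" "cycle d" "\<not> has_exit E c" "\<not> has_exit E d"
  shows "same_cycle c d"
proof (rule ccontr)
  assume not_same: "\<not> same_cycle c d"
  have ex: "tail E (hd b) \<in> cycle_verts E b" "tail E (hd b) \<in> verts E" if "cycle b" for b
  proof -
    have "b \<noteq> []" "set b \<subseteq> arcs E"
      using that by (auto simp: cycle_def)
    then have "hd b \<in> set b" "hd b \<in> arcs E"
      by auto
    then show "tail E (hd b) \<in> cycle_verts E b" "tail E (hd b) \<in> verts E"
      by (auto simp: cycle_verts_def)
  qed
  obtain u w where u: "u \<in> cycle_verts E c" "u \<in> verts E" and w: "w \<in> cycle_verts E d" "w \<in> verts E"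
    using ex assms(2,3) by blast
  have "V u * a * V w \<in> I" if "a \<in> A" for a
    using that
  proof (induction rule: lpa_induct)
    case (monomial a p x b q)
    have "V u * pth a p \<in> I \<or> gst b q * V w \<in> I"
    proof (rule ccontr)
      assume not: "\<not> ?thesis"
      have "a = u"
        using V_pth[OF monomial(1) u(2)] not by (auto simp: eqv_0_iff split: if_splits)
      moreover have "b = w"
        using gst_V[OF monomial(2) w(2)] not by (auto simp: eqv_0_iff split: if_splits)
      ultimately have "x \<in> cycle_verts E c" "x \<in> cycle_verts E d"
        using no_exit_walk assms u w monomial by blast+
      then show False
        using no_exit_same_cycle assms not_same by blast
    qed
    then have "(V u * pth a p) * (gst b q * V w) \<in> I"
    proof
      assume "V u * pth a p \<in> I"
      then show ?thesis
        by (rule I_mult_right[rotated]) (use gst_A[OF monomial(2)] w in auto)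
    next
      assume "gst b q * V w \<in> I"
      then show ?thesis
        by (rule I_mult_left[rotated]) (use pth_A[OF monomial(1)] u in auto)
    qed
    then show ?case
      by (simp add: mult.assoc)
  next
    case (eqv x y)
    have "V u * x * V w \<approx> V u * y * V w"
      using eqv(2) u w by (intro eqv_mult_left eqv_mult_right) auto
    then show ?case
      using eqv.IH eqv_I by blast
  qed (auto simp: distrib_left distrib_right scal_mult_left scal_mult_right)
  then have "V u \<in> I \<or> V w \<in> I"
    using assms(1) u w unfolding prime_elementwise_def by blast
  then show False
    using V_notin_I u w by blast
qed

text \<open>Cycles have no exits, so primeness leaves at most one cycle up to rotation. By the
  criterion for paths without repeated vertices, sufficiently long walks from any vertex repeat a
  vertex, so every vertex leads to the cycle and every infinite path meets it; lacking exits, the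
  path then stays in it.\<close>

lemma all_scalar_or_comet:
  assumes "prime_elementwise" "\<not> all_scalar"
  shows "row_finite E \<and> comet E \<and> (\<forall>c. cycle c \<longrightarrow> \<not> has_exit E c)"
proof -
  have no_exit: "\<not> has_exit E c" if "cycle c" for c
    using cycle_exit_all_scalar assms that by blast
  \<comment> \<open>Negating the criterion also covers walks that end in a sink, whatever their
    length; hence the walk supplied by \<open>greedy_walk\<close> must repeat a vertex.\<close>
  have non_simple_walk: "\<exists>n. \<forall>p u. awalk v p u \<and> (n \<le> length p \<or> sink E u) \<longrightarrow> \<not> distinct (awalk_verts v p)" for v
    using all_scalar_if_simple_paths[OF assms(1), of v] assms(2) by blast
  have cycle_power: "\<exists>p u d. awalk v p u \<and> cycle d \<and> set d \<subseteq> set p" if "v \<in> verts E" for v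
    using non_simple_walk[of v] greedy_walk[OF that] not_distinct_cycle by metis
  have "A \<noteq> I"
    using assms(1) by (simp add: prime_elementwise_def)
  then obtain c where c: "cycle c"
    using ex_vertex cycle_power by blast
  have unique: "same_cycle c d" if "cycle d" for d
    using prime_elementwise_no_exit_cycles[OF assms(1) c that] no_exit c that by blast
  have set_eq: "set d = set c" and d_ne: "d \<noteq> []" if "cycle d" for d
    using same_cycle_set[OF unique[OF that]] that by (auto simp: cycle_def)
  have "vertex_tree E v \<inter> cycle_verts E c \<noteq> {}" if "v \<in> verts E" for v
  proof -
    obtain p u d where p: "awalk v p u" "cycle d" "set d \<subseteq> set p"
      using cycle_power[OF \<open>v \<in> verts E\<close>] by blast
    then obtain e where e: "e \<in> set p" "e \<in> set c"
      using set_eq d_ne by (metis hd_in_set subsetD)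
    then obtain x y where "p = x @ e # y"
      by (auto simp: in_set_conv_decomp)
    then have "awalk v x (tail E e)"
      using p(1) by (auto simp: awalk_simps dest: awalk_ends)
    then show ?thesis
      using e(2) by (auto simp: vertex_tree_def cycle_verts_def)
  qed
  moreover have "ends_in_cycle f c" if f: "infinite_path E f" for f
  proof -
    obtain n where n: "\<not> distinct (awalk_verts (tail E (f 0)) (map f [0..<n]))"
      using non_simple_walk[of "tail E (f 0)"] infinite_path_walk[OF f]
      by (metis length_map length_upt diff_zero order_refl)
    obtain d where d: "cycle d" "set d \<subseteq> set (map f [0..<n])"
      using not_distinct_cycle[OF infinite_path_walk[OF f] n] by blast
    then have "hd d \<in> set (map f [0..<n])" "hd d \<in> set c"
      using set_eq d_ne by (metis hd_in_set subsetD)+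
    then obtain i where i: "f i \<in> set c"
      by auto
    have "f (i + k) \<in> set c" for k
    proof (induction k)
      case (Suc k)
      have "tail E (f (i + Suc k)) \<in> cycle_verts E c"
        using head_in_cycle_verts[OF c Suc] f by (auto simp: infinite_path_def)
      then show ?case
        using no_exit_edge[OF no_exit[OF c]] f by (auto simp: infinite_path_def)
    qed (use i in simp)
    then show ?thesis
      unfolding ends_in_cycle_def by (metis le_iff_add)
  qed
  moreover have "row_finite E"
    using infinite_emitter_all_scalar assms by (auto simp: row_finite_def)
  ultimately show ?thesis
    using c unique no_exit unfolding comet_def unique_cycle_def by blast
qed

lemma idl_walk:
  assumes "idl P" "awalk u p w" "V u \<in> P"
  shows "V w \<in> P"
proof -
  have "gst u p * V u * pth u p \<approx> V w"
    using eqv_trans[OF eqv_mult_right[OF pth_A[OF assms(2)] ] gst_pth_same[OF assms(2)]]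
      gst_V[OF assms(2), of u] assms(2) by auto
  moreover have "gst u p * V u * pth u p \<in> P"
    using assms gst_A[OF assms(2)] pth_A[OF assms(2)] by (auto simp: idl_def)
  ultimately show ?thesis
    using idl_eqv[OF assms(1) eqv_sym] by blast
qed

text \<open>The vertices of \<open>P\<close> include those of the cycle, and a regular vertex all of
  whose edges end in vertices of \<open>P\<close> lies in \<open>P\<close>. So a vertex outside
  \<open>P\<close> has an edge to another one outside \<open>P\<close>, and iterating gives an
  infinite path that avoids \<open>P\<close>; it would have to end in the cycle.\<close>

lemma comet_idl_full:
  assumes "row_finite E" and c: "cycle c"
    and tree: "\<And>v. v \<in> verts E \<Longrightarrow> vertex_tree E v \<inter> cycle_verts E c \<noteq> {}"
    and inf: "\<And>f. infinite_path E f \<Longrightarrow> ends_in_cycle f c"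
    and v: "v \<in> cycle_verts E c" and P: "idl P" "V v \<in> P"
  shows "P = A"
proof -
  have P': "\<And>x. x \<in> I \<Longrightarrow> x \<in> P" "\<And>x y. x \<in> P \<Longrightarrow> y \<in> P \<Longrightarrow> x + y \<in> P"
    "\<And>x c. x \<in> P \<Longrightarrow> scal c x \<in> P" "\<And>a x. a \<in> A \<Longrightarrow> x \<in> P \<Longrightarrow> a * x \<in> P"
    "\<And>a x. a \<in> A \<Longrightarrow> x \<in> P \<Longrightarrow> x * a \<in> P"
    using P(1) by (auto simp: idl_def)
  have cP: "V (tail E e) \<in> P" if e: "e \<in> set c" for e
  proof -
    obtain d where d: "d \<in> set c" "v = tail E d"
      using v by (auto simp: cycle_verts_def)
    obtain i c' where c': "awalk v (d # c') v" "set (d # c') = set c"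
      using cycle_rotate[OF c d(1)] d(2) by metis
    then obtain x y where "d # c' = x @ e # y"
      using e by (metis in_set_conv_decomp)
    then have "awalk v x (tail E e)"
      using c'(1) by (auto simp: awalk_simps dest: awalk_ends)
    then show ?thesis
      using idl_walk P by blast
  qed
  have next_edge: "\<exists>e\<in>out_arcs E w. V (head E e) \<notin> P" if w: "w \<in> verts E" "V w \<notin> P" for w
  proof (rule ccontr)
    assume contra: "\<not> ?thesis"
    have "\<not> sink E w"
    proof
      assume "sink E w"
      obtain x p where p: "awalk w p x" "x \<in> cycle_verts E c"
        using tree[OF w(1)] by (auto simp: vertex_tree_def)
      then have "x = w"
        using \<open>sink E w\<close> by (cases p) (auto simp: awalk_simps sink_def)
      then show False
        using p(2) cP w(2) by (auto simp: cycle_verts_def)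
    qed
    then have "regular_vertex E w"
      using w(1) assms(1) by (auto simp: regular_vertex_def row_finite_def)
    then have sum: "V w \<approx> (\<Sum>e\<in>out_arcs E w. Ed e * Gh e)"
      by (rule V_sum)
    have edge: "Ed e * Gh e \<in> P" if "e \<in> out_arcs E w" for e
    proof -
      have e: "e \<in> arcs E" "V (head E e) \<in> P"
        using that contra by auto
      then have "Ed e * V (head E e) * Gh e \<in> P"
        using P' by auto
      moreover have "Ed e * Gh e \<approx> Ed e * V (head E e) * Gh e"
        using e by (intro eqv_mult_right eqv_sym[OF Ed_V]) auto
      ultimately show ?thesis
        using idl_eqv P(1) by blast
    qed
    have "(\<Sum>e\<in>T. Ed e * Gh e) \<in> P" if "T \<subseteq> out_arcs E w" for T
      using that edge P' by (induction T rule: infinite_finite_induct) auto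
    then show False
      using w(2) idl_eqv[OF P(1) sum] by blast
  qed
  have VP: "V w \<in> P" if w: "w \<in> verts E" for w
  proof (rule ccontr)
    assume "V w \<notin> P"
    define nxt where "nxt u = (SOME e. e \<in> out_arcs E u \<and> V (head E e) \<notin> P)" for u
    have nxt: "nxt u \<in> arcs E" "tail E (nxt u) = u" "V (head E (nxt u)) \<notin> P"
      if "u \<in> verts E" "V u \<notin> P" for u
    proof -
      have "\<exists>e. e \<in> out_arcs E u \<and> V (head E e) \<notin> P"
        using next_edge that by blast
      from someI_ex[OF this] show "nxt u \<in> arcs E" "tail E (nxt u) = u" "V (head E (nxt u)) \<notin> P"
        by (auto simp: nxt_def)
    qed
    define pos where "pos n = ((\<lambda>u. head E (nxt u)) ^^ n) w" for n
    have pos: "pos n \<in> verts E \<and> V (pos n) \<notin> P" for n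
      by (induction n) (use w \<open>V w \<notin> P\<close> nxt in \<open>auto simp: pos_def\<close>)
    have "infinite_path E (\<lambda>n. nxt (pos n))"
      unfolding infinite_path_def
    proof (intro allI conjI)
      fix n
      show "nxt (pos n) \<in> arcs E"
        using nxt pos by blast
      have "pos (Suc n) = head E (nxt (pos n))"
        by (simp add: pos_def)
      then show "head E (nxt (pos n)) = tail E (nxt (pos (Suc n)))"
        using nxt(2) pos by metis
    qed
    then obtain n where "nxt (pos n) \<in> set c"
      using inf by (auto simp: ends_in_cycle_def)
    then have "V (tail E (nxt (pos n))) \<in> P"
      by (rule cP)
    then show False
      using nxt(2) pos by metis
  qed
  have "x \<in> P" if "x \<in> A" for x
    using that
  proof (induction rule: lpa_induct)
    case (monomial a p w b q)
    note A = pth_A[OF monomial(1)] gst_A[OF monomial(2)]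
    have a: "a \<in> verts E"
      using monomial by auto
    have "V a * pth a p \<in> P"
      by (rule P'(5)[OF A(1) VP[OF a]])
    then have "pth a p \<in> P"
      using V_pth[OF monomial(1) a] idl_eqv[OF P(1) eqv_sym] by auto
    then show ?case
      by (rule P'(5)[OF A(2)])
  next
    case (eqv x y)
    then show ?case
      using idl_eqv[OF P(1) eqv_sym] by blast
  qed (use P' in auto)
  then show ?thesis
    using P(1) by (auto simp: idl_def)
qed

lemma comet_centroid:
  assumes "prime_elementwise" "row_finite E" "comet E" "\<And>c. cycle c \<Longrightarrow> \<not> has_exit E c"
  shows "alg_isomorphic (centroid L) laurent_algebra" "\<not> alg_simple L"
proof -
  obtain c where c: "cycle c" "\<And>v. v \<in> verts E \<Longrightarrow> vertex_tree E v \<inter> cycle_verts E c \<noteq> {}"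
    "\<And>f. infinite_path E f \<Longrightarrow> ends_in_cycle f c"
    using assms(3) by (auto simp: comet_def unique_cycle_def)
  obtain u where u: "awalk u c u" "distinct (map (tail E) c)" "c \<noteq> []"
    using c(1) cycle_iff_distinct_sources by blast
  have "\<not> has_exit E c"
    using assms(4) c(1) by blast
  then interpret lpa_no_exit E K u c
    using u by unfold_locales (auto simp: has_exit_iff)
  have "u \<in> cycle_verts E c"
    using u(1,3) by (cases c) (auto simp: awalk_simps cycle_verts_def)
  then have full: "P = A" if "idl P" "V u \<in> P" for P
    using comet_idl_full[OF assms(2) c(1) _ _ _ that] c(2,3) by blast
  show "alg_isomorphic (centroid L) laurent_algebra"
    by (rule centroid_isomorphic_laurent[OF assms(1) full])
  show "\<not> alg_simple L"
    by (rule not_simple[OF full])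
qed

lemma leavitt_path_algebra_eq: "leavitt_path_algebra K E = L"
  by (simp add: leavitt_path_algebra_def L_def free_algebra_eq)

lemma lpa_component_eq: "lpa_component K E = component"
  by (rule ext) (simp add: lpa_component_def component_def cls_def free_algebra_eq S_simps)

end

theorem theorem6p1:
  fixes E :: "('v, 'e) pre_digraph"
  assumes "wf_digraph E"
  defines "L \<equiv> leavitt_path_algebra TYPE('k::field) E"
    and "D \<equiv> lpa_component TYPE('k) E"
  shows
    "(alg_simple L \<longrightarrow> alg_isomorphic (centroid L) base_field_algebra) \<and>
     (row_finite E \<and> alg_graded_simple L D \<and> \<not> alg_simple L \<longrightarrow>
        comet E \<and> alg_isomorphic (centroid L) laurent_algebra) \<and>
     (alg_prime L \<and> acyclic_graph E \<longrightarrow> alg_isomorphic (centroid L) base_field_algebra) \<and>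
     (alg_prime L \<and> (\<exists>c. pre_digraph.cycle E c \<and> has_exit E c) \<longrightarrow>
        alg_isomorphic (centroid L) base_field_algebra) \<and>
     (alg_prime L \<and>
        (\<exists>v. infinite_emitter E v \<and> (\<nexists>c. pre_digraph.cycle E c \<and> cycle_base E c = v)) \<longrightarrow>
        alg_isomorphic (centroid L) base_field_algebra) \<and>
     (row_finite E \<and> alg_prime L \<and> (\<exists>c. unique_cycle E c \<and> \<not> has_exit E c) \<longrightarrow>
        (\<not> comet E \<longrightarrow> alg_isomorphic (centroid L) base_field_algebra) \<and>
        (comet E \<longrightarrow> alg_isomorphic (centroid L) laurent_algebra))"
proof -
  interpret lpa E "TYPE('k)"
    using assms(1) by (simp add: lpa_def)
  have L: "L = local.L" and D: "D = component"
    unfolding assms(2,3) by (rule leavitt_path_algebra_eq lpa_component_eq)+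
  have scalar: "alg_isomorphic (centroid local.L) base_field_algebra" if "prime_elementwise" "all_scalar"
    using all_scalar_imp_isomorphic that by (auto simp: prime_elementwise_def)
  have "alg_isomorphic (centroid local.L) base_field_algebra" if "alg_simple local.L"
    using alg_simple_imp_prime_elementwise[OF that] all_scalar_or_comet comet_centroid(2) scalar that by blast
  moreover have "comet E \<and> alg_isomorphic (centroid local.L) laurent_algebra"
    if "alg_graded_simple local.L component" "\<not> alg_simple local.L"
    using graded_simple_imp_prime_elementwise[OF that(1)] graded_simple_not_all_scalar[OF that] all_scalar_or_comet comet_centroid(1) by blast
  \<comment> \<open>The scalar claims for prime algebras each contradict one conjunct of the comet
    alternative: acyclicity and not being a comet the second, a cycle with an exit the third, an
    infinite emitter the first.\<close>
  moreover have "alg_isomorphic (centroid local.L) base_field_algebra"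
    if "alg_prime local.L" "\<not> (row_finite E \<and> comet E \<and> (\<forall>c. cycle c \<longrightarrow> \<not> has_exit E c))"
    using alg_prime_imp_prime_elementwise[OF that(1)] all_scalar_or_comet that(2) scalar by blast
  moreover have "\<not> comet E" if "acyclic_graph E"
    using that by (auto simp: acyclic_graph_def comet_def unique_cycle_def)
  moreover have "\<not> row_finite E" if "infinite_emitter E v" for v
    using that by (auto simp: row_finite_def)
  moreover have "alg_isomorphic (centroid local.L) laurent_algebra"
    if "alg_prime local.L" "row_finite E" "comet E" "unique_cycle E c" "\<not> has_exit E c" for c
  proof (rule comet_centroid(1)[OF alg_prime_imp_prime_elementwise[OF that(1)] that(2,3)])
    \<comment> \<open>Every cycle is a rotation of \<open>c\<close>, and having an exit depends only
      on the set of edges of the cycle.\<close>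
    fix d assume "cycle d"
    then have "set d = set c"
      using that(4) same_cycle_set by (auto simp: unique_cycle_def)
    then show "\<not> has_exit E d"
      using that(5) by (simp add: has_exit_iff)
  qed
  ultimately show ?thesis
    unfolding L D by blast
qed

end
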